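(* Let $d\ge 2$, $I=[0,1]$, let $\gamma:I\to\mathbb R^d$ be of class $C^{d+1}(I)$, let $0<\alpha\le d$, and let $\mu$ be a positive Borel measure on $\mathbb R^d$. Suppose that $\det(\gamma'(t),\gamma''(t),\dots,\gamma^{(d)}(t))\neq 0$ for all $t\in I$, and that there is a constant $C_\mu$ such that $\mu(B(x,\rho))\le C_\mu\rho^\alpha$ for all $x\in\mathbb R^d$ and all $\rho>0$. Let $1\le p,q\le\infty$ satisfy \[ \frac dq\le 1-\frac1p,\qquad q\ge 2d,\qquad \frac{\beta(\alpha)}{q}+\frac1p<1,\qquad q>\beta(\alpha)+1 . \] Then there exists a constant $C$ such that \[ \|T_\lambda^\gamma f\|_{L^q(d\mu)}\le C\lambda^{-\frac{\alpha}{q}}\|f\|_{L^p(I)} \] for all $f\in L^p(I)$ and all $\lambda\ge 1$.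
   Context: $B(x,\rho)$ is the ball in $\mathbb R^d$ of radius $\rho$ centred at $x$. The operator is $T_\lambda^\gamma f(x)=\int_I e^{i\lambda x\cdot\gamma(t)}f(t)\,dt$, $x\in\mathbb R^d$. For $0<\alpha\le d$, the number $\beta(\alpha)$ is defined by $\beta(\alpha)=(j+1)\alpha+\frac{(d-j-1)(d-j)}{2}$ if $d-j-1<\alpha\le d-j$, $j=0,\dots,d-1$. *)

theory Defs
  imports "HOL-Analysis.Analysis" "HOL-Probability.Essential_Supremum"
begin

text \<open>Iterated derivatives relative to \<open>S\<close>; at an endpoint of an interval these are the
  one-sided derivatives.  For \<open>t \<in> S\<close> the value at \<open>t\<close> depends only on the restriction of
  \<open>\<gamma>\<close> to \<open>S\<close>.\<close>

primrec nth_deriv_within ::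
    "nat \<Rightarrow> real set \<Rightarrow> (real \<Rightarrow> 'a::real_normed_vector) \<Rightarrow> real \<Rightarrow> 'a" where
  "nth_deriv_within 0 S \<gamma> = \<gamma>"
| "nth_deriv_within (Suc k) S \<gamma> =
     (\<lambda>t. vector_derivative (nth_deriv_within k S \<gamma>) (at t within S))"

definition Ck_on :: "nat \<Rightarrow> real set \<Rightarrow> (real \<Rightarrow> 'a::real_normed_vector) \<Rightarrow> bool" where
  "Ck_on k S \<gamma> \<longleftrightarrow>
     (\<forall>j<k. nth_deriv_within j S \<gamma> differentiable_on S) \<and>
     continuous_on S (nth_deriv_within k S \<gamma>)"

text \<open>The matrix with columns \<open>\<gamma>'(t), \<gamma>''(t), \<dots>, \<gamma>\<^bsup>(d)\<^esup>(t)\<close>, where \<open>d = CARD('n)\<close>.  As \<open>'n\<close> carries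
  no order, its elements are numbered \<open>0, \<dots>, d - 1\<close> by \<^const>\<open>to_nat_on\<close>; another numbering
  changes the determinant at most by a sign.\<close>

definition deriv_matrix :: "real set \<Rightarrow> (real \<Rightarrow> real ^ 'n) \<Rightarrow> real \<Rightarrow> real ^ 'n ^ 'n::finite" where
  "deriv_matrix S \<gamma> t =
     (\<chi> i j. nth_deriv_within (Suc (to_nat_on (UNIV :: 'n set) j)) S \<gamma> t $ i)"

definition beta :: "nat \<Rightarrow> real \<Rightarrow> real" where
  "beta d \<alpha> =
     (let j = (THE j::nat. j < d \<and> real d - real j - 1 < \<alpha> \<and> \<alpha> \<le> real d - real j)
      in (real j + 1) * \<alpha> + (real d - real j - 1) * (real d - real j) / 2)"

lemma beta_eq:
  assumes "j < d" "real d - real j - 1 < \<alpha>" "\<alpha> \<le> real d - real j"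
  shows "beta d \<alpha> = (real j + 1) * \<alpha> + (real d - real j - 1) * (real d - real j) / 2"
proof -
  have "(THE j::nat. j < d \<and> real d - real j - 1 < \<alpha> \<and> \<alpha> \<le> real d - real j) = j"
    using assms by (intro the_equality) linarith+
  then show ?thesis
    by (simp add: beta_def)
qed

text \<open>The norm of \<open>L\<^sup>p(M)\<close> for \<open>1 \<le> p \<le> \<infinity>\<close>, with values in \<open>[0, \<infinity>]\<close>.\<close>

definition Lp_norm :: "'a measure \<Rightarrow> ereal \<Rightarrow> ('a \<Rightarrow> complex) \<Rightarrow> ennreal" where
  "Lp_norm M p f =
     (if p = \<infinity> then esssup M (\<lambda>x. ennreal (norm (f x)))
      else let r = real_of_ereal p; J = (\<integral>\<^sup>+ x. ennreal (norm (f x) powr r) \<partial>M)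
           in if J = \<infinity> then \<infinity> else ennreal (enn2real J powr (1 / r)))"

definition Lp_space :: "'a measure \<Rightarrow> ereal \<Rightarrow> ('a \<Rightarrow> complex) set" where
  "Lp_space M p = {f \<in> borel_measurable M. Lp_norm M p f < \<infinity>}"

definition osc_op ::
    "(real \<Rightarrow> real ^ 'n) \<Rightarrow> real \<Rightarrow> (real \<Rightarrow> complex) \<Rightarrow> real ^ 'n::finite \<Rightarrow> complex" where
  "osc_op \<gamma> lam f x =
     (LINT t|lebesgue_on {0..1}. exp (\<i> * of_real (lam * (x \<bullet> \<gamma> t))) * f t)"

end

theory Submission
  imports Defs "HOL-Probability.Characteristic_Functions" "HOL-Real_Asymp.Real_Asymp"
begin

text \<open>The argument follows the broad-narrow scheme of Bourgain and Guth instead of offspring curves.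
  Split an interval \<open>J\<close> of length \<open>l\<close> into \<open>A\<close> equal pieces.  At each point either a few pieces dominate,
  so that \<open>|T f\<^sub>J|\<close> is controlled by the \<open>\<ell>\<^sup>q\<close> sum over the pieces with a constant depending only on \<open>d\<close>, or
  \<open>d\<close> pairwise separated pieces are large and \<open>|T f\<^sub>J|\<close> is bounded by their geometric mean.  The product of \<open>d\<close>
  separated pieces is the Fourier transform of a density on \<open>\<real>\<^sup>d\<close>, supported in a box with sides
  \<open>l, l\<^sup>2, \<dots>, l\<^sup>d\<close>; a \<open>TT\<^sup>*\<close> argument with a Gaussian weight adapted to that box gives an \<open>L\<^sup>2(\<mu>)\<close> bound, in which
  the \<open>\<mu>\<close>-measure of the dual box produces \<open>l\<close> to the power \<open>-\<beta>(\<alpha>)\<close>, and interpolation with the trivial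
  \<open>L\<^sup>1\<close>-\<open>L\<^sup>\<infinity>\<close> bound covers the other exponents.  Both terms then carry the factor \<open>l\<^sup>e\<close> with
  \<open>e = q (1 - 1/p) - \<beta>(\<alpha>) > 0\<close>, so for large \<open>A\<close> the dominated case is a contraction and the iteration closes.
  If \<open>p > q\<close>, it suffices to treat \<open>p = q\<close>, where \<open>e > 0\<close> is the condition \<open>q > \<beta>(\<alpha>) + 1\<close>.\<close>

section \<open>Interpolation\<close>

text \<open>Neither the curve nor the measure is ever rescaled. A short arc stays where it is and
  its scale enters only through the coordinates \<open>anis\<close> and \<open>coord\<close>, so all
  constants are uniform in its position and no rescaled measure has to be controlled. Nor is there a
  change of variables with a Jacobian: the L^2 argument asks only how much product measure is sent
  into a small cube, and mean velocities answer that. The contraction rests on three points. The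
  constant of the dominated case is free of A. Some finite bound must be known in advance, so \<mu>
  is cut down to a ball; that bound enters with the weight 2^(-n) after n steps and is gone before
  the ball grows. And the pieces are recombined by the embedding of l^p in l^q, which forces p <= q.
  The other conditions enter through the product of d pieces. It is measured in the exponent q/d,
  and q >= 2d makes this at least 2, where the L^2 bound can be interpolated. The condition d/q <= 1
  - 1/p says that the exponent conjugate to q/d is at most p, so that Hoelder's inequality on a
  short arc yields a nonnegative power of its length.\<close>

lemma nn_integral_powr_Icc:
  fixes a c :: real
  assumes "a > -1" "c \<ge> 0"
  shows "(\<integral>\<^sup>+s. ennreal (s powr a) * indicator {0..c} s \<partial>lborel) = ennreal (c powr (a + 1) / (a + 1))"
proof -
  have "((\<lambda>x. x powr a) has_integral (c powr (a+1) / (a+1))) {0..c}"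
    by (rule has_integral_powr_from_0) (use assms in auto)
  then have "(\<integral>\<^sup>+x. ennreal (indicator {0..c} x * x powr a) \<partial>lborel) = ennreal (c powr (a+1) / (a+1))"
    by (rule nn_integral_has_integral_lebesgue[rotated]) auto
  then show ?thesis
    by (simp add: mult.commute ennreal_mult' ennreal_indicator)
qed

text \<open>Real interpolation between the assumed L^2 bound and the trivial L^1-L^\<infinity> bound
  that \<open>K1\<close> provides. Since (r/(r-1)) (r-1) = r, the right side is the r-th power of
  the norm of \<open>F\<close> in the dual exponent. \<open>F\<close> is truncated at a height that
  depends on the level s. The constant blows up as r tends to 2, where the L^2 bound itself takes
  over.\<close>

lemma restricted_marcinkiewicz:
  fixes K :: "'x \<Rightarrow> 't \<Rightarrow> complex" and F :: "'t \<Rightarrow> complex" and B r N :: real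
  assumes mu: "sigma_finite_measure \<mu>" and P: "finite_measure P"
    and K[measurable]: "case_prod K \<in> borel_measurable (\<mu> \<Otimes>\<^sub>M P)"
    and K1: "\<And>x t. norm (K x t) \<le> 1"
    and B: "B \<ge> 0"
    and L2: "\<And>G. G \<in> borel_measurable P \<Longrightarrow> integrable P (\<lambda>t. (norm (G t))\<^sup>2) \<Longrightarrow>
      (\<integral>\<^sup>+x. ennreal ((norm (LINT t|P. G t * K x t))\<^sup>2) \<partial>\<mu>) \<le> ennreal (B * (LINT t|P. (norm (G t))\<^sup>2))"
    and r: "r > 2"
    and F[measurable]: "F \<in> borel_measurable P"
    and Fint: "integrable P (\<lambda>t. norm (F t) powr (r / (r - 1)))"
    and N: "N = (LINT t|P. norm (F t) powr (r / (r - 1)))"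
  shows "(\<integral>\<^sup>+x. ennreal (norm (LINT t|P. F t * K x t) powr r) \<partial>\<mu>)
     \<le> ennreal (4 * r * 2 powr (r - 2) / (r - 2) * B * N powr (r - 1))"
proof -
  let ?S = "\<lambda>x. LINT t|P. F t * K x t"
  interpret mu: sigma_finite_measure \<mu> by fact
  interpret P: finite_measure P by fact
  define b where "b = 1 / (r - 1)"
  have b: "b > 0" "r / (r - 1) = 1 + b" "b * (r - 2) = 1 - b"
    using r by (auto simp: b_def field_simps)
  have Km[measurable]: "(\<lambda>t. K x t) \<in> borel_measurable P" if "x \<in> space \<mu>" for x
    using measurable_compose[OF measurable_Pair1'[OF that] K] by simp
  have le: "u \<le> 1 + u powr (1 + b)" if "u \<ge> 0" for u :: real
  proof (cases "u \<le> 1")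
    case False
    then have "u powr 1 \<le> u powr (1 + b)" using b by (intro powr_mono) auto
    then show ?thesis using False by simp
  qed (use powr_ge_zero[of u "1+b"] in linarith)
  have Fi: "integrable P F"
    by (rule Bochner_Integration.integrable_bound[of _ "\<lambda>t. 1 + norm (F t) powr (1 + b)"])
       (use Fint b le in \<open>auto intro!: Bochner_Integration.integrable_add order_trans[OF le]\<close>)
  have gm[measurable]: "(\<lambda>x. LINT t|P. F t * K x t) \<in> borel_measurable \<mu>"
    by measurable
  have N0: "N \<ge> 0" unfolding N by simp
  show ?thesis
  proof (cases "N = 0")
    case True
    then have "AE t in P. norm (F t) powr (r / (r - 1)) = 0"
      using Fint N by (subst integral_nonneg_eq_0_iff_AE[symmetric]) auto
    then have ae: "AE t in P. F t = 0" by eventually_elim auto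
    have "(?S x) = 0" for x
      by (rule integral_eq_zero_AE) (use ae in \<open>eventually_elim, auto\<close>)
    then show ?thesis by simp
  next
    case False
    then have Np: "N > 0" using N0 by simp
    \<comment> \<open>The cut is placed so that the discarded part has L^1 norm at most s/2: where s
      |F|^b > 2N one has |F| <= s/(2N) |F|^(1+b), and the integral of |F|^(1+b) is N.\<close>
    define G where "G s t = (if s * norm (F t) powr b \<le> 2 * N then F t else 0)" for s t
    let ?R = "\<lambda>s x. LINT t|P. G s t * K x t"
    let ?k = "\<lambda>s x. ennreal r * (ennreal (s powr (r - 1)) * indicator {0..norm (?S x)} s)"
    let ?h = "\<lambda>s t. ennreal (4 * r * B * (norm (F t))\<^sup>2 * s powr (r - 3)) * indicator {0..2 * N * norm (F t) powr (-b)} s"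
    have Gm[measurable]: "G s \<in> borel_measurable P" for s unfolding G_def by measurable
    have G2[measurable]: "case_prod G \<in> borel_measurable (lborel \<Otimes>\<^sub>M P)" unfolding G_def by measurable
    have GF: "norm (G s t) \<le> norm (F t)" for s t by (auto simp: G_def)
    have Gi: "integrable P (G s)" for s
      by (rule Bochner_Integration.integrable_bound[OF Fi]) (auto simp: GF)
    have Gbd: "norm (G s t) \<le> (2 * N / s) powr (1/b)" if s: "s > 0" for s t
    proof (cases "G s t = 0")
      case False
      then have *: "norm (F t) powr b \<le> 2 * N / s" "G s t = F t"
        using s by (auto simp: G_def field_simps split: if_splits)
      then have "(norm (F t) powr b) powr (1/b) \<le> (2 * N / s) powr (1/b)"
        using b by (intro powr_mono2) auto
      then show ?thesis using b * by (simp add: powr_powr)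
    qed simp
    have Gsq: "integrable P (\<lambda>t. (norm (G s t))\<^sup>2)" if "s > 0" for s
      by (rule P.integrable_const_bound[of _ "((2 * N / s) powr (1/b))\<^sup>2"])
         (use Gbd[OF that] in \<open>auto intro!: power_mono\<close>)
    let ?z = "\<lambda>t. 4 * r * B * (2 * N) powr (r - 2) / (r - 2) * norm (F t) powr (1 + b)"
    \<comment> \<open>As |K| <= 1, the discarded part changes the integral by at most s/2, so the
      level set of the full integral at s lies in that of the truncated one at s/2.\<close>
    have key: "s / 2 \<le> norm (?R s x)"
      if s: "s > 0" and x: "x \<in> space \<mu>" and le: "s \<le> norm (?S x)" for s x
    proof -
      have i1: "integrable P (\<lambda>t. F t * K x t)"
        by (rule Bochner_Integration.integrable_bound[OF Fi])
           (use x K1 in \<open>auto simp: norm_mult mult_left_le\<close>)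
      have i2: "integrable P (\<lambda>t. G s t * K x t)"
        by (rule Bochner_Integration.integrable_bound[OF Gi[of s]])
           (use x K1 in \<open>auto simp: norm_mult mult_left_le\<close>)
      have "norm (LINT t|P. F t * K x t - G s t * K x t) \<le> (LINT t|P. s / (2*N) * norm (F t) powr (1 + b))"
      proof (rule order_trans[OF integral_norm_bound integral_mono])
        show "integrable P (\<lambda>t. norm (F t * K x t - G s t * K x t))" using i1 i2 by simp
        show "integrable P (\<lambda>t. s / (2 * N) * norm (F t) powr (1 + b))" using Fint b by simp
        fix t
        have "norm (F t * K x t - G s t * K x t) = norm (F t - G s t) * norm (K x t)"
          by (simp add: norm_mult[symmetric] algebra_simps)
        also have "\<dots> \<le> norm (F t - G s t)" by (simp add: K1 mult_left_le)
        also have "\<dots> \<le> s / (2*N) * norm (F t) powr (1 + b)"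
        proof (cases "s * norm (F t) powr b \<le> 2 * N")
          case False
          then have "1 \<le> s / (2*N) * norm (F t) powr b" using Np by (simp add: field_simps)
          then have "norm (F t) * 1 \<le> norm (F t) * (s / (2*N) * norm (F t) powr b)"
            by (intro mult_left_mono) auto
          then show ?thesis using False by (simp add: G_def powr_add mult_ac powr_one)
        qed (use s Np in \<open>auto simp: G_def\<close>)
        finally show "norm (F t * K x t - G s t * K x t) \<le> s / (2*N) * norm (F t) powr (1 + b)" .
      qed
      also have "\<dots> = s / 2" using N Np b by simp
      finally have "norm ((?S x) - (?R s x)) \<le> s / 2"
        using i1 i2 by simp
      then show ?thesis using le norm_triangle_ineq2[of "?S x" "?R s x"] by linarith
    qed
    \<comment> \<open>Layer-cake formula: the r-th power of a size is the integral of r s^(r-1) over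
      the levels s below it.\<close>
    have "(\<integral>\<^sup>+x. ennreal (norm (?S x) powr r) \<partial>\<mu>)
       = (\<integral>\<^sup>+x. (\<integral>\<^sup>+s. ?k s x \<partial>lborel) \<partial>\<mu>)"
    proof (intro nn_integral_cong)
      fix x
      show "ennreal (norm (?S x) powr r) = (\<integral>\<^sup>+s. ?k s x \<partial>lborel)"
        using r by (subst nn_integral_cmult, simp, subst nn_integral_powr_Icc)
          (auto simp: ennreal_mult[symmetric])
    qed
    also have "\<dots> = (\<integral>\<^sup>+s. (\<integral>\<^sup>+x. ?k s x \<partial>\<mu>) \<partial>lborel)"
    proof -
      interpret L: pair_sigma_finite lborel \<mu> ..
      show ?thesis
        by (rule L.Fubini') (simp add: indicator_def, measurable)
    qed
    also have "\<dots> \<le> (\<integral>\<^sup>+s. (\<integral>\<^sup>+t. ?h s t \<partial>P) \<partial>lborel)"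
    proof (intro nn_integral_mono)
      fix s :: real
      show "(\<integral>\<^sup>+x. ?k s x \<partial>\<mu>)
        \<le> (\<integral>\<^sup>+t. ?h s t \<partial>P)"
      proof (cases "s > 0")
        case False
        then have "ennreal (s powr (r - 1)) * indicator {0..norm (?S x)} s = 0" for x
          using r by (cases "s = 0") auto
        then show ?thesis by (simp only: mult_zero_right) simp
      next
        case s: True
        \<comment> \<open>Chebyshev at height s/2 with exponent 2; this costs the factor 4 and turns
          s^(r-1) into s^(r-3).\<close>
        have "(\<integral>\<^sup>+x. ?k s x \<partial>\<mu>)
          \<le> (\<integral>\<^sup>+x. ennreal (4 * r * s powr (r - 3)) * ennreal ((norm (?R s x))\<^sup>2) \<partial>\<mu>)"
        proof (intro nn_integral_mono)
          fix x assume x: "x \<in> space \<mu>"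
          show "?k s x
            \<le> ennreal (4 * r * s powr (r - 3)) * ennreal ((norm (?R s x))\<^sup>2)"
          proof (cases "s \<le> norm (?S x)")
            case True
            have "(s/2)\<^sup>2 \<le> (norm (?R s x))\<^sup>2"
              using key[OF s x True] s by (intro power_mono) auto
            then have "4 * r * s powr (r - 3) * (s/2)\<^sup>2 \<le> 4 * r * s powr (r - 3) * (norm (?R s x))\<^sup>2"
              using r by (intro mult_left_mono) auto
            moreover have "s powr (r - 1) = s powr (r - 3) * s\<^sup>2"
              using s powr_add[of s "r - 3" 2] by (simp add: powr_numeral)
            ultimately have "r * s powr (r - 1) \<le> 4 * r * s powr (r - 3) * (norm (?R s x))\<^sup>2"
              by (simp add: power2_eq_square)
            then show ?thesis using True s r
              by (auto simp: ennreal_mult'[symmetric] ennreal_mult[symmetric] intro!: ennreal_leI)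
          qed simp
        qed
        also have "\<dots> = ennreal (4 * r * s powr (r - 3)) * (\<integral>\<^sup>+x. ennreal ((norm (?R s x))\<^sup>2) \<partial>\<mu>)"
          by (intro nn_integral_cmult) measurable
        also have "\<dots> \<le> ennreal (4 * r * s powr (r - 3)) * ennreal (B * (LINT t|P. (norm (G s t))\<^sup>2))"
          by (intro mult_left_mono L2 Gsq s) auto
        also have "\<dots> = ennreal (4 * r * s powr (r - 3) * B) * (\<integral>\<^sup>+t. ennreal ((norm (G s t))\<^sup>2) \<partial>P)"
          using Gsq[OF s] r B by (subst nn_integral_eq_integral) (auto simp: ennreal_mult'[symmetric] mult_ac)
        also have "\<dots> = (\<integral>\<^sup>+t. ennreal (4 * r * s powr (r - 3) * B) * ennreal ((norm (G s t))\<^sup>2) \<partial>P)"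
          by (rule nn_integral_cmult[symmetric]) measurable
        also have "\<dots> \<le> (\<integral>\<^sup>+t. ?h s t \<partial>P)"
        proof (intro nn_integral_mono)
          fix t
          show "ennreal (4 * r * s powr (r - 3) * B) * ennreal ((norm (G s t))\<^sup>2)
            \<le> ?h s t"
          proof (cases "G s t = 0")
            case False
            then have *: "s * norm (F t) powr b \<le> 2 * N" "F t \<noteq> 0" "G s t = F t"
              by (auto simp: G_def split: if_splits)
            then have "s \<le> 2 * N * norm (F t) powr (-b)"
              by (simp add: powr_minus field_simps)
            then show ?thesis using s * r B by (auto simp: ennreal_mult'[symmetric] mult_ac)
          qed simp
        qed
        finally show ?thesis .
      qed
    qed
    also have "\<dots> = (\<integral>\<^sup>+t. (\<integral>\<^sup>+s. ?h s t \<partial>lborel) \<partial>P)"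
    proof -
      interpret L: pair_sigma_finite P lborel ..
      show ?thesis
        by (rule L.Fubini') (simp add: indicator_def, measurable)
    qed
    \<comment> \<open>For fixed t the cut confines s to s <= 2N |F|^(-b). The power s^(r-3) is
      integrable at 0 because r > 2, and the powers of |F| recombine to |F|^(1+b) by b(r-2) =
      1-b.\<close>
    also have "\<dots> = (\<integral>\<^sup>+t. ennreal (?z t) \<partial>P)"
    proof (intro nn_integral_cong)
      fix t
      have "(\<integral>\<^sup>+s. ?h s t \<partial>lborel)
         = (\<integral>\<^sup>+s. ennreal (4 * r * B * (norm (F t))\<^sup>2) * (ennreal (s powr (r - 3)) * indicator {0..2 * N * norm (F t) powr (-b)} s) \<partial>lborel)"
        using r B by (simp add: ennreal_mult mult.assoc)
      also have "\<dots> = ennreal (4 * r * B * (norm (F t))\<^sup>2) * ennreal ((2 * N * norm (F t) powr (-b)) powr (r - 2) / (r - 2))"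
        using r Np nn_integral_powr_Icc[of "r - 3" "2 * N * norm (F t) powr (-b)"] by (subst nn_integral_cmult) auto
      also have "\<dots> = ennreal (?z t)"
      proof (cases "F t = 0")
        case False
        have "norm (F t) powr (1 + b) = norm (F t) powr (2 + (- b) * (r - 2))"
          using b by (simp add: algebra_simps)
        also have "\<dots> = (norm (F t))\<^sup>2 * (norm (F t) powr (-b)) powr (r - 2)"
          using False by (subst powr_add) (simp add: powr_powr powr_numeral)
        finally show ?thesis using r B Np
          by (auto simp: ennreal_mult'[symmetric] powr_mult intro!: arg_cong[where f = ennreal])
      qed simp
      finally show "(\<integral>\<^sup>+s. ?h s t \<partial>lborel)
        = ennreal (?z t)" .
    qed
    also have "\<dots> = ennreal (4 * r * B * (2 * N) powr (r - 2) / (r - 2) * N)"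
      using r B Np N b Fint by (subst nn_integral_eq_integral) (auto intro!: integrable_mult_right)
    also have "4 * r * B * (2 * N) powr (r - 2) / (r - 2) * N = 4 * r * 2 powr (r - 2) / (r - 2) * B * N powr (r - 1)"
      using Np powr_add[of N "r - 2" 1] by (simp add: powr_mult)
    finally show ?thesis .
  qed
qed

section \<open>Duality with a Gaussian weight\<close>

abbreviation std_gauss :: "('n::finite \<Rightarrow> real) measure" where
  "std_gauss \<equiv> PiM UNIV (\<lambda>_. std_normal_distribution)"

lemma product_sigma_finite_std_normal: "product_sigma_finite (\<lambda>_. std_normal_distribution)"
proof -
  interpret R: real_distribution std_normal_distribution by (rule real_dist_normal_dist)
  show ?thesis by (rule product_sigma_finite.intro) (rule R.sigma_finite_measure_axioms)
qed

lemma prob_space_std_gauss: "prob_space (std_gauss :: ('n::finite \<Rightarrow> real) measure)"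
proof (rule prob_space_PiM)
  interpret real_distribution std_normal_distribution by (rule real_dist_normal_dist)
  show "prob_space std_normal_distribution" by (rule prob_space_axioms)
qed

lemma char_std_gauss:
  fixes z :: "'n::finite \<Rightarrow> real"
  shows "(LINT \<xi>|std_gauss. iexp (\<Sum>i\<in>UNIV. z i * \<xi> i)) = of_real (exp (- (\<Sum>i\<in>UNIV. (z i)\<^sup>2) / 2))"
proof -
  interpret product_sigma_finite "\<lambda>_::'n. std_normal_distribution"
    by (rule product_sigma_finite_std_normal)
  interpret R: real_distribution std_normal_distribution by (rule real_dist_normal_dist)
  have "(LINT \<xi>|std_gauss. iexp (\<Sum>i\<in>UNIV. z i * \<xi> i)) = (LINT \<xi>|std_gauss. (\<Prod>i\<in>UNIV. iexp (z i * \<xi> i)))"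
    by (simp add: exp_sum[symmetric] sum_distrib_left)
  also have "\<dots> = (\<Prod>i\<in>UNIV. LINT y|std_normal_distribution. iexp (z i * y))"
    by (rule product_integral_prod) (auto intro!: R.integrable_iexp)
  also have "\<dots> = (\<Prod>i\<in>UNIV. of_real (exp (- ((z i)\<^sup>2) / 2)))"
    using char_std_normal_distribution by (simp add: char_def fun_eq_iff)
  also have "\<dots> = of_real (exp (- (\<Sum>i\<in>UNIV. (z i)\<^sup>2) / 2))"
    by (simp add: exp_sum[symmetric] sum_divide_distrib sum_negf flip: of_real_prod)
  finally show ?thesis .
qed

text \<open>A centre of size at most C and a radius at most 1 keep the interval inside [-C-1, C+1],
  where the density is smallest at the ends.\<close>

lemma std_normal_interval_ge:
  assumes "\<bar>\<eta>\<bar> \<le> C" "0 < r" "r \<le> 1"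
  shows "ennreal (2 * std_normal_density (C + 1) * r) \<le> emeasure std_normal_distribution {y. \<bar>\<eta> - y\<bar> < r}"
proof -
  have eq: "{y. \<bar>\<eta> - y\<bar> < r} = {\<eta> - r<..<\<eta> + r}" by auto
  have "ennreal (2 * std_normal_density (C + 1) * r) = ennreal (std_normal_density (C + 1)) * emeasure lborel {\<eta> - r<..<\<eta> + r}"
    using assms by (simp add: ennreal_mult'[symmetric] mult_ac)
  also have "\<dots> = (\<integral>\<^sup>+y. ennreal (std_normal_density (C + 1)) * indicator {\<eta> - r<..<\<eta> + r} y \<partial>lborel)"
    by (subst nn_integral_cmult_indicator) auto
  also have "\<dots> \<le> (\<integral>\<^sup>+y. ennreal (std_normal_density y) * indicator {\<eta> - r<..<\<eta> + r} y \<partial>lborel)"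
  proof (intro nn_integral_mono)
    fix y :: real
    show "ennreal (std_normal_density (C + 1)) * indicator {\<eta> - r<..<\<eta> + r} y
      \<le> ennreal (std_normal_density y) * indicator {\<eta> - r<..<\<eta> + r} y"
    proof (cases "y \<in> {\<eta> - r<..<\<eta> + r}")
      case True
      then have "\<bar>y\<bar> \<le> \<bar>C + 1\<bar>" using assms by auto
      then have "y\<^sup>2 \<le> (C + 1)\<^sup>2" by (simp add: abs_le_square_iff)
      then show ?thesis using True by (auto simp: std_normal_density_def intro!: ennreal_leI divide_right_mono)
    qed simp
  qed
  also have "\<dots> = emeasure std_normal_distribution {\<eta> - r<..<\<eta> + r}"
    by (subst emeasure_density) auto
  finally show ?thesis unfolding eq .
qed

lemma std_gauss_cube_ge:
  fixes \<eta> :: "'n::finite \<Rightarrow> real"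
  assumes "\<And>i. \<bar>\<eta> i\<bar> \<le> C" "0 < r" "r \<le> 1"
  shows "ennreal ((2 * std_normal_density (C + 1) * r) ^ CARD('n)) \<le> emeasure std_gauss {\<xi>. \<forall>i. \<bar>\<eta> i - \<xi> i\<bar> < r}"
proof -
  interpret product_sigma_finite "\<lambda>_::'n. std_normal_distribution"
    by (rule product_sigma_finite_std_normal)
  have eq: "{\<xi>. \<forall>i. \<bar>\<eta> i - \<xi> i\<bar> < r} = PiE UNIV (\<lambda>i. {y. \<bar>\<eta> i - y\<bar> < r})"
    by (auto simp: PiE_def)
  have "ennreal ((2 * std_normal_density (C + 1) * r) ^ CARD('n)) = (\<Prod>i\<in>(UNIV :: 'n set). ennreal (2 * std_normal_density (C + 1) * r))"
    using assms by (simp add: ennreal_power)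
  also have "\<dots> \<le> (\<Prod>i\<in>UNIV. emeasure std_normal_distribution {y. \<bar>\<eta> i - y\<bar> < r})"
    by (intro prod_mono_ennreal std_normal_interval_ge assms)
  also have "\<dots> = emeasure std_gauss (PiE UNIV (\<lambda>i. {y. \<bar>\<eta> i - y\<bar> < r}))"
    by (rule emeasure_PiM[symmetric]) auto
  finally show ?thesis unfolding eq .
qed

text \<open>The proof averages \<open>f\<close> over small cubes around \<open>\<Psi> t\<close>; the Lipschitz error vanishes with
  the side length.\<close>

lemma nn_integral_le_std_gauss:
  fixes \<Psi> :: "'t \<Rightarrow> 'n::finite \<Rightarrow> real" and f :: "('n \<Rightarrow> real) \<Rightarrow> real"
  assumes P: "finite_measure P"
    and \<Psi>[measurable]: "\<And>i. (\<lambda>t. \<Psi> t i) \<in> borel_measurable P"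
    and bd: "\<And>t i. t \<in> space P \<Longrightarrow> \<bar>\<Psi> t i\<bar> \<le> C"
    and cube: "\<And>\<xi> r. 0 < r \<Longrightarrow> r \<le> 1 \<Longrightarrow>
      emeasure P {t \<in> space P. \<forall>i. \<bar>\<Psi> t i - \<xi> i\<bar> < r} \<le> ennreal (D * r ^ CARD('n))"
    and D: "D \<ge> 0"
    and f[measurable]: "f \<in> borel_measurable std_gauss" and f0: "\<And>\<xi>. f \<xi> \<ge> 0"
    and L: "L \<ge> 0" and lip: "\<And>\<xi> \<eta> r. (\<And>i. \<bar>\<eta> i - \<xi> i\<bar> < r) \<Longrightarrow> f \<eta> \<le> f \<xi> + L * r"
  shows "(\<integral>\<^sup>+t. ennreal (f (\<Psi> t)) \<partial>P)
    \<le> ennreal (D / (2 * std_normal_density (C + 1)) ^ CARD('n)) * (\<integral>\<^sup>+\<xi>. ennreal (f \<xi>) \<partial>std_gauss)" (is "?X \<le> ?Z")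
proof -
  interpret P: finite_measure P by fact
  interpret G: prob_space "std_gauss :: ('n \<Rightarrow> real) measure" by (rule prob_space_std_gauss)
  interpret PG: pair_sigma_finite P "std_gauss :: ('n \<Rightarrow> real) measure" ..
  let ?F = "\<integral>\<^sup>+\<xi>. ennreal (f \<xi>) \<partial>std_gauss"
  let ?c = "2 * std_normal_density (C + 1)"
  have c: "?c > 0" by (simp add: std_normal_density_def)
  have main: "?X \<le> ?Z + ennreal (L * r * measure P (space P))" if r: "0 < r" "r \<le> 1" for r
  proof -
    \<comment> \<open>The lower bound of \<open>std_gauss_cube_ge\<close> for the Gaussian mass of a
      cube of half-side r. Dividing by it instead of by the true mass keeps the average an upper
      bound.\<close>
    define w where "w = (?c * r) ^ CARD('n)"
    have w: "w > 0" unfolding w_def by (rule zero_less_power, rule mult_pos_pos[OF c r(1)])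
    define I where "I t = {\<xi>. \<forall>i. \<bar>\<Psi> t i - \<xi> i\<bar> < r}" for t
    let ?Q = "\<lambda>t. \<integral>\<^sup>+\<xi>. ennreal (f \<xi>) * indicator (I t) \<xi> \<partial>std_gauss"
    have m1: "(\<lambda>(t, \<xi>). indicator (I t) \<xi> :: ennreal) \<in> borel_measurable (P \<Otimes>\<^sub>M std_gauss)"
      unfolding I_def indicator_def by measurable
    have Iset: "I t \<in> sets std_gauss" for t
    proof -
      have "I t = {\<xi> \<in> space std_gauss. \<forall>i. \<bar>\<Psi> t i - \<xi> i\<bar> < r}" by (auto simp: I_def space_PiM)
      then show ?thesis by simp
    qed
    have pt: "ennreal (f (\<Psi> t)) \<le> ennreal (L * r) + ennreal (1 / w) * ?Q t"
      if t: "t \<in> space P" for t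
    proof (cases "f (\<Psi> t) \<le> L * r")
      case True
      then show ?thesis by (metis add_increasing2 ennreal_leI zero_le)
    next
      case False
      define v where "v = f (\<Psi> t) - L * r"
      have v: "v > 0" using False v_def by simp
      have "ennreal v = ennreal (1 / w) * (ennreal v * ennreal w)"
        using w v by (simp add: ennreal_mult[symmetric])
      also have "\<dots> \<le> ennreal (1 / w) * (ennreal v * emeasure std_gauss (I t))"
        unfolding w_def I_def by (intro mult_left_mono std_gauss_cube_ge bd t r) auto
      also have "\<dots> = ennreal (1 / w) * (\<integral>\<^sup>+\<xi>. ennreal v * indicator (I t) \<xi> \<partial>std_gauss)"
        using Iset by (subst nn_integral_cmult_indicator) auto
      also have "\<dots> \<le> ennreal (1 / w) * ?Q t"
      proof (intro mult_left_mono nn_integral_mono)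
        fix \<xi>
        show "ennreal v * indicator (I t) \<xi> \<le> ennreal (f \<xi>) * indicator (I t) \<xi>"
          using lip[of "\<Psi> t" \<xi> r] by (auto simp: v_def I_def indicator_def intro!: ennreal_leI)
      qed auto
      finally have "ennreal v \<le> \<dots>" .
      moreover have "ennreal (f (\<Psi> t)) = ennreal (L * r) + ennreal v"
        using L r v by (subst ennreal_plus[symmetric]) (auto simp: v_def)
      ultimately show ?thesis by (simp add: add_left_mono)
    qed
    have "?X \<le> (\<integral>\<^sup>+t. ennreal (L * r) + ennreal (1 / w) * ?Q t \<partial>P)"
      by (intro nn_integral_mono pt)
    also have "\<dots> = ennreal (L * r) * emeasure P (space P) + ennreal (1 / w) * (\<integral>\<^sup>+t. ?Q t \<partial>P)"
      using m1 by (subst nn_integral_add) (auto simp: nn_integral_cmult)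
    \<comment> \<open>After the exchange the inner integral measures those t whose image lies in a
      cube about \<xi>. This is what \<open>cube\<close> bounds, and its power of r cancels the one
      in \<open>w\<close>.\<close>
    also have "(\<integral>\<^sup>+t. ?Q t \<partial>P)
      = (\<integral>\<^sup>+\<xi>. (\<integral>\<^sup>+t. ennreal (f \<xi>) * indicator (I t) \<xi> \<partial>P) \<partial>std_gauss)"
      by (rule PG.Fubini'[symmetric]) (use m1 in measurable)
    also have "\<dots> \<le> (\<integral>\<^sup>+\<xi>. ennreal (f \<xi>) * ennreal (D * r ^ CARD('n)) \<partial>std_gauss)"
    proof (intro nn_integral_mono)
      fix \<xi> :: "'n \<Rightarrow> real"
      let ?T = "{t \<in> space P. \<forall>i. \<bar>\<Psi> t i - \<xi> i\<bar> < r}"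
      have [measurable]: "?T \<in> sets P" by measurable
      have "(\<integral>\<^sup>+t. ennreal (f \<xi>) * indicator (I t) \<xi> \<partial>P) = (\<integral>\<^sup>+t. ennreal (f \<xi>) * indicator ?T t \<partial>P)"
        by (intro nn_integral_cong) (auto simp: I_def indicator_def)
      also have "\<dots> = ennreal (f \<xi>) * emeasure P ?T"
        by (rule nn_integral_cmult_indicator) measurable
      also have "\<dots> \<le> ennreal (f \<xi>) * ennreal (D * r ^ CARD('n))"
        by (intro mult_left_mono cube r) auto
      finally show "(\<integral>\<^sup>+t. ennreal (f \<xi>) * indicator (I t) \<xi> \<partial>P) \<le> ennreal (f \<xi>) * ennreal (D * r ^ CARD('n))" .
    qed
    also have "\<dots> = ennreal (D * r ^ CARD('n)) * ?F"
      by (subst nn_integral_multc) (auto simp: mult.commute)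
    finally have "?X \<le> ennreal (L * r) * emeasure P (space P) + ennreal (1 / w) * (ennreal (D * r ^ CARD('n)) * ?F)"
      by (simp add: add_left_mono mult_left_mono)
    also have "ennreal (1 / w) * (ennreal (D * r ^ CARD('n)) * ?F) = ?Z"
      using w D r c by (simp add: w_def mult.assoc[symmetric] ennreal_mult[symmetric] power_mult_distrib)
    also have "ennreal (L * r) * emeasure P (space P) = ennreal (L * r * measure P (space P))"
      using L r by (simp add: P.emeasure_eq_measure ennreal_mult)
    finally show ?thesis by (simp add: add.commute)
  qed
  show ?thesis
  proof (rule ennreal_le_epsilon)
    fix e :: real assume e: "0 < e"
    define r where "r = min 1 (e / (L * measure P (space P) + 1))"
    have den: "L * measure P (space P) + 1 > 0" using L by (simp add: add_nonneg_pos)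
    have r: "0 < r" "r \<le> 1" using e den by (auto simp: r_def)
    have "r \<le> e / (L * measure P (space P) + 1)" by (simp add: r_def)
    then have "r * (L * measure P (space P) + 1) \<le> e" using den by (simp add: field_simps)
    then have "L * r * measure P (space P) \<le> e" using r by (simp add: algebra_simps)
    then show "?X \<le> ?Z + ennreal e"
      using main[OF r] by (meson add_left_mono ennreal_leI order_trans)
  qed
qed

lemma norm_iexp_diff_le: "norm (iexp a - iexp b) \<le> \<bar>a - b\<bar>"
proof -
  have "iexp a - iexp b = iexp b * (iexp (a - b) - 1)"
    by (simp add: algebra_simps exp_add[symmetric])
  then show ?thesis using iexp_approx1[of "a - b" 0] by (simp add: norm_mult)
qed

text \<open>The \<open>TT\<^sup>*\<close> argument: by duality only the adjoint \<open>H\<close> matters, and the Gaussian weight turns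
  \<open>\<integral>|H|\<^sup>2\<close> into a quadratic form with a nonnegative kernel, to which Schur's test applies.\<close>

lemma oscillatory_L2_bound:
  fixes Y :: "'x \<Rightarrow> 'n::finite \<Rightarrow> real" and \<Psi> :: "'t \<Rightarrow> 'n \<Rightarrow> real" and F :: "'t \<Rightarrow> complex"
  assumes mu: "finite_measure \<mu>" and P: "finite_measure P"
    and Y[measurable]: "\<And>i. (\<lambda>x. Y x i) \<in> borel_measurable \<mu>"
    and Ybd: "\<And>x i. x \<in> space \<mu> \<Longrightarrow> \<bar>Y x i\<bar> \<le> R"
    and \<Psi>[measurable]: "\<And>i. (\<lambda>t. \<Psi> t i) \<in> borel_measurable P"
    and bd: "\<And>t i. t \<in> space P \<Longrightarrow> \<bar>\<Psi> t i\<bar> \<le> C"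
    and cube: "\<And>\<xi> r. 0 < r \<Longrightarrow> r \<le> 1 \<Longrightarrow>
      emeasure P {t \<in> space P. \<forall>i. \<bar>\<Psi> t i - \<xi> i\<bar> < r} \<le> ennreal (D * r ^ CARD('n))"
    and D: "D > 0"
    and \<kappa>: "\<kappa> > 0" and kern: "\<And>x. x \<in> space \<mu> \<Longrightarrow> (LINT y|\<mu>. exp (- (\<Sum>i\<in>UNIV. (Y x i - Y y i)\<^sup>2) / 2)) \<le> \<kappa>"
    and F[measurable]: "F \<in> borel_measurable P" and F2: "integrable P (\<lambda>t. (norm (F t))\<^sup>2)"
  shows "(\<integral>\<^sup>+x. ennreal ((norm (LINT t|P. F t * iexp (\<Sum>i\<in>UNIV. Y x i * \<Psi> t i)))\<^sup>2) \<partial>\<mu>)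
    \<le> ennreal (D / (2 * std_normal_density (C + 1)) ^ CARD('n) * \<kappa> * (LINT t|P. (norm (F t))\<^sup>2))"
proof -
  interpret mu: finite_measure \<mu> by fact
  interpret P: finite_measure P by fact
  interpret G: prob_space "std_gauss :: ('n \<Rightarrow> real) measure" by (rule prob_space_std_gauss)
  interpret MP: pair_sigma_finite \<mu> P ..
  interpret MM: pair_sigma_finite \<mu> \<mu> ..
  interpret MMf: finite_measure "\<mu> \<Otimes>\<^sub>M \<mu>" by (intro finite_measure_pair_measure mu P)
  interpret GMM: pair_sigma_finite "std_gauss :: ('n \<Rightarrow> real) measure" "\<mu> \<Otimes>\<^sub>M \<mu>" ..
  interpret GMMf: finite_measure "(std_gauss :: ('n \<Rightarrow> real) measure) \<Otimes>\<^sub>M (\<mu> \<Otimes>\<^sub>M \<mu>)"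
    by (intro finite_measure_pair_measure G.finite_measure_axioms MMf.finite_measure_axioms)
  let ?M2 = "\<mu> \<Otimes>\<^sub>M \<mu>"
  let ?E = "\<lambda>x \<xi>. iexp (\<Sum>i\<in>UNIV. Y x i * \<xi> i)"
  have le: "u \<le> 1 + u\<^sup>2" for u :: real
    using zero_le_power2[of "u - 1/2"] by (simp add: power2_eq_square algebra_simps)
  have Fi: "integrable P F"
    by (rule Bochner_Integration.integrable_bound[of _ "\<lambda>t. 1 + (norm (F t))\<^sup>2"])
       (use F2 le in \<open>auto intro!: Bochner_Integration.integrable_add order_trans[OF le]\<close>)
  define g where "g x = (LINT t|P. F t * ?E x (\<Psi> t))" for x
  have g[measurable]: "g \<in> borel_measurable \<mu>" unfolding g_def by measurable
  have cnjg[measurable]: "(\<lambda>x. cnj (g x)) \<in> borel_measurable \<mu>"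
    by (rule measurable_compose[OF g borel_measurable_continuous_onI]) (intro continuous_intros)
  have comp[measurable]: "(\<lambda>\<xi>. \<xi> i) \<in> borel_measurable (std_gauss :: ('n \<Rightarrow> real) measure)" for i
    using measurable_component_singleton[of i UNIV "\<lambda>_. std_normal_distribution"] by simp
  define g0 where "g0 = (LINT t|P. norm (F t))"
  have g0: "g0 \<ge> 0" unfolding g0_def by simp
  have gb: "norm (g x) \<le> g0" for x
    unfolding g_def g0_def by (rule order_trans[OF integral_norm_bound]) (simp add: norm_mult)
  have gi: "integrable \<mu> g" by (rule mu.integrable_const_bound[of _ g0]) (auto simp: gb)
  have g2: "integrable \<mu> (\<lambda>x. (norm (g x))\<^sup>2)"
    by (rule mu.integrable_const_bound[of _ "g0\<^sup>2"]) (auto intro!: power_mono gb)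
  define Q where "Q = (LINT x|\<mu>. (norm (g x))\<^sup>2)"
  have Q0: "Q \<ge> 0" unfolding Q_def by simp
  \<comment> \<open>The adjoint applied to \<open>g\<close>, taken as a function on the whole
    frequency space: it can then be evaluated along \<open>\<Psi>\<close> and also averaged against
    the Gaussian.\<close>
  define H where "H \<xi> = (LINT x|\<mu>. cnj (g x) * ?E x \<xi>)" for \<xi>
  have H[measurable]: "H \<in> borel_measurable std_gauss" unfolding H_def by measurable
  define h0 where "h0 = (LINT x|\<mu>. norm (g x))"
  have h0: "h0 \<ge> 0" unfolding h0_def by simp
  have Hb: "norm (H \<xi>) \<le> h0" for \<xi>
    unfolding H_def h0_def by (rule order_trans[OF integral_norm_bound]) (simp add: norm_mult)
  have Ei: "integrable \<mu> (\<lambda>x. cnj (g x) * ?E x \<xi>)" for \<xi>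
    by (rule mu.integrable_const_bound[of _ g0]) (auto simp: gb norm_mult)

  have HP: "(\<lambda>t. H (\<Psi> t)) \<in> borel_measurable P" unfolding H_def by measurable
  have HP2: "integrable P (\<lambda>t. (norm (H (\<Psi> t)))\<^sup>2)"
    by (rule P.integrable_const_bound[of _ "h0\<^sup>2"]) (use HP in \<open>auto intro!: power_mono Hb\<close>)

  have dual: "of_real Q = (LINT t|P. F t * H (\<Psi> t))"
  proof -
    have int: "integrable (\<mu> \<Otimes>\<^sub>M P) (\<lambda>(x, t). cnj (g x) * (F t * ?E x (\<Psi> t)))"
    proof -
      have 1: "integrable \<mu> (\<lambda>x. LINT t|P. norm (cnj (g x) * (F t * ?E x (\<Psi> t))))"
        using gi by (simp add: norm_mult)
      show ?thesis
        by (rule MP.Fubini_integrable) (use 1 Fi in \<open>auto simp: norm_mult intro!: integrable_mult_right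
          Bochner_Integration.integrable_bound[OF Fi]\<close>)
    qed
    have "complex_of_real Q = (LINT x|\<mu>. complex_of_real ((norm (g x))\<^sup>2))"
      unfolding Q_def by (rule integral_complex_of_real[symmetric])
    also have "\<dots> = (LINT x|\<mu>. cnj (g x) * g x)"
      unfolding complex_norm_square by (simp add: mult.commute)
    also have "\<dots> = (LINT x|\<mu>. (LINT t|P. cnj (g x) * (F t * ?E x (\<Psi> t))))"
      unfolding g_def by simp
    also have "\<dots> = (LINT t|P. (LINT x|\<mu>. cnj (g x) * (F t * ?E x (\<Psi> t))))"
      by (rule MP.Fubini_integral[symmetric]) (rule int)
    also have "\<dots> = (LINT t|P. F t * H (\<Psi> t))"
      unfolding H_def by (simp add: mult.left_commute)
    finally show ?thesis .
  qed

  \<comment> \<open>Boundedness of \<open>Y\<close> makes \<open>H\<close> Lipschitz. Only the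
    finiteness of the Lipschitz constant matters; it does not reach the conclusion.\<close>
  have lipH: "norm (H \<eta> - H \<xi>) \<le> h0 * (CARD('n) * \<bar>R\<bar> * r)" if r: "\<And>i. \<bar>\<eta> i - \<xi> i\<bar> < r" for \<eta> \<xi> r
  proof -
    have "H \<eta> - H \<xi> = (LINT x|\<mu>. cnj (g x) * (?E x \<eta> - ?E x \<xi>))"
      unfolding H_def by (subst Bochner_Integration.integral_diff[symmetric, OF Ei Ei]) (simp add: algebra_simps)
    also have "norm \<dots> \<le> (LINT x|\<mu>. norm (g x) * (CARD('n) * \<bar>R\<bar> * r))"
    proof (rule order_trans[OF integral_norm_bound integral_mono])
      show "integrable \<mu> (\<lambda>x. norm (cnj (g x) * (?E x \<eta> - ?E x \<xi>)))"
        using Bochner_Integration.integrable_diff[OF Ei[of \<eta>] Ei[of \<xi>]]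
        by (intro integrable_norm) (simp add: algebra_simps)
      show "integrable \<mu> (\<lambda>x. norm (g x) * (CARD('n) * \<bar>R\<bar> * r))" using gi by simp
      fix x assume x: "x \<in> space \<mu>"
      have "norm (?E x \<eta> - ?E x \<xi>) \<le> \<bar>(\<Sum>i\<in>UNIV. Y x i * \<eta> i) - (\<Sum>i\<in>UNIV. Y x i * \<xi> i)\<bar>"
        by (rule norm_iexp_diff_le)
      also have "\<dots> = \<bar>\<Sum>i\<in>UNIV. Y x i * (\<eta> i - \<xi> i)\<bar>"
        by (simp add: sum_subtractf right_diff_distrib)
      also have "\<dots> \<le> (\<Sum>i\<in>(UNIV :: 'n set). \<bar>R\<bar> * r)"
      proof (rule order_trans[OF sum_abs sum_mono])
        fix i
        have "\<bar>Y x i\<bar> \<le> \<bar>R\<bar>" using Ybd[OF x, of i] by simp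
        then show "\<bar>Y x i * (\<eta> i - \<xi> i)\<bar> \<le> \<bar>R\<bar> * r"
          unfolding abs_mult using r[of i] by (intro mult_mono) auto
      qed
      finally show "norm (cnj (g x) * (?E x \<eta> - ?E x \<xi>)) \<le> norm (g x) * (CARD('n) * \<bar>R\<bar> * r)"
        by (simp add: norm_mult mult_left_mono mult.assoc)
    qed
    finally show ?thesis by (simp add: h0_def)
  qed
  have lip: "(norm (H \<eta>))\<^sup>2 \<le> (norm (H \<xi>))\<^sup>2 + 2 * h0 * h0 * CARD('n) * \<bar>R\<bar> * r"
    if r: "\<And>i. \<bar>\<eta> i - \<xi> i\<bar> < r" for \<eta> \<xi> r
  proof -
    have "(norm (H \<eta>))\<^sup>2 - (norm (H \<xi>))\<^sup>2 = (norm (H \<eta>) - norm (H \<xi>)) * (norm (H \<eta>) + norm (H \<xi>))"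
      by (simp add: power2_eq_square algebra_simps)
    also have "\<dots> \<le> norm (H \<eta> - H \<xi>) * (h0 + h0)"
      by (intro mult_mono norm_triangle_ineq2 add_mono Hb) auto
    also have "\<dots> \<le> (h0 * (CARD('n) * \<bar>R\<bar> * r)) * (h0 + h0)"
      using h0 by (intro mult_right_mono lipH r) auto
    finally show ?thesis by (simp add: algebra_simps)
  qed

  define c where "c = D / (2 * std_normal_density (C + 1)) ^ CARD('n)"
  have c: "c > 0" unfolding c_def
    by (rule divide_pos_pos[OF D zero_less_power]) (simp add: std_normal_density_def)

  \<comment> \<open>Expanding the square gives a double integral of conj(g(x)) g(y) against the
    characteristic function of the Gaussian at Y x - Y y. This kernel is nonnegative and symmetric,
    so Schur's test amounts to the inequality of means followed by the row bound
    \<open>kern\<close>.\<close>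
  have HG: "(LINT \<xi>|std_gauss. (norm (H \<xi>))\<^sup>2) \<le> \<kappa> * Q"
  proof -
    define k where "k x y = exp (- (\<Sum>i\<in>UNIV. (Y x i - Y y i)\<^sup>2) / 2)" for x y
    let ?p = "\<lambda>z. case z of (x, y) \<Rightarrow> (norm (g x))\<^sup>2 * k x y"
    let ?q = "\<lambda>z. case z of (x, y) \<Rightarrow> (norm (g y))\<^sup>2 * k x y"
    let ?v = "\<lambda>z. cnj (g (fst z)) * g (snd z) * complex_of_real (k (fst z) (snd z))"
    have k[measurable]: "case_prod k \<in> borel_measurable ?M2" unfolding k_def by measurable
    have k1: "0 \<le> k x y" "k x y \<le> 1" for x y unfolding k_def by (auto intro!: sum_nonneg)
    have ksym: "k x y = k y x" for x y unfolding k_def by (simp add: power2_commute)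
    define u where "u z \<xi> = (cnj (g (fst z)) * g (snd z)) * iexp (\<Sum>i\<in>UNIV. (Y (fst z) i - Y (snd z) i) * \<xi> i)" for z \<xi>
    have um[measurable]: "(\<lambda>(\<xi>, z). u z \<xi>) \<in> borel_measurable (std_gauss \<Otimes>\<^sub>M ?M2)"
      unfolding u_def by measurable
    have ub: "norm (u z \<xi>) \<le> g0 * g0" for z \<xi>
      unfolding u_def by (simp add: norm_mult) (intro mult_mono gb g0, simp)
    have H2: "complex_of_real ((norm (H \<xi>))\<^sup>2) = (LINT z|?M2. u z \<xi>)" for \<xi>
    proof -
      have ui: "integrable ?M2 (\<lambda>z. u z \<xi>)"
        by (rule MMf.integrable_const_bound[of _ "g0 * g0"]) (use ub in \<open>auto simp: u_def\<close>)
      have "complex_of_real ((norm (H \<xi>))\<^sup>2) = H \<xi> * cnj (H \<xi>)" by (rule complex_norm_square)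
      also have "\<dots> = (LINT x|\<mu>. cnj (g x) * ?E x \<xi> * cnj (H \<xi>))"
        using Ei by (subst H_def) simp
      also have "\<dots> = (LINT x|\<mu>. (LINT y|\<mu>. (cnj (g x) * ?E x \<xi>) * cnj (cnj (g y) * ?E y \<xi>)))"
        unfolding H_def by (simp only: integral_mult_right_zero Bochner_Integration.integral_cnj)
      also have "\<dots> = (LINT x|\<mu>. (LINT y|\<mu>. u (x, y) \<xi>))"
      proof -
        have "(cnj (g x) * ?E x \<xi>) * cnj (cnj (g y) * ?E y \<xi>) = u (x, y) \<xi>" for x y
        proof -
          have "?E x \<xi> * cnj (?E y \<xi>) = iexp ((\<Sum>i\<in>UNIV. Y x i * \<xi> i) - (\<Sum>i\<in>UNIV. Y y i * \<xi> i))"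
            by (simp add: exp_cnj exp_add[symmetric] right_diff_distrib)
          also have "(\<Sum>i\<in>UNIV. Y x i * \<xi> i) - (\<Sum>i\<in>UNIV. Y y i * \<xi> i) = (\<Sum>i\<in>UNIV. (Y x i - Y y i) * \<xi> i)"
            by (simp add: sum_subtractf left_diff_distrib)
          finally show ?thesis by (simp add: u_def mult_ac)
        qed
        then show ?thesis by simp
      qed
      also have "\<dots> = (LINT z|?M2. u z \<xi>)"
        using ui by (rule MM.integral_fst')
      finally show ?thesis .
    qed
    have H2i: "integrable std_gauss (\<lambda>\<xi>. (norm (H \<xi>))\<^sup>2)"
      by (rule G.integrable_const_bound[of _ "h0\<^sup>2"]) (auto intro!: power_mono Hb)
    have "complex_of_real (LINT \<xi>|std_gauss. (norm (H \<xi>))\<^sup>2) = (LINT \<xi>|std_gauss. (LINT z|?M2. u z \<xi>))"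
      unfolding H2[symmetric] by (rule integral_complex_of_real[symmetric])
    also have "\<dots> = (LINT z|?M2. (LINT \<xi>|std_gauss. u z \<xi>))"
      by (rule GMM.Fubini_integral[symmetric], rule GMMf.integrable_const_bound[of _ "g0 * g0"])
         (use ub in auto)
    also have "\<dots> = (LINT z|?M2. (cnj (g (fst z)) * g (snd z)) * of_real (k (fst z) (snd z)))"
      unfolding u_def k_def by (simp only: integral_mult_right_zero char_std_gauss)
    finally have eq: "complex_of_real (LINT \<xi>|std_gauss. (norm (H \<xi>))\<^sup>2) = \<dots>" .
    have ki: "integrable ?M2 (\<lambda>(x, y). (norm (g x))\<^sup>2 * k x y)"
    proof (rule MMf.integrable_const_bound[of _ "g0\<^sup>2"])
      have "(norm (g x))\<^sup>2 * k x y \<le> g0\<^sup>2 * 1" for x y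
        by (intro mult_mono power_mono gb k1) auto
      then show "AE z in ?M2. norm (?p z) \<le> g0\<^sup>2"
        using k1 by (auto simp: abs_mult)
    qed measurable
    have ki2: "integrable ?M2 (\<lambda>(x, y). (norm (g y))\<^sup>2 * k x y)"
      using MM.integrable_product_swap[OF ki] by (simp add: ksym split_beta')
    have "(LINT \<xi>|std_gauss. (norm (H \<xi>))\<^sup>2) = norm (complex_of_real (LINT \<xi>|std_gauss. (norm (H \<xi>))\<^sup>2))"
      by simp
    also have "\<dots> \<le> (LINT z|?M2. (1/2) * ?p z + (1/2) * ?q z)"
      unfolding eq
    proof (rule order_trans[OF integral_norm_bound integral_mono])
      show "integrable ?M2 (\<lambda>z. norm (?v z))"
      proof (rule MMf.integrable_const_bound[of _ "g0 * g0"])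
        have "norm (g x) * norm (g y) * k x y \<le> g0 * g0 * 1" for x y
          by (intro mult_mono gb k1 g0) (auto simp: g0)
        then show "AE z in ?M2. norm (norm (?v z)) \<le> g0 * g0"
          using k1 by (auto simp: norm_mult)
      qed measurable
      show "integrable ?M2 (\<lambda>z. (1/2) * ?p z + (1/2) * ?q z)"
        using ki ki2 by simp
      fix z :: "'x \<times> 'x"
      obtain x y where z: "z = (x, y)" by fastforce
      have "norm (g x) * norm (g y) \<le> 1/2 * (norm (g x))\<^sup>2 + 1/2 * (norm (g y))\<^sup>2"
        using zero_le_power2[of "norm (g x) - norm (g y)"] by (simp add: power2_eq_square algebra_simps)
      from mult_right_mono[OF this k1(1)[of x y]]
      show "norm (?v z)
        \<le> (1/2) * ?p z + (1/2) * ?q z"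
        using k1 by (simp add: z norm_mult algebra_simps)
    qed
    also have "\<dots> = (1/2) * (LINT z|?M2. ?p z) + (1/2) * (LINT z|?M2. ?q z)"
      using ki ki2 by simp
    also have "(LINT z|?M2. ?q z) = (LINT z|?M2. ?p z)"
      using MM.integral_product_swap[of "\<lambda>(x, y). (norm (g x))\<^sup>2 * k x y"] by (simp add: ksym split_beta')
    also have "(LINT z|?M2. ?p z) = (LINT x|\<mu>. (LINT y|\<mu>. (norm (g x))\<^sup>2 * k x y))"
      using MM.integral_fst'[OF ki] by simp
    also have "\<dots> \<le> (LINT x|\<mu>. (norm (g x))\<^sup>2 * \<kappa>)"
    proof (rule integral_mono)
      show "integrable \<mu> (\<lambda>x. LINT y|\<mu>. (norm (g x))\<^sup>2 * k x y)"
        using MM.integrable_fst'[OF ki] by simp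
      show "integrable \<mu> (\<lambda>x. (norm (g x))\<^sup>2 * \<kappa>)" using g2 by simp
      fix x assume "x \<in> space \<mu>"
      then show "(LINT y|\<mu>. (norm (g x))\<^sup>2 * k x y) \<le> (norm (g x))\<^sup>2 * \<kappa>"
        using kern[of x] by (simp add: k_def mult_left_mono)
    qed
    finally show ?thesis by (simp add: Q_def mult.commute)
  qed

  have HPsi: "(LINT t|P. (norm (H (\<Psi> t)))\<^sup>2) \<le> c * \<kappa> * Q"
  proof -
    have "ennreal (LINT t|P. (norm (H (\<Psi> t)))\<^sup>2) = (\<integral>\<^sup>+t. ennreal ((norm (H (\<Psi> t)))\<^sup>2) \<partial>P)"
      using HP2 by (intro nn_integral_eq_integral[symmetric]) auto
    also have "\<dots> \<le> ennreal c * (\<integral>\<^sup>+\<xi>. ennreal ((norm (H \<xi>))\<^sup>2) \<partial>std_gauss)"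
      unfolding c_def
      by (rule nn_integral_le_std_gauss[where L = "2 * h0 * h0 * CARD('n) * \<bar>R\<bar>", OF P \<Psi> bd cube])
         (use D h0 lip in auto)
    also have "(\<integral>\<^sup>+\<xi>. ennreal ((norm (H \<xi>))\<^sup>2) \<partial>std_gauss) = ennreal (LINT \<xi>|std_gauss. (norm (H \<xi>))\<^sup>2)"
      by (intro nn_integral_eq_integral G.integrable_const_bound[of _ "h0\<^sup>2"]) (auto intro!: power_mono Hb)
    also have "ennreal c * \<dots> \<le> ennreal c * ennreal (\<kappa> * Q)"
      by (intro mult_left_mono ennreal_leI HG) auto
    also have "\<dots> = ennreal (c * \<kappa> * Q)"
      using c \<kappa> Q0 by (simp add: ennreal_mult[symmetric] mult.assoc)
    finally show ?thesis using c \<kappa> Q0 by (subst (asm) ennreal_le_iff) auto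
  qed

  let ?F = "LINT t|P. (norm (F t))\<^sup>2"
  define K where "K = c * \<kappa>"
  have K: "K > 0" using c \<kappa> by (simp add: K_def)
  \<comment> \<open>With the weight K in the inequality of means, the term in \<open>H\<close> is at
    most Q/2 by \<open>HPsi\<close> and is absorbed on the left. This is legitimate because
    \<open>g\<close> is bounded and \<mu> finite, so that Q is a genuine finite integral.\<close>
  have "Q \<le> K * ?F"
  proof -
    have "Q = norm (complex_of_real Q)" using Q0 by simp
    also have "\<dots> \<le> (LINT t|P. K / 2 * (norm (F t))\<^sup>2 + 1 / (2 * K) * (norm (H (\<Psi> t)))\<^sup>2)"
      unfolding dual
    proof (rule order_trans[OF integral_norm_bound integral_mono])
      show "integrable P (\<lambda>t. norm (F t * H (\<Psi> t)))"
        by (rule Bochner_Integration.integrable_bound[OF integrable_mult_right[OF integrable_norm[OF Fi], of h0]])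
           (use HP h0 Hb in \<open>auto simp: norm_mult mult.commute[of h0] intro!: mult_left_mono\<close>)
      show "integrable P (\<lambda>t. K / 2 * (norm (F t))\<^sup>2 + 1 / (2 * K) * (norm (H (\<Psi> t)))\<^sup>2)"
        using F2 HP2 by simp
      fix t
      have "0 \<le> (K * norm (F t) - norm (H (\<Psi> t)))\<^sup>2" by simp
      then have "0 \<le> (K * norm (F t) - norm (H (\<Psi> t)))\<^sup>2 / (2 * K)" using K by simp
      then show "norm (F t * H (\<Psi> t)) \<le> K / 2 * (norm (F t))\<^sup>2 + 1 / (2 * K) * (norm (H (\<Psi> t)))\<^sup>2"
        using K by (simp add: norm_mult power2_eq_square field_simps)
    qed
    also have "\<dots> = K / 2 * ?F + 1 / (2 * K) * (LINT t|P. (norm (H (\<Psi> t)))\<^sup>2)"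
      using F2 HP2 by simp
    also have "\<dots> \<le> K / 2 * ?F + 1 / (2 * K) * (K * Q)"
      using HPsi K by (intro add_left_mono mult_left_mono) (auto simp: K_def)
    finally show ?thesis using K by simp
  qed
  then have "ennreal Q \<le> ennreal (K * ?F)" by (rule ennreal_leI)
  then show ?thesis
    using g2 unfolding K_def c_def Q_def
    by (subst (asm) nn_integral_eq_integral[symmetric]) (auto simp: g_def)
qed

section \<open>Geometry of the curve\<close>

locale nondegenerate_curve =
  fixes \<gamma> :: "real \<Rightarrow> real ^ 'n::finite"
  assumes smooth: "Ck_on (CARD('n) + 1) {0..1} \<gamma>"
    and nondeg: "\<And>t. t \<in> {0..1} \<Longrightarrow> det (deriv_matrix {0..1} \<gamma> t) \<noteq> 0"
begin

declare nth_deriv_within.simps(2) [simp del]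

abbreviation gd :: "nat \<Rightarrow> real \<Rightarrow> real ^ 'n" where
  "gd k \<equiv> nth_deriv_within k {0..1} \<gamma>"

abbreviation idx :: "'n \<Rightarrow> nat" where
  "idx \<equiv> to_nat_on (UNIV :: 'n set)"

lemma gd_deriv:
  assumes "k \<le> CARD('n)" "t \<in> {0..1}"
  shows "(gd k has_vector_derivative gd (Suc k) t) (at t within {0..1})"
proof -
  have "gd k differentiable at t within {0..1}"
    using smooth assms by (auto simp: Ck_on_def differentiable_on_def)
  then show ?thesis by (simp add: vector_derivative_works nth_deriv_within.simps(2))
qed

lemma gd_continuous: "k \<le> CARD('n) + 1 \<Longrightarrow> continuous_on {0..1} (gd k)"
  using smooth by (cases "k = CARD('n) + 1") (auto simp: Ck_on_def intro!: differentiable_imp_continuous_on)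

lemma idx_bij: "bij_betw idx UNIV {..<CARD('n)}"
  by (rule to_nat_on_finite) simp

lemma idx_less: "idx j < CARD('n)"
  using idx_bij by (auto simp: bij_betw_def)

lemma sum_idx: "(\<Sum>j\<in>UNIV. f (idx j)) = (\<Sum>i<CARD('n). f i)"
  by (rule sum.reindex_bij_betw[OF idx_bij])

text \<open>The velocity is expanded, so d terms reach the derivative of order d, and the bounded
  derivative of order d+1 controls the remainder. Its order (u - a)^d is what makes it subordinate
  to the main terms in \<open>velocity_approx\<close>.\<close>

lemma taylor:
  obtains C where "C \<ge> 0"
    "\<And>a u. 0 \<le> a \<Longrightarrow> a \<le> u \<Longrightarrow> u \<le> 1 \<Longrightarrow>
      norm (gd 1 u - (\<Sum>i<CARD('n). ((u - a) ^ i / fact i) *\<^sub>R gd (Suc i) a)) \<le> C * (u - a) ^ CARD('n)"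
proof -
  have "bounded (gd (CARD('n) + 1) ` {0..1})"
    by (intro compact_imp_bounded compact_continuous_image gd_continuous) auto
  then obtain C where C: "C > 0" "\<And>t. t \<in> {0..1} \<Longrightarrow> norm (gd (CARD('n) + 1) t) \<le> C"
    by (auto simp: bounded_pos)
  show ?thesis
  proof (rule that[of C])
    fix a u :: real assume au: "0 \<le> a" "a \<le> u" "u \<le> 1"
    define i where "i x = ((u - x) ^ (CARD('n) - 1) / fact (CARD('n) - 1)) *\<^sub>R gd (Suc CARD('n)) x" for x
    have "(i has_integral gd 1 u - (\<Sum>i<CARD('n). ((u - a) ^ i / fact i) *\<^sub>R gd (Suc i) a)) {a..u}"
      unfolding i_def
    proof (rule Taylor_has_integral[where Df = "\<lambda>k. gd (Suc k)"])
      fix m t assume mt: "m < CARD('n)" "a \<le> t" "t \<le> u"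
      then show "(gd (Suc m) has_vector_derivative gd (Suc (Suc m)) t) (at t within {a..u})"
        using au by (intro has_vector_derivative_within_subset[OF gd_deriv]) auto
    qed (use au in auto)
    moreover have "norm (i x) \<le> C * (u - a) ^ (CARD('n) - 1)" if "x \<in> {a..u}" for x
    proof -
      have "norm (i x) = (u - x) ^ (CARD('n) - 1) / fact (CARD('n) - 1) * norm (gd (Suc CARD('n)) x)"
        using that by (simp add: i_def)
      also have "\<dots> \<le> (u - a) ^ (CARD('n) - 1) / 1 * C"
        using that au C(2)[of x] by (intro mult_mono frac_le power_mono) (auto simp: fact_ge_1)
      finally show ?thesis by (simp add: mult.commute)
    qed
    ultimately have "norm (gd 1 u - (\<Sum>i<CARD('n). ((u - a) ^ i / fact i) *\<^sub>R gd (Suc i) a))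
        \<le> C * (u - a) ^ (CARD('n) - 1) * measure lborel {a..u}"
      using C au by (intro has_integral_bound_real) auto
    also have "\<dots> = C * (u - a) ^ CARD('n)"
      using au power_minus_mult[of "CARD('n)" "u - a"] by simp
    finally show "norm (gd 1 u - (\<Sum>i<CARD('n). ((u - a) ^ i / fact i) *\<^sub>R gd (Suc i) a)) \<le> C * (u - a) ^ CARD('n)" .
  qed (use C in auto)
qed

lemma deriv_matrix_inner: "(transpose (deriv_matrix {0..1} \<gamma> a) *v x) $ j = x \<bullet> gd (Suc (idx j)) a"
  by (simp add: deriv_matrix_def matrix_vector_mult_def transpose_def inner_vec_def mult.commute)

lemma frame_injective:
  assumes "a \<in> {0..1}" "\<And>j. x \<bullet> gd (Suc (idx j)) a = 0"
  shows "x = 0"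
proof -
  have "transpose (deriv_matrix {0..1} \<gamma> a) *v x = 0"
    unfolding vec_eq_iff deriv_matrix_inner using assms(2) by simp
  moreover have "inj ((*v) (transpose (deriv_matrix {0..1} \<gamma> a)))"
    using nondeg[OF assms(1)] by (simp add: inj_matrix_vector_mult invertible_det_nz transpose_invertible)
  ultimately show ?thesis by (metis injD matrix_vector_mult_0_right)
qed

text \<open>Compactness of [0,1] times the unit sphere makes the constant uniform in the base point
  \<open>a\<close>: the minimum is attained, and \<open>frame_injective\<close> excludes that it is
  0.\<close>

lemma frame_bound:
  obtains C where "C > 0" "\<And>a x. a \<in> {0..1} \<Longrightarrow> norm x \<le> C * (\<Sum>j\<in>UNIV. \<bar>x \<bullet> gd (Suc (idx j)) a\<bar>)"
proof -
  let ?f = "\<lambda>z. \<Sum>j\<in>UNIV. \<bar>snd z \<bullet> gd (Suc (idx j)) (fst z)\<bar>"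
  let ?K = "{0..1::real} \<times> sphere (0 :: real ^ 'n) 1"
  have c: "compact ?K" by (intro compact_Times) auto
  have ne: "?K \<noteq> {}" by (auto simp: sphere_eq_empty)
  have cont: "continuous_on ?K ?f"
  proof (intro continuous_intros)
    fix j
    show "continuous_on ?K (\<lambda>x. gd (Suc (idx j)) (fst x))"
      using idx_less[of j] by (intro continuous_on_compose2[OF gd_continuous] continuous_intros) auto
  qed
  obtain z where z: "z \<in> ?K" "\<And>y. y \<in> ?K \<Longrightarrow> ?f z \<le> ?f y"
    using continuous_attains_inf[OF c ne cont] by blast
  have pos: "?f z > 0"
  proof (rule ccontr)
    assume "\<not> ?f z > 0"
    moreover have "?f z \<ge> 0" by (intro sum_nonneg) auto
    ultimately have "?f z = 0" by linarith
    then have "\<And>j. snd z \<bullet> gd (Suc (idx j)) (fst z) = 0"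
      by (simp add: sum_nonneg_eq_0_iff)
    then have "snd z = 0" using z(1) by (intro frame_injective[of "fst z"]) auto
    then show False using z(1) by auto
  qed
  show ?thesis
  proof (rule that[of "1 / ?f z"])
    fix a :: real and x :: "real ^ 'n" assume a: "a \<in> {0..1}"
    show "norm x \<le> 1 / ?f z * (\<Sum>j\<in>UNIV. \<bar>x \<bullet> gd (Suc (idx j)) a\<bar>)"
    proof (cases "x = 0")
      case False
      have "(a, x /\<^sub>R norm x) \<in> ?K" using a False by auto
      from z(2)[OF this] have "?f z \<le> (\<Sum>j\<in>UNIV. \<bar>x \<bullet> gd (Suc (idx j)) a\<bar>) / norm x"
        by (simp add: abs_mult sum_distrib_left divide_inverse mult.commute)
      then show ?thesis using pos False by (simp add: field_simps)
    qed simp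
  qed (use pos in simp)
qed

end

section \<open>Polynomials at separated nodes\<close>

text \<open>Up to the factorials, \<open>y\<close> lists the coefficients of a polynomial of degree
  below \<open>CARD('n)\<close> that vanishes at as many distinct points.\<close>

lemma vandermonde_injective:
  fixes u y :: "'n::finite \<Rightarrow> real"
  assumes "inj u" "\<And>i. (\<Sum>k\<in>UNIV. y k * (u i ^ to_nat_on UNIV k / fact (to_nat_on UNIV k))) = 0"
  shows "y k = 0"
proof -
  let ?e = "to_nat_on (UNIV :: 'n set)"
  have e: "bij_betw ?e UNIV {..<CARD('n)}" by (rule to_nat_on_finite) simp
  define p where "p = (\<Sum>k\<in>UNIV. monom (y k / fact (?e k)) (?e k))"
  have poly: "poly p x = (\<Sum>k\<in>UNIV. y k * (x ^ ?e k / fact (?e k)))" for x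
    by (simp add: p_def poly_sum poly_monom)
  have coeff: "coeff p (?e k) = y k / fact (?e k)" for k
  proof -
    have "coeff p (?e k) = (\<Sum>j\<in>UNIV. if j = k then y j / fact (?e j) else 0)"
      using e unfolding p_def coeff_sum by (intro sum.cong) (auto simp: bij_betw_def inj_on_def)
    then show ?thesis by simp
  qed
  have "p = 0"
  proof (rule ccontr)
    assume p: "p \<noteq> 0"
    have "degree p < CARD('n)"
    proof -
      have "degree p \<le> CARD('n) - 1" unfolding p_def
      proof (rule degree_sum_le)
        fix k
        have "?e k < CARD('n)" using e by (auto simp: bij_betw_def)
        then show "degree (monom (y k / fact (?e k)) (?e k)) \<le> CARD('n) - 1"
          using degree_monom_le[of "y k / fact (?e k)" "?e k"] by linarith
      qed simp
      then show ?thesis using zero_less_card_finite[where 'a = 'n] by linarith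
    qed
    moreover have "range u \<subseteq> {x. poly p x = 0}" using assms(2) poly by auto
    then have "card (range u) \<le> card {x. poly p x = 0}" by (rule card_mono[OF poly_roots_finite[OF p]])
    moreover have "card {x. poly p x = 0} \<le> degree p" by (rule card_poly_roots_bound[OF p])
    ultimately show False using card_image[OF assms(1)] by simp
  qed
  then show ?thesis using coeff[of k] by simp
qed

text \<open>Quantitative form of \<open>vandermonde_injective\<close>. Nodes in [0,1] at mutual
  distance at least h form a compact set, and both sides are homogeneous in \<open>y\<close>, so a
  positive minimum over the unit sphere gives a constant that depends on h and the dimension
  alone.\<close>

lemma moment_bound:
  assumes h: "h > 0"
  shows "\<exists>c>0. \<forall>(u :: 'n::finite \<Rightarrow> real) (y :: 'n \<Rightarrow> real).
    (\<forall>i. u i \<in> {0..1}) \<longrightarrow> (\<forall>i j. i \<noteq> j \<longrightarrow> \<bar>u i - u j\<bar> \<ge> h) \<longrightarrow>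
      c * (\<Sum>k\<in>UNIV. \<bar>y k\<bar>) \<le> (\<Sum>i\<in>UNIV. \<bar>\<Sum>k\<in>UNIV. y k * (u i ^ to_nat_on UNIV k / fact (to_nat_on UNIV k))\<bar>)"
proof -
  let ?e = "to_nat_on (UNIV :: 'n set)"
  define U where "U = {u :: real ^ 'n. (\<forall>i. 0 \<le> u $ i \<and> u $ i \<le> 1) \<and> (\<forall>i j. i \<noteq> j \<longrightarrow> \<bar>u $ i - u $ j\<bar> \<ge> h)}"
  define K where "K = U \<times> sphere (0 :: real ^ 'n) 1"
  let ?f = "\<lambda>z. \<Sum>i\<in>(UNIV :: 'n set). \<bar>\<Sum>k\<in>UNIV. snd z $ k * (fst z $ i ^ ?e k / fact (?e k))\<bar>"
  have f0: "?f z \<ge> 0" for z :: "(real ^ 'n) \<times> (real ^ 'n)" by (intro sum_nonneg) auto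
  have "closed U" unfolding U_def
    by (intro closed_Collect_conj closed_Collect_all closed_Collect_imp closed_Collect_le continuous_intros) auto
  moreover have "bounded U"
    by (rule bounded_subset[of "cbox 0 1"]) (auto simp: mem_box_cart U_def)
  ultimately have c: "compact K"
    unfolding K_def by (intro compact_Times) (auto simp: compact_eq_bounded_closed)
  have cont: "continuous_on K ?f" by (intro continuous_intros) auto
  have sph: "sphere (0 :: real ^ 'n) 1 \<noteq> {}" by (simp add: sphere_eq_empty)
  show ?thesis
  proof (cases "U = {}")
    \<comment> \<open>For large h there are no d separated nodes in [0,1]. Nothing is claimed then,
      but there is no minimum to take either.\<close>
    case True
    show ?thesis
    proof (intro exI[of _ 1] conjI allI impI)
      fix u y :: "'n \<Rightarrow> real" assume "\<forall>i. u i \<in> {0..1}" "\<forall>i j. i \<noteq> j \<longrightarrow> \<bar>u i - u j\<bar> \<ge> h"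
      then have "(\<chi> i. u i) \<in> U" by (auto simp: U_def)
      then show "1 * (\<Sum>k\<in>UNIV. \<bar>y k\<bar>) \<le> (\<Sum>i\<in>UNIV. \<bar>\<Sum>k\<in>UNIV. y k * (u i ^ ?e k / fact (?e k))\<bar>)"
        unfolding True by simp
    qed simp
  next
    case False
    then have "K \<noteq> {}" using sph unfolding K_def by blast
    then obtain z where z: "z \<in> K" "\<And>w. w \<in> K \<Longrightarrow> ?f z \<le> ?f w"
      using continuous_attains_inf[OF c _ cont] by blast
    have pos: "?f z > 0"
    proof (rule ccontr)
      assume "\<not> ?f z > 0"
      with f0[of z] have "?f z = 0" by (intro antisym) linarith+
      then have *: "(\<Sum>k\<in>UNIV. snd z $ k * (fst z $ i ^ ?e k / fact (?e k))) = 0" for i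
        by (simp add: sum_nonneg_eq_0_iff)
      have "inj (\<lambda>i. fst z $ i)"
      proof (rule injI, rule ccontr)
        fix i j assume "fst z $ i = fst z $ j" "i \<noteq> j"
        moreover have "\<bar>fst z $ i - fst z $ j\<bar> \<ge> h" using z(1) \<open>i \<noteq> j\<close> by (auto simp: K_def U_def)
        ultimately show False using h by simp
      qed
      then have "snd z $ k = 0" for k using vandermonde_injective[of "\<lambda>i. fst z $ i" "\<lambda>k. snd z $ k"] * by blast
      then have "snd z = 0" by (simp add: vec_eq_iff)
      then show False using z(1) by (auto simp: K_def)
    qed
    have le: "(\<Sum>k\<in>UNIV. \<bar>y $ k\<bar>) \<le> CARD('n) * norm y" for y :: "real ^ 'n"
      using sum_bounded_above[of UNIV "\<lambda>k. \<bar>y $ k\<bar>" "norm y"] component_le_norm_cart by auto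
    show ?thesis
    proof (intro exI[of _ "?f z / CARD('n)"] conjI allI impI)
      fix u y :: "'n \<Rightarrow> real"
      assume u: "\<forall>i. u i \<in> {0..1}" "\<forall>i j. i \<noteq> j \<longrightarrow> \<bar>u i - u j\<bar> \<ge> h"
      define v where "v = (\<chi> k. y k)"
      let ?S = "\<Sum>i\<in>UNIV. \<bar>\<Sum>k\<in>UNIV. y k * (u i ^ ?e k / fact (?e k))\<bar>"
      have "?f z * norm v \<le> ?S"
      proof (cases "v = 0")
        case True
        then show ?thesis by (auto intro: sum_nonneg)
      next
        case False
        have "((\<chi> i. u i), v /\<^sub>R norm v) \<in> K" using u False by (auto simp: K_def U_def)
        from z(2)[OF this] have "?f z \<le> (\<Sum>i\<in>UNIV. \<bar>\<Sum>k\<in>UNIV. inverse (norm v) * (y k * (u i ^ ?e k / fact (?e k)))\<bar>)"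
          by (simp add: v_def mult.assoc)
        also have "\<dots> = inverse (norm v) * ?S"
          unfolding sum_distrib_left[symmetric] abs_mult by simp
        finally show ?thesis using False by (simp add: field_simps)
      qed
      moreover have "?f z * (\<Sum>k\<in>UNIV. \<bar>y k\<bar>) \<le> ?f z * (CARD('n) * norm v)"
        using le[of v] pos by (intro mult_left_mono) (auto simp: v_def)
      ultimately have "?f z * (\<Sum>k\<in>UNIV. \<bar>y k\<bar>) \<le> CARD('n) * ?S"
        by (smt (verit) mult.left_commute mult_left_mono of_nat_0_le_iff)
      then show "?f z / CARD('n) * (\<Sum>k\<in>UNIV. \<bar>y k\<bar>) \<le> ?S"
        by (simp add: field_simps)
    qed (use pos in simp)
  qed
qed

lemma matrix_inv_right:
  fixes A :: "real ^ 'n ^ 'n"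
  assumes "invertible A"
  shows "A ** matrix_inv A = mat 1"
  using someI_ex[OF assms[unfolded invertible_def]] unfolding matrix_inv_def by blast

section \<open>Coordinates adapted to an arc of length l\<close>

context nondegenerate_curve
begin

text \<open>Coordinates on the side of x. The pairing with the k-th derivative at \<open>a\<close>
  is weighted by l^k, the k-th side of the box around the arc, so the dual box is the set where all
  these coordinates are at most 1 in size. The matching coordinates on the side of the curve are
  \<open>coord\<close>.\<close>

definition anis :: "real \<Rightarrow> real \<Rightarrow> real ^ 'n \<Rightarrow> 'n \<Rightarrow> real" where
  "anis a l x j = l ^ Suc (idx j) * (x \<bullet> gd (Suc (idx j)) a)"

abbreviation anis_norm :: "real \<Rightarrow> real \<Rightarrow> real ^ 'n \<Rightarrow> real" where
  "anis_norm a l x \<equiv> (\<Sum>k\<in>UNIV. \<bar>anis a l x k\<bar>)"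

text \<open>On the scale of the arc the velocity is 1/l times a polynomial in (u - a)/l with
  coefficients \<open>anis\<close>. The main part is of order \<open>anis_norm / l\<close>, the
  error only of order \<open>anis_norm\<close>: the remainder carries l^d, which is at most every
  side l^k, and \<open>frame_bound\<close> replaces |x| by pairings. This gain of one factor l lets
  a short arc be treated as a moment curve.\<close>

lemma velocity_approx:
  obtains C where "C \<ge> 0"
    "\<And>a l u x. 0 \<le> a \<Longrightarrow> 0 < l \<Longrightarrow> l \<le> 1 \<Longrightarrow> a \<le> u \<Longrightarrow> u \<le> a + l \<Longrightarrow> u \<le> 1 \<Longrightarrow>
      \<bar>x \<bullet> gd 1 u - (\<Sum>k\<in>UNIV. anis a l x k * (((u - a) / l) ^ idx k / fact (idx k))) / l\<bar>
        \<le> C * anis_norm a l x"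
proof -
  obtain C1 where C1: "C1 \<ge> 0"
    "\<And>a u. 0 \<le> a \<Longrightarrow> a \<le> u \<Longrightarrow> u \<le> 1 \<Longrightarrow>
      norm (gd 1 u - (\<Sum>i<CARD('n). ((u - a) ^ i / fact i) *\<^sub>R gd (Suc i) a)) \<le> C1 * (u - a) ^ CARD('n)"
    using taylor by blast
  obtain C2 where C2: "C2 > 0"
    "\<And>a x. a \<in> {0..1} \<Longrightarrow> norm x \<le> C2 * (\<Sum>j\<in>UNIV. \<bar>x \<bullet> gd (Suc (idx j)) a\<bar>)"
    using frame_bound by blast
  show ?thesis
  proof (rule that[of "C2 * C1"])
    fix a l u :: real and x :: "real ^ 'n"
    assume *: "0 \<le> a" "0 < l" "l \<le> 1" "a \<le> u" "u \<le> a + l" "u \<le> 1"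
    define R where "R = gd 1 u - (\<Sum>i<CARD('n). ((u - a) ^ i / fact i) *\<^sub>R gd (Suc i) a)"
    have R: "norm R \<le> C1 * l ^ CARD('n)"
    proof -
      have "norm R \<le> C1 * (u - a) ^ CARD('n)" unfolding R_def by (rule C1(2)) (use * in auto)
      also have "\<dots> \<le> C1 * l ^ CARD('n)" using * C1(1) by (intro mult_left_mono power_mono) auto
      finally show ?thesis .
    qed
    have "x \<bullet> gd 1 u = x \<bullet> R + x \<bullet> (\<Sum>i<CARD('n). ((u - a) ^ i / fact i) *\<^sub>R gd (Suc i) a)"
      by (simp add: R_def inner_diff_right)
    also have "x \<bullet> (\<Sum>i<CARD('n). ((u - a) ^ i / fact i) *\<^sub>R gd (Suc i) a)
        = (\<Sum>i<CARD('n). ((u - a) ^ i / fact i) * (x \<bullet> gd (Suc i) a))"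
      by (simp add: inner_sum_right)
    also have "\<dots> = (\<Sum>k\<in>UNIV. ((u - a) ^ idx k / fact (idx k)) * (x \<bullet> gd (Suc (idx k)) a))"
      by (rule sum_idx[symmetric])
    also have "\<dots> = (\<Sum>k\<in>UNIV. anis a l x k * (((u - a) / l) ^ idx k / fact (idx k))) / l"
      using * unfolding sum_divide_distrib anis_def by (intro sum.cong) (auto simp: power_divide)
    finally have eq: "x \<bullet> gd 1 u - (\<Sum>k\<in>UNIV. anis a l x k * (((u - a) / l) ^ idx k / fact (idx k))) / l = x \<bullet> R"
      by simp
    have "\<bar>x \<bullet> R\<bar> \<le> norm x * norm R" by (rule Cauchy_Schwarz_ineq2)
    also have "\<dots> \<le> (C2 * (\<Sum>j\<in>UNIV. \<bar>x \<bullet> gd (Suc (idx j)) a\<bar>)) * (C1 * l ^ CARD('n))"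
      using * C2(1) by (intro mult_mono R C2(2)) (auto intro!: sum_nonneg mult_nonneg_nonneg)
    also have "\<dots> = C2 * C1 * (\<Sum>j\<in>UNIV. l ^ CARD('n) * \<bar>x \<bullet> gd (Suc (idx j)) a\<bar>)"
      by (simp add: sum_distrib_left mult_ac)
    also have "\<dots> \<le> C2 * C1 * anis_norm a l x"
    proof (intro mult_left_mono sum_mono)
      fix j
      have "l ^ CARD('n) \<le> l ^ Suc (idx j)"
        using * idx_less[of j] by (intro power_decreasing) auto
      then show "l ^ CARD('n) * \<bar>x \<bullet> gd (Suc (idx j)) a\<bar> \<le> \<bar>anis a l x j\<bar>"
        using * by (simp only: anis_def abs_mult) (intro mult_right_mono, auto)
    qed (use C1 C2 in auto)
    finally show "\<bar>x \<bullet> gd 1 u - (\<Sum>k\<in>UNIV. anis a l x k * (((u - a) / l) ^ idx k / fact (idx k))) / l\<bar>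
        \<le> C2 * C1 * anis_norm a l x" unfolding eq .
  qed (use C1 C2 in auto)
qed

text \<open>\<open>moment_bound\<close> at the rescaled nodes (u i - a)/l, with the Taylor error
  absorbed once l is small.\<close>

lemma velocity_lower:
  assumes h: "h > 0"
  obtains c l0 where "c > 0" "l0 > 0" "l0 \<le> 1"
    "\<And>a l u x. 0 \<le> a \<Longrightarrow> 0 < l \<Longrightarrow> l \<le> l0 \<Longrightarrow> a + l \<le> 1 \<Longrightarrow> \<forall>i. u i \<in> {a..a + l} \<Longrightarrow>
      \<forall>i j. i \<noteq> j \<longrightarrow> \<bar>u i - u j\<bar> \<ge> h * l \<Longrightarrow>
      c / l * anis_norm a l x \<le> (\<Sum>i\<in>(UNIV :: 'n set). \<bar>x \<bullet> gd 1 (u i)\<bar>)"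
proof -
  from moment_bound[OF h, where 'n = 'n] obtain c where c0: "c > 0 \<and> (\<forall>(u :: 'n \<Rightarrow> real) (y :: 'n \<Rightarrow> real).
    (\<forall>i. u i \<in> {0..1}) \<longrightarrow> (\<forall>i j. i \<noteq> j \<longrightarrow> \<bar>u i - u j\<bar> \<ge> h) \<longrightarrow>
      c * (\<Sum>k\<in>UNIV. \<bar>y k\<bar>) \<le> (\<Sum>i\<in>UNIV. \<bar>\<Sum>k\<in>UNIV. y k * (u i ^ idx k / fact (idx k))\<bar>))" ..
  note c = conjunct1[OF c0] conjunct2[OF c0, rule_format]
  obtain C where C: "C \<ge> 0"
    "\<And>a l u x. 0 \<le> a \<Longrightarrow> 0 < l \<Longrightarrow> l \<le> 1 \<Longrightarrow> a \<le> u \<Longrightarrow> u \<le> a + l \<Longrightarrow> u \<le> 1 \<Longrightarrow>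
      \<bar>x \<bullet> gd 1 u - (\<Sum>k\<in>UNIV. anis a l x k * (((u - a) / l) ^ idx k / fact (idx k))) / l\<bar>
        \<le> C * anis_norm a l x"
    using velocity_approx by blast
  \<comment> \<open>For l <= c / ?D the d errors C * S add up to at most half of the main term c/l *
    S. The \<open>+ 1\<close> keeps the divisor positive when C = 0.\<close>
  let ?D = "2 * real CARD('n) * (C + 1)"
  have D: "?D > 0" using C by simp
  show ?thesis
  proof (rule that[of "c / 2" "min 1 (c / ?D)"])
    fix a l :: real and u :: "'n \<Rightarrow> real" and x :: "real ^ 'n"
    assume *: "0 \<le> a" "0 < l" "l \<le> min 1 (c / ?D)" "a + l \<le> 1" "\<forall>i. u i \<in> {a..a + l}"
      "\<forall>i j. i \<noteq> j \<longrightarrow> \<bar>u i - u j\<bar> \<ge> h * l"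
    define S where "S = anis_norm a l x"
    have S: "S \<ge> 0" unfolding S_def by (intro sum_nonneg) auto
    define w where "w i = (\<Sum>k\<in>UNIV. anis a l x k * (((u i - a) / l) ^ idx k / fact (idx k)))" for i
    have "c * S \<le> (\<Sum>i\<in>UNIV. \<bar>w i\<bar>)" unfolding S_def w_def
    proof (rule c(2)[where u = "\<lambda>i. (u i - a) / l" and y = "anis a l x"])
      show "(u i - a) / l \<in> {0..1}" for i using *(5)[rule_format, of i] *(2) by auto
      show "\<bar>(u i - a) / l - (u j - a) / l\<bar> \<ge> h" if "i \<noteq> j" for i j
      proof -
        have "\<bar>(u i - a) / l - (u j - a) / l\<bar> = \<bar>u i - u j\<bar> / l"
          using *(2) by (simp add: diff_divide_distrib[symmetric] abs_divide)
        then show ?thesis using *(6) that *(2) by (simp add: field_simps)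
      qed
    qed
    then have "c / l * S \<le> (\<Sum>i\<in>UNIV. \<bar>w i\<bar> / l)"
      using *(2) by (simp add: sum_divide_distrib[symmetric] divide_right_mono)
    also have "\<dots> \<le> (\<Sum>i\<in>UNIV. \<bar>x \<bullet> gd 1 (u i)\<bar> + C * S)"
    proof (rule sum_mono)
      fix i
      have "\<bar>x \<bullet> gd 1 (u i) - w i / l\<bar> \<le> C * S" unfolding w_def S_def
      proof (rule C(2))
        show "a \<le> u i" "u i \<le> a + l" using *(5) by auto
        then show "u i \<le> 1" using *(4) by linarith
      qed (use * in auto)
      then show "\<bar>w i\<bar> / l \<le> \<bar>x \<bullet> gd 1 (u i)\<bar> + C * S"
        using *(2) abs_divide[of "w i" l] by linarith
    qed
    also have "\<dots> = (\<Sum>i\<in>UNIV. \<bar>x \<bullet> gd 1 (u i)\<bar>) + CARD('n) * C * S"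
      by (simp add: sum.distrib)
    finally have 1: "c / l * S \<le> \<dots>" .
    have "l * ?D \<le> c" using *(3) D by (simp add: field_simps)
    moreover have "l * (2 * (CARD('n) * C)) \<le> l * ?D" using *(2) by (intro mult_left_mono) auto
    ultimately have "l * (2 * (CARD('n) * C)) \<le> c" by linarith
    then have "CARD('n) * C \<le> c / 2 / l" using *(2) by (simp add: field_simps)
    then have "CARD('n) * C * S \<le> c / 2 / l * S" using S by (rule mult_right_mono)
    then show "c / 2 / l * anis_norm a l x \<le> (\<Sum>i\<in>UNIV. \<bar>x \<bullet> gd 1 (u i)\<bar>)"
      using 1 unfolding S_def[symmetric] by (simp add: field_simps)
  qed (use c D in auto)
qed

text \<open>Formulated for one functional x at a time, since for a vector-valued curve the
  intermediate point has to depend on x.\<close>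

lemma curve_mvt:
  assumes "0 \<le> s" "s < t" "t \<le> 1"
  shows "\<exists>v\<in>{s<..<t}. x \<bullet> (\<gamma> t - \<gamma> s) = (t - s) * (x \<bullet> gd 1 v)"
proof -
  have "\<exists>v\<in>{s<..<t}. x \<bullet> \<gamma> t - x \<bullet> \<gamma> s = (\<lambda>h. h * (x \<bullet> gd 1 v)) (t - s)"
  proof (rule mvt_simple[OF assms(2)])
    fix v assume "s \<le> v" "v \<le> t"
    then have "(gd 0 has_vector_derivative gd (Suc 0) v) (at v within {s..t})"
      using assms by (intro has_vector_derivative_within_subset[OF gd_deriv]) auto
    then have "((\<lambda>v. x \<bullet> \<gamma> v) has_derivative (\<lambda>h. x \<bullet> (h *\<^sub>R gd 1 v))) (at v within {s..t})"
      unfolding has_vector_derivative_def by (intro has_derivative_inner_right) simp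
    then show "((\<lambda>v. x \<bullet> \<gamma> v) has_derivative (\<lambda>h. h * (x \<bullet> gd 1 v))) (at v within {s..t})"
      by simp
  qed
  then show ?thesis by (simp add: inner_diff_right)
qed

text \<open>A velocity of order \<open>anis_norm / l\<close> acts for a time of at most l. By
  duality (\<open>coord_upper\<close>) this puts the arc into a box whose size in the coordinates
  \<open>coord\<close> does not depend on l.\<close>

lemma displacement_upper:
  obtains C where "C > 0"
    "\<And>a l u x. 0 \<le> a \<Longrightarrow> 0 < l \<Longrightarrow> a + l \<le> 1 \<Longrightarrow> u \<in> {a..a + l} \<Longrightarrow>
      \<bar>x \<bullet> (\<gamma> u - \<gamma> a)\<bar> \<le> C * anis_norm a l x"
proof -
  obtain C where C: "C \<ge> 0"
    "\<And>a l u x. 0 \<le> a \<Longrightarrow> 0 < l \<Longrightarrow> l \<le> 1 \<Longrightarrow> a \<le> u \<Longrightarrow> u \<le> a + l \<Longrightarrow> u \<le> 1 \<Longrightarrow>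
      \<bar>x \<bullet> gd 1 u - (\<Sum>k\<in>UNIV. anis a l x k * (((u - a) / l) ^ idx k / fact (idx k))) / l\<bar>
        \<le> C * anis_norm a l x"
    using velocity_approx by blast
  show ?thesis
  proof (rule that[of "1 + C"])
    fix a l u :: real and x :: "real ^ 'n"
    assume *: "0 \<le> a" "0 < l" "a + l \<le> 1" "u \<in> {a..a + l}"
    define S where "S = anis_norm a l x"
    have S: "S \<ge> 0" unfolding S_def by (intro sum_nonneg) auto
    show "\<bar>x \<bullet> (\<gamma> u - \<gamma> a)\<bar> \<le> (1 + C) * anis_norm a l x"
    proof (cases "u = a")
      case True
      then show ?thesis using C S by (simp add: S_def)
    next
      case False
      obtain v where v: "a < v" "v < u" "x \<bullet> (\<gamma> u - \<gamma> a) = (u - a) * (x \<bullet> gd 1 v)"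
        using curve_mvt[of a u x] * False by auto
      define w where "w = (\<Sum>k\<in>UNIV. anis a l x k * (((v - a) / l) ^ idx k / fact (idx k)))"
      have "\<bar>w\<bar> \<le> S" unfolding w_def S_def
      proof (rule order_trans[OF sum_abs sum_mono])
        fix k
        have "((v - a) / l) ^ idx k \<le> 1" using v * by (intro power_le_one) auto
        then have "((v - a) / l) ^ idx k / fact (idx k) \<le> 1 / 1"
          using fact_ge_1[of "idx k", where 'a = real] by (simp add: divide_le_eq order_trans[of _ 1])
        moreover have "0 \<le> ((v - a) / l) ^ idx k / fact (idx k)" using v * by simp
        ultimately show "\<bar>anis a l x k * (((v - a) / l) ^ idx k / fact (idx k))\<bar> \<le> \<bar>anis a l x k\<bar>"
          by (simp only: abs_mult abs_of_nonneg div_by_1) (intro mult_left_le, auto)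
      qed
      moreover have "\<bar>x \<bullet> gd 1 v - w / l\<bar> \<le> C * S" unfolding w_def S_def
        by (rule C(2)) (use * v in auto)
      moreover have "\<bar>w / l\<bar> \<le> S / l" using calculation(1) * by (simp add: divide_right_mono abs_divide)
      ultimately have "\<bar>x \<bullet> gd 1 v\<bar> \<le> S / l + C * S" by linarith
      then have "\<bar>u - a\<bar> * \<bar>x \<bullet> gd 1 v\<bar> \<le> l * (S / l + C * S)"
        using * v by (intro mult_mono) auto
      also have "\<dots> = S + l * (C * S)" using * by (simp add: distrib_left)
      also have "\<dots> \<le> S + 1 * (C * S)" using * C S by (intro add_left_mono mult_right_mono) auto
      finally show ?thesis
        unfolding v(3) abs_mult S_def[symmetric] by (simp add: distrib_right)
    qed
  qed (use C in auto)
qed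

text \<open>Coordinates of v in the basis of the vectors l^k times the k-th derivative at
  \<open>a\<close>, that is, in units of the sides of the box.\<close>

definition coord :: "real \<Rightarrow> real \<Rightarrow> real ^ 'n \<Rightarrow> 'n \<Rightarrow> real" where
  "coord a l v j = (matrix_inv (deriv_matrix {0..1} \<gamma> a) *v v) $ j / l ^ Suc (idx j)"

lemma inner_eq_anis_coord:
  assumes "a \<in> {0..1}" "l > 0"
  shows "x \<bullet> v = (\<Sum>j\<in>UNIV. anis a l x j * coord a l v j)"
proof -
  let ?M = "deriv_matrix {0..1} \<gamma> a"
  have "?M ** matrix_inv ?M = mat 1"
    using nondeg[OF assms(1)] by (simp add: matrix_inv_right invertible_det_nz)
  then have "x \<bullet> v = x \<bullet> (?M *v (matrix_inv ?M *v v))"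
    by (simp add: matrix_vector_mul_assoc)
  also have "\<dots> = (transpose ?M *v x) \<bullet> (matrix_inv ?M *v v)"
    by (simp add: dot_lmul_matrix)
  also have "\<dots> = (\<Sum>j\<in>UNIV. (x \<bullet> gd (Suc (idx j)) a) * (matrix_inv ?M *v v) $ j)"
    unfolding inner_vec_def deriv_matrix_inner by simp
  also have "\<dots> = (\<Sum>j\<in>UNIV. anis a l x j * coord a l v j)"
    using assms unfolding anis_def coord_def by (intro sum.cong) auto
  finally show ?thesis .
qed

lemma anis_surj:
  assumes "a \<in> {0..1}" "l > 0"
  obtains x where "\<And>j. anis a l x j = y j"
proof -
  let ?M = "transpose (deriv_matrix {0..1} \<gamma> a)"
  define x where "x = matrix_inv ?M *v (\<chi> j. y j / l ^ Suc (idx j))"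
  have "?M ** matrix_inv ?M = mat 1"
    using nondeg[OF assms(1)] by (simp add: matrix_inv_right transpose_invertible invertible_det_nz)
  then have x: "?M *v x = (\<chi> j. y j / l ^ Suc (idx j))"
    unfolding x_def by (simp add: matrix_vector_mul_assoc)
  have "x \<bullet> gd (Suc (idx j)) a = y j / l ^ Suc (idx j)" for j
    unfolding deriv_matrix_inner[symmetric] x by simp
  then show ?thesis using assms by (intro that[of x]) (simp add: anis_def)
qed

lemma anis_diff: "anis a l (x - y) j = anis a l x j - anis a l y j"
  by (simp add: anis_def inner_diff_left right_diff_distrib)

lemma coord_diff: "coord a l (v - w) j = coord a l v j - coord a l w j"
  by (simp add: coord_def matrix_vector_mult_diff_distrib diff_divide_distrib)

lemma coord_measurable: "(\<lambda>v. coord a l v j) \<in> borel_measurable borel"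
  unfolding coord_def divide_inverse
  by (intro borel_measurable_continuous_onI continuous_intros)


text \<open>Test with the x whose \<open>anis\<close> coordinates form the j-th unit vector: it
  reads off the j-th coordinate and has \<open>anis_norm\<close> equal to 1.\<close>

lemma coord_upper:
  assumes "a \<in> {0..1}" "l > 0" and v: "\<And>x. \<bar>x \<bullet> v\<bar> \<le> C * anis_norm a l x"
  shows "\<bar>coord a l v j\<bar> \<le> C"
proof -
  obtain x where x: "\<And>k. anis a l x k = (if k = j then 1 else 0)"
    using anis_surj[OF assms(1,2), of "\<lambda>k. if k = j then 1 else 0"] by blast
  have "x \<bullet> v = (\<Sum>k\<in>UNIV. if k = j then coord a l v k else 0)"
    unfolding inner_eq_anis_coord[OF assms(1,2)] x by (intro sum.cong) auto
  then have "x \<bullet> v = coord a l v j" by simp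
  moreover have "anis_norm a l x = (\<Sum>k\<in>UNIV. if k = j then 1 else 0)"
    unfolding x by (intro sum.cong) auto
  then have "anis_norm a l x = 1" by simp
  ultimately show ?thesis using v[of x] by simp
qed

text \<open>By the mean value theorem the difference of the two sums is \<open>V (t - s)\<close> for a matrix \<open>V\<close> whose
  \<open>i\<close>-th column is an average of \<open>\<gamma>'\<close> between \<open>s i\<close> and \<open>t i\<close>.  The transpose of \<open>V\<close> inherits the lower
  bound of the velocities, tested against each fixed \<open>x\<close>; no determinant is expanded.\<close>

lemma sum_curve_lower:
  fixes t s lo hi :: "'n \<Rightarrow> real"
  assumes "a \<in> {0..1}" "l > 0" "c > 0"
    and vl: "\<And>u x. \<forall>i. u i \<in> {lo i..hi i} \<Longrightarrow> c / l * anis_norm a l x \<le> (\<Sum>i\<in>UNIV. \<bar>x \<bullet> gd 1 (u i)\<bar>)"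
    and I: "\<And>i. 0 \<le> lo i" "\<And>i. hi i \<le> 1"
    and t: "\<And>i. t i \<in> {lo i..hi i}" and s: "\<And>i. s i \<in> {lo i..hi i}"
    and \<rho>: "\<And>i. \<bar>coord a l ((\<Sum>i\<in>UNIV. \<gamma> (t i)) - (\<Sum>i\<in>UNIV. \<gamma> (s i))) i\<bar> \<le> \<rho>"
  shows "\<bar>t j - s j\<bar> \<le> l / c * \<rho>"
proof -
  \<comment> \<open>Difference quotients, completed by the derivative where t i = s i, so that each
    \<open>v i\<close> is a mean velocity in the degenerate case too.\<close>
  define v where "v i = (if t i = s i then gd 1 (t i) else (\<gamma> (t i) - \<gamma> (s i)) /\<^sub>R (t i - s i))" for i
  have v_eq: "\<gamma> (t i) - \<gamma> (s i) = (t i - s i) *\<^sub>R v i" for i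
    by (simp add: v_def)
  \<comment> \<open>The mean value point depends on x as well as on i. As \<open>vl\<close> is
    assumed for every choice of points in the intervals, the lower bound passes to \<open>v\<close>
    nevertheless.\<close>
  have ex: "\<exists>u\<in>{lo i..hi i}. x \<bullet> v i = x \<bullet> gd 1 u" for i x
  proof -
    consider "t i = s i" | "s i < t i" | "t i < s i" by linarith
    then show ?thesis
    proof cases
      case 1
      then show ?thesis using t[of i] by (auto simp: v_def)
    next
      case 2
      then obtain w where "w \<in> {s i<..<t i}" "x \<bullet> (\<gamma> (t i) - \<gamma> (s i)) = (t i - s i) * (x \<bullet> gd 1 w)"
        using curve_mvt[of "s i" "t i" x] s[of i] t[of i] I(1)[of i] I(2)[of i] by auto
      then show ?thesis using 2 s[of i] t[of i] unfolding v_eq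
        by (intro bexI[of _ w]) auto
    next
      case 3
      then obtain w where "w \<in> {t i<..<s i}" "x \<bullet> (\<gamma> (s i) - \<gamma> (t i)) = (s i - t i) * (x \<bullet> gd 1 w)"
        using curve_mvt[of "t i" "s i" x] s[of i] t[of i] I(1)[of i] I(2)[of i] by auto
      moreover have "\<gamma> (s i) - \<gamma> (t i) = (s i - t i) *\<^sub>R v i"
        using v_eq[of i] by (metis minus_diff_eq scaleR_left.minus)
      ultimately show ?thesis using 3 s[of i] t[of i]
        by (intro bexI[of _ w]) auto
    qed
  qed
  have low: "c / l * anis_norm a l x \<le> (\<Sum>i\<in>UNIV. \<bar>x \<bullet> v i\<bar>)" for x
  proof -
    obtain u where u: "\<And>i. u i \<in> {lo i..hi i}" "\<And>i. x \<bullet> v i = x \<bullet> gd 1 (u i)"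
      using ex[where x = x] by metis
    show ?thesis unfolding u(2) by (rule vl) (use u in blast)
  qed
  define V where "V x = (\<chi> i. x \<bullet> v i)" for x
  have lin: "linear V" by (rule linearI) (simp_all add: V_def vec_eq_iff inner_add_left)
  have "inj V"
  proof (rule linear_injective_0[OF lin, THEN iffD2], intro allI impI)
    fix x assume "V x = 0"
    then have "x \<bullet> v i = 0" for i by (simp add: V_def vec_eq_iff)
    then have "c / l * anis_norm a l x \<le> 0" using low[of x] by simp
    then have "anis_norm a l x \<le> 0" using assms(2,3) by (simp add: mult_le_0_iff divide_le_0_iff)
    then have "anis_norm a l x = 0" by (intro antisym sum_nonneg) auto
    then have "anis a l x k = 0" for k by (simp add: sum_nonneg_eq_0_iff)
    then show "x = 0" using assms by (intro frame_injective[OF assms(1)]) (simp add: anis_def)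
  qed
  then have "surj V" using lin by (simp add: linear_injective_imp_surjective)
  \<comment> \<open>This functional sees only \<open>v j\<close>, so pairing it with the difference
    of the two sums isolates t j - s j. The lower bound applied to it limits its
    \<open>anis_norm\<close> to l/c.\<close>
  then obtain x where "V x = axis j 1" by (metis surjD)
  then have x: "x \<bullet> v i = (if i = j then 1 else 0)" for i by (auto simp: V_def vec_eq_iff axis_def)
  have "c / l * anis_norm a l x \<le> (\<Sum>i\<in>UNIV. if i = j then 1 else 0)"
    by (rule order_trans[OF low]) (simp add: x sum_mono)
  then have A: "anis_norm a l x \<le> l / c" using assms by (simp add: field_simps)
  let ?d = "(\<Sum>i\<in>UNIV. \<gamma> (t i)) - (\<Sum>i\<in>UNIV. \<gamma> (s i))"
  have "x \<bullet> ?d = (\<Sum>i\<in>UNIV. x \<bullet> ((t i - s i) *\<^sub>R v i))"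
    by (simp add: sum_subtractf[symmetric] v_eq inner_sum_right)
  also have "\<dots> = (\<Sum>i\<in>UNIV. if i = j then t i - s i else 0)"
    by (intro sum.cong) (auto simp: x)
  finally have "t j - s j = x \<bullet> ?d" by simp
  also have "\<dots> = (\<Sum>k\<in>UNIV. anis a l x k * coord a l ?d k)"
    by (rule inner_eq_anis_coord[OF assms(1,2)])
  finally have "\<bar>t j - s j\<bar> \<le> (\<Sum>k\<in>UNIV. \<bar>anis a l x k * coord a l ?d k\<bar>)"
    by (simp add: sum_abs)
  also have "\<dots> \<le> (\<Sum>k\<in>UNIV. \<bar>anis a l x k\<bar> * \<rho>)"
    unfolding abs_mult by (intro sum_mono mult_left_mono \<rho>) auto
  also have "\<dots> \<le> l / c * \<rho>"
    unfolding sum_distrib_right[symmetric] using \<rho>[of j] by (intro mult_right_mono A) linarith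
  finally show ?thesis .
qed

end

section \<open>The measure of the dual boxes\<close>

text \<open>Truncated subtraction discards the i <= J; what remains is the triangular number in the
  definition of \<open>beta\<close>.\<close>

lemma sum_truncated_diff:
  assumes "J < d"
  shows "real (\<Sum>i<d. i - J) = (real d - real J - 1) * (real d - real J) / 2"
proof -
  obtain n where d: "d = Suc J + n" using assms by (metis less_iff_Suc_add add_Suc_shift add_Suc)
  have "real (\<Sum>i<Suc J + n. i - J) = real n * (real n + 1) / 2"
  proof (induction n)
    case (Suc n)
    have "(\<Sum>i<Suc J + Suc n. i - J) = (\<Sum>i<Suc J + n. i - J) + (Suc J + n - J)" by simp
    then show ?case using Suc by (simp add: field_simps)
  qed simp
  then show ?thesis by (simp add: d)
qed

lemma card_int_ball_le:
  assumes "B \<ge> 1"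
  shows "real (card {- \<lceil>B\<rceil>..\<lceil>B\<rceil>}) \<le> 5 * B"
proof -
  have "\<lceil>B\<rceil> \<ge> 1" using assms by linarith
  then have "real (card {- \<lceil>B\<rceil>..\<lceil>B\<rceil>}) = 2 * real_of_int \<lceil>B\<rceil> + 1" by simp
  then show ?thesis using assms by linarith
qed

lemma ex_dim_index:
  assumes "0 < \<alpha>" "\<alpha> \<le> real d"
  obtains J :: nat where "J < d" "real d - real J - 1 < \<alpha>" "\<alpha> \<le> real d - real J"
proof (rule that[of "nat \<lfloor>real d - \<alpha>\<rfloor>"])
  have "real (nat \<lfloor>real d - \<alpha>\<rfloor>) = of_int \<lfloor>real d - \<alpha>\<rfloor>" using assms by simp
  then show "real d - real (nat \<lfloor>real d - \<alpha>\<rfloor>) - 1 < \<alpha>" "\<alpha> \<le> real d - real (nat \<lfloor>real d - \<alpha>\<rfloor>)" "nat \<lfloor>real d - \<alpha>\<rfloor> < d"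
    using assms by linarith+
qed

lemma beta_pos:
  assumes "0 < \<alpha>" "\<alpha> \<le> real d"
  shows "beta d \<alpha> > 0"
proof -
  obtain J where J: "J < d" "real d - real J - 1 < \<alpha>" "\<alpha> \<le> real d - real J"
    using ex_dim_index[OF assms] .
  then have "(real d - real J - 1) * (real d - real J) \<ge> 0" by (intro mult_nonneg_nonneg) auto
  then show ?thesis unfolding beta_eq[OF J] using assms by (intro add_pos_nonneg) auto
qed

locale curve_and_measure = nondegenerate_curve \<gamma> for \<gamma> :: "real \<Rightarrow> real ^ 'n::finite" +
  fixes \<mu> :: "(real ^ 'n) measure" and \<alpha> \<beta> M :: real
  assumes \<alpha>: "0 < \<alpha>" "\<alpha> \<le> real CARD('n)" and mu: "sets \<mu> = sets borel"
    and ball: "\<And>x \<rho>. \<rho> > 0 \<Longrightarrow> emeasure \<mu> (ball x \<rho>) \<le> ennreal (M * \<rho> powr \<alpha>)"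
    and beta: "\<beta> = beta CARD('n) \<alpha>"
begin

text \<open>The anisotropic box is covered by balls of radius comparable to \<open>\<rho> l\<^sup>-\<^sup>k\<close>, where \<open>k\<close> is the
  index for which this cover has the smallest total mass; this is where \<open>\<beta>(\<alpha>)\<close> comes from.\<close>

lemma box_measure:
  obtains C where "C > 0"
    "\<And>a l \<rho> x. a \<in> {0..1} \<Longrightarrow> 0 < l \<Longrightarrow> l \<le> 1 \<Longrightarrow> \<rho> > 0 \<Longrightarrow>
      emeasure \<mu> {y. \<forall>j. \<bar>anis a l (x - y) j\<bar> < \<rho>} \<le> ennreal (C * l powr (- \<beta>) * \<rho> powr \<alpha>)"
proof -
  obtain C where C: "C > 0"
    "\<And>a x. a \<in> {0..1} \<Longrightarrow> norm x \<le> C * (\<Sum>j\<in>UNIV. \<bar>x \<bullet> gd (Suc (idx j)) a\<bar>)"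
    using frame_bound by blast
  obtain J where J: "J < CARD('n)" "real CARD('n) - real J - 1 < \<alpha>" "\<alpha> \<le> real CARD('n) - real J"
    using ex_dim_index[OF \<alpha>] .
  \<comment> \<open>\<open>M\<close> may be 0 or negative; the substitute is positive.\<close>
  define M' where "M' = \<bar>M\<bar> + 1"
  define K where "K = C * CARD('n) + 1"
  have K: "K > 0" using C by (simp add: K_def add_nonneg_pos)
  have ball': "emeasure \<mu> (ball x r) \<le> ennreal (M' * r powr \<alpha>)" if "r > 0" for x r
    by (rule order_trans[OF ball[OF that]]) (auto intro!: ennreal_leI mult_right_mono simp: M'_def)
  show ?thesis
  proof (rule that[of "5 ^ CARD('n) * M' * K powr \<alpha>"])
    fix a l \<rho> :: real and x :: "real ^ 'n"
    assume *: "a \<in> {0..1}" "0 < l" "l \<le> 1" "\<rho> > 0"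
    \<comment> \<open>The dual box has half-sides \<rho>/l^k for k = 1, ..., d. With balls of radius
      about \<rho>/l^(J+1), the directions k <= J+1 need boundedly many balls each, and every other
      direction about l^(-(k-J-1)) of them. The number of balls contributes l^(-(d-J-1)(d-J)/2) and
      the mass of a single ball l^(-(J+1) \<alpha>); together this is l^(-\<beta>).\<close>
    define R where "R = \<rho> / l ^ Suc J"
    have R: "R > 0" using * by (simp add: R_def)
    define m where "m j = Suc (idx j) - Suc J" for j :: 'n
    define B where "B j = (1 / l) ^ m j" for j :: 'n
    have B: "B j \<ge> 1" for j unfolding B_def using * by (intro one_le_power) auto
    define w where "w y j = (x - y) \<bullet> gd (Suc (idx j)) a / R" for y and j :: 'n
    define S where "S = PiE (UNIV :: 'n set) (\<lambda>j. {- \<lceil>B j\<rceil>..\<lceil>B j\<rceil>})"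
    define cell where "cell n = {y. \<forall>j. \<lfloor>w y j\<rfloor> = n j}" for n
    \<comment> \<open>The balls are centred at points of their own cells. An empty cell gets an
      arbitrary centre, which merely adds a ball to the cover.\<close>
    define center where "center n = (SOME y. y \<in> cell n)" for n
    have "finite S" unfolding S_def by (intro finite_PiE) auto
    have cover: "{y. \<forall>j. \<bar>anis a l (x - y) j\<bar> < \<rho>} \<subseteq> (\<Union>n\<in>S. ball (center n) (K * R))"
    proof
      fix y assume "y \<in> {y. \<forall>j. \<bar>anis a l (x - y) j\<bar> < \<rho>}"
      then have y: "\<bar>anis a l (x - y) j\<bar> < \<rho>" for j by auto
      have wB: "\<bar>w y j\<bar> < B j" for j
      proof -
        have "l ^ Suc (idx j) * \<bar>(x - y) \<bullet> gd (Suc (idx j)) a\<bar> < \<rho>"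
          using y[of j] * by (simp only: anis_def abs_mult abs_of_pos zero_less_power)
        then have "\<bar>(x - y) \<bullet> gd (Suc (idx j)) a\<bar> < \<rho> / l ^ Suc (idx j)"
          using * by (simp only: pos_less_divide_eq zero_less_power mult.commute)
        then have "\<bar>w y j\<bar> < \<rho> / l ^ Suc (idx j) / R"
          using divide_strict_right_mono[OF _ R] R unfolding w_def abs_divide by (metis abs_of_pos)
        also have "\<dots> = l ^ Suc J / l ^ Suc (idx j)" using * by (simp add: R_def)
        also have "\<dots> \<le> B j"
        proof (cases "J \<le> idx j")
          case True
          then have "l ^ Suc (idx j) = l ^ Suc J * l ^ m j" by (simp add: m_def power_add[symmetric] del: power_Suc)
          then show ?thesis using * by (simp add: B_def power_divide)
        next
          case False
          then have "l ^ Suc J \<le> l ^ Suc (idx j)" using * by (intro power_decreasing) auto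
          then have "l ^ Suc J / l ^ Suc (idx j) \<le> 1" using * by (simp only: divide_le_eq_1 zero_less_power) simp
          then show ?thesis using B[of j] by linarith
        qed
        finally show ?thesis .
      qed
      define n where "n j = \<lfloor>w y j\<rfloor>" for j
      have nS: "n \<in> S"
      proof -
        have "n j \<in> {- \<lceil>B j\<rceil>..\<lceil>B j\<rceil>}" for j
          using wB[of j] unfolding n_def atLeastAtMost_iff by linarith
        then show ?thesis by (auto simp: S_def PiE_def)
      qed
      have "y \<in> cell n" by (simp add: cell_def n_def)
      then have cn: "center n \<in> cell n" unfolding center_def by (rule someI)
      have "dist (center n) y \<le> C * (\<Sum>j\<in>UNIV. \<bar>(center n - y) \<bullet> gd (Suc (idx j)) a\<bar>)"
        unfolding dist_norm by (rule C(2)[OF *(1)])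
      also have "\<dots> \<le> C * (\<Sum>j\<in>(UNIV :: 'n set). R)"
      proof (intro mult_left_mono sum_mono)
        fix j
        have "\<lfloor>w (center n) j\<rfloor> = \<lfloor>w y j\<rfloor>" using cn by (simp add: cell_def n_def)
        then have "\<bar>w y j - w (center n) j\<bar> \<le> 1" by linarith
        moreover have "w y j - w (center n) j = (center n - y) \<bullet> gd (Suc (idx j)) a / R"
          by (simp add: w_def inner_diff_left diff_divide_distrib)
        ultimately show "\<bar>(center n - y) \<bullet> gd (Suc (idx j)) a\<bar> \<le> R"
          using R by (simp add: abs_divide)
      qed (use C in auto)
      also have "\<dots> < K * R" using R by (simp add: K_def algebra_simps)
      finally show "y \<in> (\<Union>n\<in>S. ball (center n) (K * R))" using nS by auto
    qed
    have "emeasure \<mu> {y. \<forall>j. \<bar>anis a l (x - y) j\<bar> < \<rho>} \<le> emeasure \<mu> (\<Union>n\<in>S. ball (center n) (K * R))"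
      using cover \<open>finite S\<close> by (intro emeasure_mono) (auto simp: mu)
    also have "\<dots> \<le> (\<Sum>n\<in>S. emeasure \<mu> (ball (center n) (K * R)))"
      using \<open>finite S\<close> by (intro emeasure_subadditive_finite) (auto simp: mu)
    also have "\<dots> \<le> (\<Sum>n\<in>S. ennreal (M' * (K * R) powr \<alpha>))"
      using K R by (intro sum_mono ball') auto
    also have "\<dots> = ennreal (real (card S) * (M' * (K * R) powr \<alpha>))"
      by (simp add: ennreal_of_nat_eq_real_of_nat ennreal_mult[symmetric] M'_def)
    also have "\<dots> \<le> ennreal (5 ^ CARD('n) * M' * K powr \<alpha> * l powr (- \<beta>) * \<rho> powr \<alpha>)"
    proof (rule ennreal_leI)
      let ?s = "(real CARD('n) - real J - 1) * (real CARD('n) - real J) / 2"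
      have "real (card S) = (\<Prod>j\<in>(UNIV :: 'n set). real (card {- \<lceil>B j\<rceil>..\<lceil>B j\<rceil>}))"
        by (simp add: S_def card_PiE)
      also have "\<dots> \<le> (\<Prod>j\<in>(UNIV :: 'n set). 5 * B j)"
        by (intro prod_mono conjI card_int_ball_le B) auto
      also have "\<dots> = 5 ^ CARD('n) * (1 / l) ^ (\<Sum>j\<in>(UNIV :: 'n set). m j)"
        by (simp add: B_def prod.distrib power_sum)
      also have "(\<Sum>j\<in>(UNIV :: 'n set). m j) = (\<Sum>i<CARD('n). i - J)"
        unfolding m_def by (subst sum_idx[symmetric]) simp
      also have "(1 / l) ^ (\<Sum>i<CARD('n). i - J) = l powr (- real (\<Sum>i<CARD('n). i - J))"
        using * by (simp add: powr_minus powr_realpow power_divide inverse_eq_divide del: of_nat_sum)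
      finally have 1: "real (card S) \<le> 5 ^ CARD('n) * l powr (- ?s)"
        unfolding sum_truncated_diff[OF J(1)] .
      have 2: "(K * R) powr \<alpha> = K powr \<alpha> * (\<rho> powr \<alpha> * l powr (- ((real J + 1) * \<alpha>)))"
      proof -
        have "R = \<rho> * l powr (- (real J + 1))"
          using powr_realpow[OF *(2), of "Suc J"]
          unfolding R_def powr_minus divide_inverse by (simp only: of_nat_Suc add.commute)
        then have "(K * R) powr \<alpha> = K powr \<alpha> * (\<rho> powr \<alpha> * (l powr (- (real J + 1))) powr \<alpha>)"
          using K * by (simp add: powr_mult)
        then show ?thesis by (simp only: powr_powr mult_minus_left)
      qed
      have "real (card S) * (M' * (K * R) powr \<alpha>)
        \<le> (5 ^ CARD('n) * l powr (- ?s)) * (M' * (K * R) powr \<alpha>)"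
        by (intro mult_right_mono 1) (auto simp: M'_def)
      also have "\<dots> = 5 ^ CARD('n) * M' * K powr \<alpha> *
          (l powr (- ?s) * l powr (- ((real J + 1) * \<alpha>))) * \<rho> powr \<alpha>"
        unfolding 2 by (simp only: mult_ac)
      also have "l powr (- ?s) * l powr (- ((real J + 1) * \<alpha>))
          = l powr (- \<beta>)"
        unfolding beta beta_eq[OF J] by (simp only: powr_add[symmetric] minus_add_distrib add.commute)
      finally show "real (card S) * (M' * (K * R) powr \<alpha>)
          \<le> 5 ^ CARD('n) * M' * K powr \<alpha> * l powr (- \<beta>) * \<rho> powr \<alpha>" .
    qed
    finally show "emeasure \<mu> {y. \<forall>j. \<bar>anis a l (x - y) j\<bar> < \<rho>}
      \<le> ennreal (5 ^ CARD('n) * M' * K powr \<alpha> * l powr (- \<beta>) * \<rho> powr \<alpha>)" .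
  qed (use K in \<open>auto simp: M'_def intro!: mult_pos_pos\<close>)
qed

end

section \<open>The multilinear estimate\<close>

lemma summable_gaussian_powr: "summable (\<lambda>n. exp (- (real n)\<^sup>2 / 2) * (real n + 1) powr \<alpha>)"
proof (rule summable_comparison_test_ev)
  have "eventually (\<lambda>n. exp (- (real n)\<^sup>2 / 2) * (real n + 1) powr \<alpha> \<le> inverse ((real n) ^ 2)) sequentially"
    by real_asymp
  then show "eventually (\<lambda>n. norm (exp (- (real n)\<^sup>2 / 2) * (real n + 1) powr \<alpha>) \<le> inverse ((real n) ^ 2)) sequentially"
    by eventually_elim simp
  show "summable (\<lambda>n. inverse ((real n) ^ 2))"
    using inverse_power_summable[of 2, where 'a = real] by simp
qed

text \<open>Hoelder's inequality up to a factor 2, from the pointwise bound g <= \<tau> +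
  \<tau>^(1-s) g^s. The choice \<tau> = (N/l)^(1/s) makes the two integrated terms equal. The mass
  and the integral of the power enter only through upper bounds.\<close>

lemma integral_le_powr:
  fixes g :: "'a \<Rightarrow> real"
  assumes "finite_measure P" and g[measurable]: "g \<in> borel_measurable P" and g0: "\<And>x. g x \<ge> 0"
    and s: "s \<ge> 1" and gi: "integrable P (\<lambda>x. g x powr s)" and N: "(LINT x|P. g x powr s) \<le> N"
    and l: "measure P (space P) \<le> l" "l > 0"
  shows "integrable P g" "(LINT x|P. g x) \<le> 2 * l powr (1 - 1 / s) * N powr (1 / s)"
proof -
  interpret finite_measure P by fact
  have le: "g x \<le> \<tau> + \<tau> powr (1 - s) * g x powr s" if \<tau>: "\<tau> > 0" for x \<tau>
  proof (cases "g x \<le> \<tau>")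
    case True
    moreover have "0 \<le> \<tau> powr (1 - s) * g x powr s" by simp
    ultimately show ?thesis by linarith
  next
    case False
    then have "\<tau> powr (s - 1) \<le> g x powr (s - 1)" using s \<tau> by (intro powr_mono2) auto
    then have "\<tau> powr (1 - s) * \<tau> powr (s - 1) \<le> \<tau> powr (1 - s) * g x powr (s - 1)"
      by (intro mult_left_mono) auto
    then have "1 \<le> \<tau> powr (1 - s) * g x powr (s - 1)"
      using \<tau> by (simp add: powr_add[symmetric])
    then have "g x * 1 \<le> g x * (\<tau> powr (1 - s) * g x powr (s - 1))" by (intro mult_left_mono g0)
    also have "\<dots> = \<tau> powr (1 - s) * g x powr s"
      using False \<tau> powr_add[of "g x" 1 "s - 1"] by simp
    finally show ?thesis using \<tau> by simp
  qed
  show int: "integrable P g"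
    by (rule Bochner_Integration.integrable_bound[of _ "\<lambda>x. 1 + g x powr s"])
       (use gi g0 le[of 1] in \<open>auto intro!: AE_I2\<close>)
  have N0: "N \<ge> 0" by (rule order_trans[OF _ N]) simp
  have bd: "(LINT x|P. g x) \<le> \<tau> * l + \<tau> powr (1 - s) * N" if \<tau>: "\<tau> > 0" for \<tau>
  proof -
    have "(LINT x|P. g x) \<le> (LINT x|P. \<tau> + \<tau> powr (1 - s) * g x powr s)"
      using gi int le[OF \<tau>] by (intro integral_mono) auto
    also have "\<dots> = \<tau> * measure P (space P) + \<tau> powr (1 - s) * (LINT x|P. g x powr s)"
      using gi by simp
    also have "\<dots> \<le> \<tau> * l + \<tau> powr (1 - s) * N"
      using \<tau> l N by (intro add_mono mult_left_mono) auto
    finally show ?thesis .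
  qed
  show "(LINT x|P. g x) \<le> 2 * l powr (1 - 1 / s) * N powr (1 / s)"
  proof (cases "N = 0")
    case True
    then have "(LINT x|P. g x powr s) = 0" using N by (intro antisym) auto
    then have "AE x in P. g x powr s = 0" using gi by (subst (asm) integral_nonneg_eq_0_iff_AE) auto
    then have "AE x in P. g x = 0" by eventually_elim simp
    then have "(LINT x|P. g x) = 0" by (rule integral_eq_zero_AE)
    then show ?thesis by simp
  next
    case False
    then have Np: "N > 0" using N0 by simp
    define \<tau> where "\<tau> = (N / l) powr (1 / s)"
    have \<tau>: "\<tau> > 0" using Np l by (simp add: \<tau>_def)
    have 1: "\<tau> * l = l powr (1 - 1 / s) * N powr (1 / s)"
      using l Np by (simp add: \<tau>_def powr_divide powr_diff)
    have "\<tau> powr (1 - s) = \<tau> * \<tau> powr (- s)" using \<tau> powr_add[of \<tau> 1 "- s"] by simp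
    also have "\<tau> powr (- s) = l / N" using Np l s by (simp add: \<tau>_def powr_powr powr_minus)
    finally have "\<tau> powr (1 - s) * N = \<tau> * l" using Np by simp
    then show ?thesis using bd[OF \<tau>] unfolding 1 by (simp add: mult_ac)
  qed
qed

context curve_and_measure
begin

lemma anis_measurable: "(\<lambda>x. anis a l x j) \<in> borel_measurable borel"
  unfolding anis_def by (intro borel_measurable_continuous_onI continuous_intros)

text \<open>The row bound that Schur's test needs in \<open>oscillatory_L2_bound\<close>, for the
  coordinates \<open>anis\<close> dilated by lam. A ball of radius n+1 in these coordinates lies in
  an anisotropic box of half-width (n+1)/lam; this yields the power of lam and a convergent sum over
  n.\<close>

lemma kernel_bound:
  obtains C where "C > 0"
    "\<And>a l lam x. a \<in> {0..1} \<Longrightarrow> 0 < l \<Longrightarrow> l \<le> 1 \<Longrightarrow> lam > 0 \<Longrightarrow>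
      (\<integral>\<^sup>+y. ennreal (exp (- (\<Sum>i\<in>UNIV. (lam * anis a l x i - lam * anis a l y i)\<^sup>2) / 2)) \<partial>\<mu>)
        \<le> ennreal (C * l powr (- \<beta>) * lam powr (- \<alpha>))"
proof -
  obtain C where C: "C > 0"
    "\<And>a l \<rho> x. a \<in> {0..1} \<Longrightarrow> 0 < l \<Longrightarrow> l \<le> 1 \<Longrightarrow> \<rho> > 0 \<Longrightarrow>
      emeasure \<mu> {y. \<forall>j. \<bar>anis a l (x - y) j\<bar> < \<rho>} \<le> ennreal (C * l powr (- \<beta>) * \<rho> powr \<alpha>)"
    using box_measure by blast
  define s where "s n = exp (- (real n)\<^sup>2 / 2) * (real n + 1) powr \<alpha>" for n
  have s: "summable s" unfolding s_def by (rule summable_gaussian_powr)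
  have s0: "s n > 0" for n by (simp add: s_def)
  have S: "suminf s > 0" using s s0 by (rule suminf_pos)
  show ?thesis
  proof (rule that[of "C * suminf s"])
    fix a l lam :: real and x :: "real ^ 'n"
    assume *: "a \<in> {0..1}" "0 < l" "l \<le> 1" "lam > 0"
    define E where "E n = {y. \<forall>j. \<bar>anis a l (x - y) j\<bar> < (real n + 1) / lam}" for n
    have E: "E n \<in> sets \<mu>" for n
    proof -
      have "(\<lambda>y. anis a l (x - y) j) \<in> borel_measurable borel" for j
        unfolding anis_def by (intro borel_measurable_continuous_onI continuous_intros)
      then have "{y \<in> space borel. \<forall>j. \<bar>anis a l (x - y) j\<bar> < (real n + 1) / lam} \<in> sets borel"
        by measurable
      then show ?thesis by (simp add: E_def mu)
    qed
    let ?I = "\<integral>\<^sup>+y. ennreal (exp (- (\<Sum>i\<in>UNIV. (lam * anis a l x i - lam * anis a l y i)\<^sup>2) / 2)) \<partial>\<mu>"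
    let ?e = "\<lambda>n y. ennreal (exp (- (real n)\<^sup>2 / 2)) * indicator (E n) y"
    let ?b = "C * l powr (- \<beta>) * lam powr (- \<alpha>)"
    have "?I
       \<le> (\<integral>\<^sup>+y. (\<Sum>n. ?e n y) \<partial>\<mu>)"
    proof (rule nn_integral_mono)
      fix y
      define T where "T = (\<Sum>i\<in>UNIV. (lam * anis a l x i - lam * anis a l y i)\<^sup>2)"
      \<comment> \<open>The unit shell that contains y. The single term of the series with this
        index already dominates the Gaussian at y.\<close>
      define n where "n = nat \<lfloor>sqrt T\<rfloor>"
      have T0: "T \<ge> 0" unfolding T_def by (intro sum_nonneg) auto
      have n: "real n \<le> sqrt T" "sqrt T < real n + 1" using T0 by (simp_all add: n_def)
      have "y \<in> E n" unfolding E_def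
      proof (intro CollectI allI)
        fix j
        have "(lam * anis a l (x - y) j)\<^sup>2 \<le> T"
          unfolding T_def anis_diff right_diff_distrib by (rule member_le_sum) auto
        then have "\<bar>lam * anis a l (x - y) j\<bar> \<le> sqrt T" by (intro real_le_rsqrt) simp
        then have "lam * \<bar>anis a l (x - y) j\<bar> < real n + 1" using n * by (simp add: abs_mult)
        then show "\<bar>anis a l (x - y) j\<bar> < (real n + 1) / lam" using * by (simp add: field_simps)
      qed
      have "(real n)\<^sup>2 \<le> T" using n(1) T0 by (simp add: real_le_rsqrt sqrt_ge_absD)
      then have "ennreal (exp (- T / 2)) \<le> ?e n y"
        using \<open>y \<in> E n\<close> by (simp add: ennreal_leI)
      also have "\<dots> \<le> (\<Sum>n. ?e n y)"
      proof -
        have "f n \<le> suminf f" for f :: "nat \<Rightarrow> ennreal"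
          using sum_le_suminf[OF summableI, of "{n}" f] by simp
        then show ?thesis .
      qed
      finally show "ennreal (exp (- (\<Sum>i\<in>UNIV. (lam * anis a l x i - lam * anis a l y i)\<^sup>2) / 2))
        \<le> (\<Sum>n. ?e n y)" unfolding T_def .
    qed
    also have "\<dots> = (\<Sum>n. \<integral>\<^sup>+y. ?e n y \<partial>\<mu>)"
      using E by (intro nn_integral_suminf) auto
    also have "\<dots> \<le> (\<Sum>n. ennreal (?b * s n))"
    proof (intro suminf_le summableI)
      fix n
      have "(\<integral>\<^sup>+y. ?e n y \<partial>\<mu>) = ennreal (exp (- (real n)\<^sup>2 / 2)) * emeasure \<mu> (E n)"
        by (rule nn_integral_cmult_indicator[OF E])
      also have "\<dots> \<le> ennreal (exp (- (real n)\<^sup>2 / 2)) * ennreal (C * l powr (- \<beta>) * ((real n + 1) / lam) powr \<alpha>)"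
        unfolding E_def using * by (intro mult_left_mono C(2)) auto
      also have "\<dots> = ennreal (?b * s n)"
      proof -
        have "((real n + 1) / lam) powr \<alpha> = (real n + 1) powr \<alpha> * lam powr (- \<alpha>)"
          using * by (simp add: powr_divide powr_minus_divide)
        then have "exp (- (real n)\<^sup>2 / 2) * (C * l powr (- \<beta>) * ((real n + 1) / lam) powr \<alpha>)
            = ?b * s n"
          unfolding s_def by (simp only: mult_ac)
        then show ?thesis by (subst ennreal_mult'[symmetric]) (simp_all only: exp_ge_zero)
      qed
      finally show "(\<integral>\<^sup>+y. ?e n y \<partial>\<mu>)
         \<le> ennreal (?b * s n)" .
    qed
    also have "\<dots> = ennreal (\<Sum>n. ?b * s n)"
    proof (intro suminf_ennreal2 summable_mult s)
      show "0 \<le> ?b * s n" for n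
        using C(1) less_imp_le[OF s0[of n]] by (intro mult_nonneg_nonneg) simp_all
    qed
    also have "(\<Sum>n. ?b * s n) = C * suminf s * l powr (- \<beta>) * lam powr (- \<alpha>)"
      using s by (subst suminf_mult) (auto simp: mult_ac)
    finally show "?I
        \<le> ennreal (C * suminf s * l powr (- \<beta>) * lam powr (- \<alpha>))" .
  qed (use C S in simp)
qed

end

section \<open>Oscillatory integrals over products of arcs\<close>

lemma finite_measure_PiM:
  assumes "\<And>i::'i::finite. finite_measure (M i)"
  shows "finite_measure (PiM UNIV M)"
proof
  interpret product_sigma_finite M
    by (rule product_sigma_finite.intro) (rule finite_measure.axioms(1)[OF assms])
  have "emeasure (PiM UNIV M) (space (PiM UNIV M)) = (\<Prod>i\<in>UNIV. emeasure (M i) (space (M i)))"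
    unfolding space_PiM by (rule emeasure_PiM) auto
  also have "\<dots> \<noteq> \<infinity>"
    using finite_measure.emeasure_finite[OF assms] by (simp add: ennreal_prod_eq_top)
  finally show "emeasure (PiM UNIV M) (space (PiM UNIV M)) \<noteq> \<infinity>" .
qed

lemma finite_measure_restrict_ball:
  fixes \<mu> :: "'a::metric_space measure"
  assumes mu: "sets \<mu> = sets borel"
    and ball: "\<And>x \<rho>. \<rho> > 0 \<Longrightarrow> emeasure \<mu> (ball x \<rho>) \<le> ennreal (B \<rho>)"
  shows "finite_measure (restrict_space \<mu> (ball x R))"
proof
  have sp: "space \<mu> = UNIV" using sets_eq_imp_space_eq[OF mu] by simp
  have "emeasure \<mu> (ball x R) < \<infinity>"
  proof (cases "R > 0")
    case True
    show ?thesis by (rule order_le_less_trans[OF ball[OF True]]) simp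
  qed (simp add: ball_empty)
  then show "emeasure (restrict_space \<mu> (ball x R)) (space (restrict_space \<mu> (ball x R))) \<noteq> \<infinity>"
    by (simp add: space_restrict_space sp emeasure_restrict_space mu)
qed

context nondegenerate_curve
begin

abbreviation box :: "('n \<Rightarrow> real set) \<Rightarrow> ('n \<Rightarrow> real) measure" where
  "box I \<equiv> PiM UNIV (\<lambda>i. lebesgue_on (I i))"

abbreviation osc_box :: "('n \<Rightarrow> real set) \<Rightarrow> real \<Rightarrow> (('n \<Rightarrow> real) \<Rightarrow> complex) \<Rightarrow> real ^ 'n \<Rightarrow> complex" where
  "osc_box I lam F x \<equiv> LINT t|box I. F t * iexp (lam * (x \<bullet> (\<Sum>i\<in>UNIV. \<gamma> (t i))))"

abbreviation osc_on :: "real set \<Rightarrow> real \<Rightarrow> (real \<Rightarrow> complex) \<Rightarrow> real ^ 'n \<Rightarrow> complex" where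
  "osc_on S lam f x \<equiv> LINT t|lebesgue_on S. f t * iexp (lam * (x \<bullet> \<gamma> t))"

text \<open>The separation is imposed on closed intervals around the sets \<open>I i\<close>,
  because a mean value point between two points of \<open>I i\<close> may lie outside this
  set.\<close>

definition admissible :: "real \<Rightarrow> real \<Rightarrow> real \<Rightarrow> ('n \<Rightarrow> real set) \<Rightarrow> bool" where
  "admissible h a l I \<longleftrightarrow> 0 \<le> a \<and> 0 < l \<and> a + l \<le> 1 \<and> (\<forall>i. I i \<in> sets lebesgue) \<and>
    (\<exists>lo hi. (\<forall>i. I i \<subseteq> {lo i..hi i} \<and> {lo i..hi i} \<subseteq> {a..a + l}) \<and>
      (\<forall>i j. i \<noteq> j \<longrightarrow> (\<forall>u\<in>{lo i..hi i}. \<forall>v\<in>{lo j..hi j}. \<bar>u - v\<bar> \<ge> h * l)))"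

lemma admissible_subset:
  assumes "admissible h a l I"
  shows "I i \<subseteq> {a..a + l} \<and> I i \<subseteq> {0..1}"
proof -
  have "I i \<subseteq> {a..a + l}"
    using assms unfolding admissible_def by (elim conjE exE) (rule subset_trans, blast+)
  moreover have "{a..a + l} \<subseteq> {0..1}" using assms unfolding admissible_def by simp
  ultimately show ?thesis by (meson subset_trans)
qed

lemma finite_measure_lebesgue_on_subset:
  fixes S :: "real set"
  assumes "S \<in> sets lebesgue" "S \<subseteq> {a..b}"
  shows "finite_measure (lebesgue_on S)"
proof -
  have "S \<in> lmeasurable"
    by (rule bounded_set_imp_lmeasurable[OF bounded_subset[OF bounded_closed_interval assms(2)] assms(1)])
  then show ?thesis by (rule finite_measure_lebesgue_on)
qed

lemma admissible_finite:
  assumes "admissible h a l I"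
  shows "finite_measure (lebesgue_on (I i))" "finite_measure (box I)"
    "product_sigma_finite (\<lambda>i. lebesgue_on (I i))"
proof -
  have *: "finite_measure (lebesgue_on (I i))" for i
    using assms admissible_subset[OF assms, of i]
    by (intro finite_measure_lebesgue_on_subset[of _ a "a + l"]) (auto simp: admissible_def)
  show "finite_measure (lebesgue_on (I i))" by (rule *)
  show "finite_measure (box I)" by (rule finite_measure_PiM[OF *])
  show "product_sigma_finite (\<lambda>i. lebesgue_on (I i))"
    by (rule product_sigma_finite.intro, rule finite_measure.axioms(1)[OF *])
qed

lemma gamma_measurable:
  assumes "S \<in> sets lebesgue" "S \<subseteq> {0..1}"
  shows "\<gamma> \<in> borel_measurable (lebesgue_on S)"
  using continuous_on_subset[OF gd_continuous[of 0] assms(2)] assms(1)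
  by (intro continuous_imp_measurable_on_sets_lebesgue) auto

lemma sum_gamma_measurable:
  assumes "admissible h a l I"
  shows "(\<lambda>t. \<Sum>i\<in>UNIV. \<gamma> (t i)) \<in> borel_measurable (box I)"
proof (intro borel_measurable_sum)
  fix i
  have "\<gamma> \<in> borel_measurable (lebesgue_on (I i))"
    using assms admissible_subset[OF assms, of i] by (intro gamma_measurable) (auto simp: admissible_def)
  then show "(\<lambda>t. \<gamma> (t i)) \<in> borel_measurable (box I)"
    by (rule measurable_compose[OF measurable_component_singleton[of i UNIV "\<lambda>i. lebesgue_on (I i)"], rotated]) simp
qed

end

context curve_and_measure
begin

text \<open>Truncation to a ball makes \<mu> finite. The constants in the estimates below are chosen
  before R, which lets R tend to infinity in \<open>global_estimate\<close>.\<close>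

abbreviation mu_ball :: "real \<Rightarrow> (real ^ 'n) measure" where
  "mu_ball R \<equiv> restrict_space \<mu> (ball 0 R)"

text \<open>In the coordinates \<open>coord\<close> the sum of d separated arcs sends the product
  measure to a bounded set with density of order l^d (\<open>displacement_upper\<close>,
  \<open>sum_curve_lower\<close>). The remaining power of l and that of lam come from
  \<open>kernel_bound\<close>.\<close>

lemma multilinear_L2:
  assumes h: "h > 0"
  obtains C l0 where "C > 0" "l0 > 0" "l0 \<le> 1"
    "\<And>a l I lam R F. admissible h a l I \<Longrightarrow> l \<le> l0 \<Longrightarrow> lam > 0 \<Longrightarrow>
      F \<in> borel_measurable (box I) \<Longrightarrow> integrable (box I) (\<lambda>t. (norm (F t))\<^sup>2) \<Longrightarrow>
      (\<integral>\<^sup>+x. ennreal ((norm (osc_box I lam F x))\<^sup>2) \<partial>mu_ball R)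
        \<le> ennreal (C * l powr (CARD('n) - \<beta>) * lam powr (- \<alpha>) * (LINT t|box I. (norm (F t))\<^sup>2))"
proof -
  obtain c l0 where c: "c > 0" "l0 > 0" "l0 \<le> 1"
    "\<And>a l u x. 0 \<le> a \<Longrightarrow> 0 < l \<Longrightarrow> l \<le> l0 \<Longrightarrow> a + l \<le> 1 \<Longrightarrow> \<forall>i. u i \<in> {a..a + l} \<Longrightarrow>
      \<forall>i j. i \<noteq> j \<longrightarrow> \<bar>u i - u j\<bar> \<ge> h * l \<Longrightarrow>
      c / l * anis_norm a l x \<le> (\<Sum>i\<in>(UNIV :: 'n set). \<bar>x \<bullet> gd 1 (u i)\<bar>)"
    by (rule velocity_lower[OF h]) (rule that)
  obtain D where D: "D > 0"
    "\<And>a l u x. 0 \<le> a \<Longrightarrow> 0 < l \<Longrightarrow> a + l \<le> 1 \<Longrightarrow> u \<in> {a..a + l} \<Longrightarrow>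
      \<bar>x \<bullet> (\<gamma> u - \<gamma> a)\<bar> \<le> D * anis_norm a l x"
    using displacement_upper by blast
  obtain B where B: "B > 0"
    "\<And>a l lam x. a \<in> {0..1} \<Longrightarrow> 0 < l \<Longrightarrow> l \<le> 1 \<Longrightarrow> lam > 0 \<Longrightarrow>
      (\<integral>\<^sup>+y. ennreal (exp (- (\<Sum>i\<in>UNIV. (lam * anis a l x i - lam * anis a l y i)\<^sup>2) / 2)) \<partial>\<mu>)
        \<le> ennreal (B * l powr (- \<beta>) * lam powr (- \<alpha>))"
    using kernel_bound by blast
  let ?E = "CARD('n) * D"
  define G where "G = (4 / c) ^ CARD('n) / (2 * std_normal_density (?E + 1)) ^ CARD('n) * B"
  have sd: "2 * std_normal_density (?E + 1) > 0" by (simp add: std_normal_density_def)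
  have G: "G > 0" unfolding G_def
    by (rule mult_pos_pos[OF divide_pos_pos[OF zero_less_power zero_less_power[OF sd]] B(1)]) (use c(1) in simp)
  show ?thesis
  proof (rule that[OF G c(2,3)])
    fix a l lam R :: real and I :: "'n \<Rightarrow> real set" and F :: "('n \<Rightarrow> real) \<Rightarrow> complex"
    assume adm: "admissible h a l I" and l: "l \<le> l0" and lam: "lam > 0"
      and F: "F \<in> borel_measurable (box I)" and F2: "integrable (box I) (\<lambda>t. (norm (F t))\<^sup>2)"
    have al: "0 \<le> a" "0 < l" "a + l \<le> 1" "\<And>i. I i \<in> sets lebesgue"
      using adm unfolding admissible_def by simp_all
    obtain lo hi where lohi0: "(\<forall>i. I i \<subseteq> {lo i..hi i} \<and> {lo i..hi i} \<subseteq> {a..a + l}) \<and>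
      (\<forall>i j. i \<noteq> j \<longrightarrow> (\<forall>u\<in>{lo i..hi i}. \<forall>v\<in>{lo j..hi j}. \<bar>u - v\<bar> \<ge> h * l))"
      using adm unfolding admissible_def by (elim conjE exE) (rule that, intro conjI)
    have lohi: "I i \<subseteq> {lo i..hi i}" "{lo i..hi i} \<subseteq> {a..a + l}"
      "i \<noteq> j \<Longrightarrow> u \<in> {lo i..hi i} \<Longrightarrow> v \<in> {lo j..hi j} \<Longrightarrow> \<bar>u - v\<bar> \<ge> h * l" for i j u v
      using conjunct1[OF lohi0, rule_format] conjunct2[OF lohi0, rule_format] by simp_all
    have a01: "a \<in> {0..1}" and l1: "l \<le> 1" using al by auto
    define \<Phi> where "\<Phi> t = (\<Sum>i\<in>UNIV. \<gamma> (t i))" for t :: "'n \<Rightarrow> real"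
    \<comment> \<open>Subtracting d times \<gamma>(a) changes the phase by a term independent of t,
      which the norm does not see, and moves the sum into the box about the origin.\<close>
    define \<Psi> where "\<Psi> t = coord a l (\<Phi> t - real CARD('n) *\<^sub>R \<gamma> a)" for t
    define Y where "Y x i = lam * anis a l x i" for x and i :: 'n
    let ?\<mu> = "mu_ball R"
    have sp: "space \<mu> = UNIV" using sets_eq_imp_space_eq[OF mu] by simp
    have mu_fin: "finite_measure ?\<mu>"
      by (rule finite_measure_restrict_ball[OF mu ball])
    interpret mu: finite_measure ?\<mu> by (rule mu_fin)
    note P_fin = admissible_finite[OF adm]
    interpret P: product_sigma_finite "\<lambda>i. lebesgue_on (I i)" by (rule P_fin(3))
    have space: "t i \<in> I i" if "t \<in> space (box I)" for t i
      using that by (auto simp: space_PiM PiE_def Pi_def)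
    have phase: "lam * (x \<bullet> \<Phi> t) = lam * real CARD('n) * (x \<bullet> \<gamma> a) + (\<Sum>i\<in>UNIV. Y x i * \<Psi> t i)" for x t
    proof -
      have "x \<bullet> (\<Phi> t - real CARD('n) *\<^sub>R \<gamma> a) = (\<Sum>i\<in>UNIV. anis a l x i * \<Psi> t i)"
        unfolding \<Psi>_def by (rule inner_eq_anis_coord[OF a01 al(2)])
      then have "x \<bullet> \<Phi> t = real CARD('n) * (x \<bullet> \<gamma> a) + (\<Sum>i\<in>UNIV. anis a l x i * \<Psi> t i)"
        by (simp add: inner_diff_right)
      then show ?thesis by (simp add: Y_def distrib_left sum_distrib_left mult.assoc)
    qed
    have norm_eq: "norm (LINT t|box I. F t * iexp (lam * (x \<bullet> \<Phi> t))) = norm (LINT t|box I. F t * iexp (\<Sum>i\<in>UNIV. Y x i * \<Psi> t i))" for x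
    proof -
      have "F t * iexp (lam * (x \<bullet> \<Phi> t)) = iexp (lam * real CARD('n) * (x \<bullet> \<gamma> a)) * (F t * iexp (\<Sum>i\<in>UNIV. Y x i * \<Psi> t i))" for t
        unfolding phase by (simp add: exp_add distrib_left mult_ac)
      then have "norm (LINT t|box I. F t * iexp (lam * (x \<bullet> \<Phi> t)))
        = norm (iexp (lam * real CARD('n) * (x \<bullet> \<gamma> a)) * (LINT t|box I. F t * iexp (\<Sum>i\<in>UNIV. Y x i * \<Psi> t i)))"
        by (simp only: integral_mult_right_zero)
      then show ?thesis by (simp only: norm_mult norm_exp_i_times mult_1)
    qed
    have Ym: "(\<lambda>x. Y x i) \<in> borel_measurable ?\<mu>" for i
    proof -
      have "(\<lambda>x. Y x i) \<in> borel_measurable \<mu>"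
        unfolding Y_def measurable_cong_sets[OF mu refl]
        by (intro borel_measurable_times borel_measurable_const anis_measurable)
      then show ?thesis by (rule measurable_restrict_space1)
    qed
    have \<Psi>m: "(\<lambda>t. \<Psi> t i) \<in> borel_measurable (box I)" for i
      unfolding \<Psi>_def \<Phi>_def
      by (rule measurable_compose[OF _ coord_measurable]) (intro borel_measurable_diff borel_measurable_const sum_gamma_measurable[OF adm])
    \<comment> \<open>A crude bound, finite for each R; it serves only the boundedness that
      \<open>oscillatory_L2_bound\<close> asks of \<open>Y\<close>.\<close>
    let ?y = "\<lambda>i. lam * (l ^ Suc (idx i) * (\<bar>R\<bar> * norm (gd (Suc (idx i)) a)))"
    have Ybd: "\<bar>Y x i\<bar> \<le> sum ?y UNIV"
      if x: "x \<in> space ?\<mu>" for x i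
    proof -
      have "norm x < R" using x by (simp add: space_restrict_space)
      then have "norm x \<le> \<bar>R\<bar>" by linarith
      then have "\<bar>x \<bullet> gd (Suc (idx i)) a\<bar> \<le> \<bar>R\<bar> * norm (gd (Suc (idx i)) a)"
        by (intro order_trans[OF Cauchy_Schwarz_ineq2] mult_right_mono) auto
      then have "\<bar>Y x i\<bar> \<le> ?y i"
        using lam al(2) unfolding Y_def anis_def abs_mult by (intro mult_mono) auto
      also have "\<dots> \<le> sum ?y UNIV"
        by (rule member_le_sum[of i UNIV]) (use lam al(2) in auto)
      finally show ?thesis .
    qed
    have \<Psi>bd: "\<bar>\<Psi> t i\<bar> \<le> ?E" if t: "t \<in> space (box I)" for t i
      unfolding \<Psi>_def
    proof (rule coord_upper[OF a01 al(2)])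
      fix x
      have "x \<bullet> (\<Phi> t - real CARD('n) *\<^sub>R \<gamma> a) = (\<Sum>i\<in>UNIV. x \<bullet> (\<gamma> (t i) - \<gamma> a))"
        by (simp add: \<Phi>_def inner_diff_right inner_sum_right sum_subtractf)
      also have "\<bar>\<dots>\<bar> \<le> (\<Sum>i\<in>(UNIV :: 'n set). D * anis_norm a l x)"
        using space[OF t] lohi al by (intro order_trans[OF sum_abs] sum_mono D) blast+
      finally show "\<bar>x \<bullet> (\<Phi> t - real CARD('n) *\<^sub>R \<gamma> a)\<bar> \<le> ?E * anis_norm a l x"
        by (simp add: mult.assoc)
    qed
    have cube: "emeasure (box I) {t \<in> space (box I). \<forall>i. \<bar>\<Psi> t i - \<xi> i\<bar> < r} \<le> ennreal ((4 * l / c) ^ CARD('n) * r ^ CARD('n))"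
      (is "emeasure _ ?T \<le> _") if r: "0 < r" "r \<le> 1" for \<xi> r
    proof (cases "?T = {}")
      case True
      show ?thesis unfolding True by simp
    next
      case False
      \<comment> \<open>The preimage of a cube is compared with one of its own points: the
        coordinates of any other t differ from those of s by at most 2r, so t lies within 2rl/c of s
        in each variable.\<close>
      then obtain s where s: "s \<in> space (box I)" "\<And>i. \<bar>\<Psi> s i - \<xi> i\<bar> < r" by auto
      define A where "A j = I j \<inter> {s j - l / c * (2 * r)..s j + l / c * (2 * r)}" for j
      have Am: "A j \<in> sets (lebesgue_on (I j))" for j
        unfolding A_def by (auto simp: sets_restrict_space)
      have "?T \<subseteq> PiE UNIV A"
      proof
        fix t assume "t \<in> ?T"
        then have t: "t \<in> space (box I)" "\<And>i. \<bar>\<Psi> t i - \<xi> i\<bar> < r" by auto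
        have "\<bar>t j - s j\<bar> \<le> l / c * (2 * r)" for j
        proof (rule sum_curve_lower[OF a01 al(2) c(1), where lo = lo and hi = hi])
          fix u x assume u: "\<forall>i. u i \<in> {lo i..hi i}"
          show "c / l * anis_norm a l x \<le> (\<Sum>i\<in>UNIV. \<bar>x \<bullet> gd 1 (u i)\<bar>)"
            by (rule c(4)[OF al(1,2) l al(3)]) (use u lohi in blast)+
        next
          fix i
          have "t i \<in> {lo i..hi i}" using space[OF t(1)] lohi(1) by blast
          then have ne: "lo i \<in> {lo i..hi i}" "hi i \<in> {lo i..hi i}" by auto
          show "0 \<le> lo i" "hi i \<le> 1" using subsetD[OF lohi(2) ne(1)] subsetD[OF lohi(2) ne(2)] al by auto
          show "t i \<in> {lo i..hi i}" by fact
          show "s i \<in> {lo i..hi i}" using space[OF s(1)] lohi(1) by blast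
          have "coord a l (\<Phi> t - \<Phi> s) i = \<Psi> t i - \<Psi> s i"
            by (simp add: \<Psi>_def coord_diff)
          then show "\<bar>coord a l ((\<Sum>i\<in>UNIV. \<gamma> (t i)) - (\<Sum>i\<in>UNIV. \<gamma> (s i))) i\<bar> \<le> 2 * r"
            using t(2)[of i] s(2)[of i] unfolding \<Phi>_def by linarith
        qed
        then have "t j \<in> A j" for j
          using space[OF t(1), of j] unfolding A_def by (simp add: abs_le_iff) (smt (verit))
        then show "t \<in> PiE UNIV A" by (auto simp: PiE_def)
      qed
      then have "emeasure (box I) ?T \<le> emeasure (box I) (PiE UNIV A)"
        using Am by (intro emeasure_mono sets_PiM_I_finite) auto
      also have "\<dots> = (\<Prod>j\<in>UNIV. emeasure (lebesgue_on (I j)) (A j))"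
        using Am by (intro P.emeasure_PiM) auto
      also have "\<dots> \<le> (\<Prod>j\<in>(UNIV :: 'n set). ennreal (4 * l / c * r))"
      proof (intro prod_mono_ennreal)
        fix j
        have "emeasure (lebesgue_on (I j)) (A j) = emeasure lebesgue (A j)"
          using al(4) by (subst emeasure_restrict_space) (auto simp: A_def)
        also have "\<dots> \<le> emeasure lebesgue {s j - l / c * (2 * r)..s j + l / c * (2 * r)}"
          by (intro emeasure_mono) (auto simp: A_def)
        also have "\<dots> = ennreal (4 * l / c * r)"
          using al(2) c(1) r by simp
        finally show "emeasure (lebesgue_on (I j)) (A j) \<le> ennreal (4 * l / c * r)" .
      qed
      also have "\<dots> = ennreal ((4 * l / c) ^ CARD('n) * r ^ CARD('n))"
        using al(2) c(1) r unfolding power_mult_distrib[symmetric] by (simp add: ennreal_power)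
      finally show ?thesis .
    qed
    let ?k = "\<lambda>x y. exp (- (\<Sum>i\<in>UNIV. (Y x i - Y y i)\<^sup>2) / 2)"
    have kern: "(LINT y|?\<mu>. ?k x y) \<le> B * l powr (- \<beta>) * lam powr (- \<alpha>)" for x
    proof -
      have m: "(\<lambda>y. ?k x y) \<in> borel_measurable ?\<mu>"
        using Ym by measurable
      have "ennreal (LINT y|?\<mu>. ?k x y) = (\<integral>\<^sup>+y. ennreal (?k x y) \<partial>?\<mu>)"
        by (intro nn_integral_eq_integral[symmetric] mu.integrable_const_bound[of _ 1] m) (auto intro!: sum_nonneg)
      also have "\<dots> \<le> (\<integral>\<^sup>+y. ennreal (?k x y) \<partial>\<mu>)"
        by (subst nn_integral_restrict_space) (auto simp: mu indicator_def intro!: nn_integral_mono)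
      also have "\<dots> \<le> ennreal (B * l powr (- \<beta>) * lam powr (- \<alpha>))"
        unfolding Y_def by (rule B(2)[OF a01 al(2) l1 lam])
      finally show ?thesis using B(1) by (subst (asm) ennreal_le_iff) (auto intro!: mult_nonneg_nonneg)
    qed
    have "(\<integral>\<^sup>+x. ennreal ((norm (LINT t|box I. F t * iexp (\<Sum>i\<in>UNIV. Y x i * \<Psi> t i)))\<^sup>2) \<partial>?\<mu>)
      \<le> ennreal ((4 * l / c) ^ CARD('n) / (2 * std_normal_density (?E + 1)) ^ CARD('n) * (B * l powr (- \<beta>) * lam powr (- \<alpha>))
          * (LINT t|box I. (norm (F t))\<^sup>2))"
      by (rule oscillatory_L2_bound[OF mu_fin P_fin(2) Ym Ybd \<Psi>m \<Psi>bd cube _ _ kern F F2])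
         (use al(2) c(1) B(1) lam in \<open>auto intro!: mult_pos_pos\<close>)
    also have "(4 * l / c) ^ CARD('n) / (2 * std_normal_density (?E + 1)) ^ CARD('n) * (B * l powr (- \<beta>) * lam powr (- \<alpha>))
       = G * l powr (CARD('n) - \<beta>) * lam powr (- \<alpha>)"
    proof -
      have "(4 * l / c) ^ CARD('n) = (4 / c) ^ CARD('n) * l powr real CARD('n)"
        using al(2) by (simp add: powr_realpow power_mult_distrib power_divide)
      moreover have "l powr (CARD('n) - \<beta>) = l powr real CARD('n) * l powr (- \<beta>)"
        by (simp add: powr_add[symmetric])
      ultimately show ?thesis unfolding G_def by (simp only: mult_ac divide_inverse)
    qed
    finally show "(\<integral>\<^sup>+x. ennreal ((norm (osc_box I lam F x))\<^sup>2) \<partial>?\<mu>)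
        \<le> ennreal (G * l powr (CARD('n) - \<beta>) * lam powr (- \<alpha>) * (LINT t|box I. (norm (F t))\<^sup>2))"
      using norm_eq unfolding \<Phi>_def by simp
  qed
qed

end

lemma powr_power': "n > 0 \<Longrightarrow> (x powr a) ^ n = x powr (real n * a)" for x :: real
  by (cases "x = 0") (auto simp: powr_power)

locale restriction_exponents = curve_and_measure \<gamma> \<mu> \<alpha> \<beta> M
    for \<gamma> :: "real \<Rightarrow> real ^ 'n::finite" and \<mu> \<alpha> \<beta> M +
  fixes p q :: real
  assumes q: "q \<ge> 2 * CARD('n)" and p: "p \<ge> 1" and pq: "CARD('n) / q \<le> 1 - 1 / p"
begin

definition gain :: real where
  "gain = q * (1 - 1 / p) - \<beta>"

text \<open>The product of the d integrals is one oscillatory integral of a tensor product over the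
  box, measured in the exponent r = q/d. By \<open>q\<close> this is at least 2, so the L^2 bound
  can be interpolated, and by \<open>pq\<close> its conjugate r' is at most p, so Hoelder's
  inequality applies in each variable.\<close>

lemma multilinear_Lq:
  assumes h: "h > 0"
  obtains C l0 where "C > 0" "l0 > 0" "l0 \<le> 1"
    "\<And>a l I lam R f N. admissible h a l I \<Longrightarrow> l \<le> l0 \<Longrightarrow> lam > 0 \<Longrightarrow>
      \<forall>i. f \<in> borel_measurable (lebesgue_on (I i)) \<and> integrable (lebesgue_on (I i)) (\<lambda>t. norm (f t) powr p)
        \<and> (LINT t|lebesgue_on (I i). norm (f t) powr p) \<le> N \<Longrightarrow>
      (\<integral>\<^sup>+x. ennreal (\<Prod>i\<in>UNIV. norm (osc_on (I i) lam f x) powr (q / CARD('n)))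
          \<partial>mu_ball R)
        \<le> ennreal (C * lam powr (- \<alpha>) * l powr gain * N powr (q / p))"
proof -
  let ?d = "real CARD('n)"
  have d: "?d > 0" by simp
  define r where "r = q / ?d"
  define r' where "r' = r / (r - 1)"
  have r: "r \<ge> 2" using q d by (simp add: r_def field_simps)
  have r1: "r' \<ge> 1" "r' > 0" using r by (simp_all add: r'_def field_simps)
  have "1 / r \<le> 1 - 1 / p" using pq by (simp add: r_def)
  then have "1 / p \<le> (r - 1) / r" using r by (simp add: diff_divide_distrib)
  then have r'p: "r' \<le> p" using r p by (simp add: r'_def field_simps)
  obtain C l0 where C: "C > 0" "l0 > 0" "l0 \<le> 1"
    "\<And>a l I lam R F. admissible h a l I \<Longrightarrow> l \<le> l0 \<Longrightarrow> lam > 0 \<Longrightarrow>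
      F \<in> borel_measurable (box I) \<Longrightarrow> integrable (box I) (\<lambda>t. (norm (F t))\<^sup>2) \<Longrightarrow>
      (\<integral>\<^sup>+x. ennreal ((norm (osc_box I lam F x))\<^sup>2) \<partial>mu_ball R)
        \<le> ennreal (C * l powr (CARD('n) - \<beta>) * lam powr (- \<alpha>) * (LINT t|box I. (norm (F t))\<^sup>2))"
    by (rule multilinear_L2[OF h]) (rule that)
  \<comment> \<open>The interpolation constant degenerates at r = 2, where the L^2 bound already has
    the desired form.\<close>
  define C1 where "C1 = (if r = 2 then 1 else 4 * r * 2 powr (r - 2) / (r - 2))"
  have C1: "C1 > 0" using r by (simp add: C1_def)
  let ?K = "C1 * C * 2 powr (q - ?d)"
  show ?thesis
  proof (rule that[OF _ C(2,3)])
    show "?K > 0" using C1 C(1) by simp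
    fix a l lam R N :: real and I :: "'n \<Rightarrow> real set" and f :: "real \<Rightarrow> complex"
    assume adm: "admissible h a l I" and l: "l \<le> l0" and lam: "lam > 0"
      and f: "\<forall>i. f \<in> borel_measurable (lebesgue_on (I i)) \<and> integrable (lebesgue_on (I i)) (\<lambda>t. norm (f t) powr p)
        \<and> (LINT t|lebesgue_on (I i). norm (f t) powr p) \<le> N"
    have l_pos: "l > 0" using adm by (simp add: admissible_def)
    have fm: "f \<in> borel_measurable (lebesgue_on (I i))"
      and fp: "integrable (lebesgue_on (I i)) (\<lambda>t. norm (f t) powr p)"
      and fN: "(LINT t|lebesgue_on (I i). norm (f t) powr p) \<le> N" for i
      using f by auto
    have N0: "N \<ge> 0" by (rule order_trans[OF _ fN]) simp
    let ?\<mu> = "mu_ball R"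
    have mu_fin: "finite_measure ?\<mu>" by (rule finite_measure_restrict_ball[OF mu ball])
    note P_fin = admissible_finite[OF adm]
    interpret P: product_sigma_finite "\<lambda>i. lebesgue_on (I i)" by (rule P_fin(3))
    have meas: "measure (lebesgue_on (I i)) (space (lebesgue_on (I i))) \<le> l" for i
    proof -
      have Is: "I i \<in> sets lebesgue" using adm by (simp add: admissible_def)
      have "measure (lebesgue_on (I i)) (space (lebesgue_on (I i))) = measure lebesgue (I i)"
        using Is by (simp add: measure_restrict_space)
      also have "\<dots> \<le> measure lebesgue {a..a + l}"
        using Is admissible_subset[OF adm, of i] by (intro measure_mono_fmeasurable) auto
      finally show ?thesis using l_pos by simp
    qed
    have g: "integrable (lebesgue_on (I i)) (\<lambda>t. norm (f t) powr s)"
      "(LINT t|lebesgue_on (I i). norm (f t) powr s) \<le> 2 * l powr (1 - s / p) * N powr (s / p)"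
      if s: "0 < s" "s \<le> p" for i s
    proof -
      have eq: "(norm (f t) powr s) powr (p / s) = norm (f t) powr p" for t
        using s by (simp add: powr_powr)
      have ps: "p / s \<ge> 1" using s by simp
      have m: "(\<lambda>t. norm (f t) powr s) \<in> borel_measurable (lebesgue_on (I i))" using fm[of i] by measurable
      note * = integral_le_powr[OF P_fin(1) m _ ps _ _ meas l_pos, unfolded eq, OF _ fp fN]
      show "integrable (lebesgue_on (I i)) (\<lambda>t. norm (f t) powr s)" by (rule *(1)) simp
      show "(LINT t|lebesgue_on (I i). norm (f t) powr s) \<le> 2 * l powr (1 - s / p) * N powr (s / p)"
        using *(2) by simp
    qed
    have fi: "integrable (lebesgue_on (I i)) f" for i
      using g(1)[of 1 i] p fm[of i] by (simp add: integrable_norm_iff)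
    define F where "F t = (\<Prod>i\<in>UNIV. f (t i))" for t :: "'n \<Rightarrow> real"
    have Fi: "integrable (box I) F" unfolding F_def by (rule P.product_integrable_prod) (auto intro: fi)
    then have Fm: "F \<in> borel_measurable (box I)" by (rule borel_measurable_integrable)
    define NF where "NF = (LINT t|box I. norm (F t) powr r')"
    have Fpow: "norm (F t) powr s = (\<Prod>i\<in>UNIV. norm (f (t i)) powr s)" for t s
      by (simp add: F_def prod_norm[symmetric] prod_powr_distrib)
    have Fint: "integrable (box I) (\<lambda>t. norm (F t) powr r')"
      unfolding Fpow by (rule P.product_integrable_prod) (auto intro: g r1 r'p)
    have NF: "NF = (\<Prod>i\<in>UNIV. LINT t|lebesgue_on (I i). norm (f t) powr r')"
      unfolding NF_def Fpow by (rule P.product_integral_prod) (auto intro: g r1 r'p)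
    have S: "(osc_box I lam F x) = (\<Prod>i\<in>UNIV. osc_on (I i) lam f x)" for x
    proof -
      have "F t * iexp (lam * (x \<bullet> (\<Sum>i\<in>UNIV. \<gamma> (t i)))) = (\<Prod>i\<in>UNIV. f (t i) * iexp (lam * (x \<bullet> \<gamma> (t i))))" for t
        by (simp add: F_def prod.distrib exp_sum[symmetric] inner_sum_right sum_distrib_left)
      moreover have "integrable (lebesgue_on (I i)) (\<lambda>t. f t * iexp (lam * (x \<bullet> \<gamma> t)))" for i
      proof (rule Bochner_Integration.integrable_bound[OF fi])
        have "\<gamma> \<in> borel_measurable (lebesgue_on (I i))"
          using adm admissible_subset[OF adm, of i] by (intro gamma_measurable) (auto simp: admissible_def)
        then show "(\<lambda>t. f t * iexp (lam * (x \<bullet> \<gamma> t))) \<in> borel_measurable (lebesgue_on (I i))"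
          using fm[of i] by measurable
      qed (simp add: norm_mult)
      ultimately show ?thesis
        by (simp only:) (rule P.product_integral_prod, simp_all)
    qed
    define B where "B = C * l powr (?d - \<beta>) * lam powr (- \<alpha>)"
    have B: "B \<ge> 0" using C(1) by (simp add: B_def)
    have main: "(\<integral>\<^sup>+x. ennreal (norm (osc_box I lam F x) powr r) \<partial>?\<mu>)
      \<le> ennreal (C1 * B * NF powr (r - 1))"
    proof (cases "r = 2")
      case True
      then have r': "r' = 2" by (simp add: r'_def)
      have sq: "integrable (box I) (\<lambda>t. (norm (F t))\<^sup>2)" using Fint by (simp add: r' powr_numeral)
      have "NF = (LINT t|box I. (norm (F t))\<^sup>2)" "NF \<ge> 0" by (simp_all add: NF_def r' powr_numeral)
      then show ?thesis using C(4)[OF adm l lam Fm sq, of R]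
        by (simp add: True C1_def B_def powr_numeral)
    next
      case False
      have Km: "case_prod (\<lambda>x t. iexp (lam * (x \<bullet> (\<Sum>i\<in>UNIV. \<gamma> (t i))))) \<in> borel_measurable (?\<mu> \<Otimes>\<^sub>M box I)"
      proof -
        have 1: "(\<lambda>x. x) \<in> borel_measurable ?\<mu>"
          by (rule measurable_restrict_space1) (simp add: measurable_cong_sets[OF mu refl])
        note [measurable] = measurable_compose[OF measurable_fst 1] measurable_compose[OF measurable_snd sum_gamma_measurable[OF adm]]
        show ?thesis by measurable
      qed
      have "(\<integral>\<^sup>+x. ennreal (norm (osc_box I lam F x) powr r) \<partial>?\<mu>)
        \<le> ennreal (4 * r * 2 powr (r - 2) / (r - 2) * B * NF powr (r - 1))"
      proof (rule restricted_marcinkiewicz[OF finite_measure.axioms(1)[OF mu_fin] P_fin(2) Km _ B _ _ Fm])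
        show "r > 2" using r False by simp
        fix G :: "('n \<Rightarrow> real) \<Rightarrow> complex"
        assume "G \<in> borel_measurable (box I)" "integrable (box I) (\<lambda>t. (norm (G t))\<^sup>2)"
        then show "(\<integral>\<^sup>+x. ennreal ((norm (osc_box I lam G x))\<^sup>2) \<partial>?\<mu>)
          \<le> ennreal (B * (LINT t|box I. (norm (G t))\<^sup>2))"
          unfolding B_def by (rule C(4)[OF adm l lam])
      qed (use Fint in \<open>simp_all add: r'_def NF_def\<close>)
      then show ?thesis using False by (simp add: C1_def)
    qed
    \<comment> \<open>Each of the d factors is estimated on an arc of length l; the identity r'(r-1)
      = r brings the exponents into this form.\<close>
    have NFb: "NF powr (r - 1) \<le> 2 powr (q - ?d) * l powr (q - ?d - q / p) * N powr (q / p)"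
    proof -
      let ?X = "2 * l powr (1 - r' / p) * N powr (r' / p)"
      have dr: "?d * (r - 1) = q - ?d" using d by (simp add: r_def field_simps)
      have rr: "r' * (r - 1) = r" using r by (simp add: r'_def)
      have rw: "r' / p * (r - 1) * ?d = q / p"
      proof -
        have "r' / p * (r - 1) * ?d = (r' * (r - 1)) * ?d / p" by simp
        also have "\<dots> = q / p" unfolding rr using d by (simp add: r_def)
        finally show ?thesis .
      qed
      have "NF powr (r - 1) = (\<Prod>i\<in>UNIV. (LINT t|lebesgue_on (I i). norm (f t) powr r') powr (r - 1))"
        unfolding NF by (rule prod_powr_distrib)
      also have "\<dots> \<le> (\<Prod>i\<in>(UNIV :: 'n set). ?X powr (r - 1))"
        using r g(2)[OF r1(2) r'p] by (intro prod_mono conjI powr_mono2) auto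
      also have "\<dots> = (?X powr (r - 1)) ^ CARD('n)" by simp
      also have "?X powr (r - 1) = 2 powr (r - 1) * l powr ((1 - r' / p) * (r - 1)) * N powr (r' / p * (r - 1))"
        using l_pos N0 by (simp add: powr_mult powr_powr)
      also have "\<dots> ^ CARD('n) = 2 powr (?d * (r - 1)) * l powr (?d * ((1 - r' / p) * (r - 1))) * N powr (?d * (r' / p * (r - 1)))"
        by (simp only: power_mult_distrib powr_power' zero_less_card_finite)
      also have "?d * ((1 - r' / p) * (r - 1)) = q - ?d - q / p"
      proof -
        have "?d * ((1 - w) * (r - 1)) = ?d * (r - 1) - w * (r - 1) * ?d" for w
          by (simp add: algebra_simps)
        from this[of "r' / p"] show ?thesis unfolding rw dr .
      qed
      also have "?d * (r' / p * (r - 1)) = q / p" unfolding rw[symmetric] by (simp only: mult_ac)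
      finally show ?thesis unfolding dr .
    qed
    have "(\<integral>\<^sup>+x. ennreal (\<Prod>i\<in>UNIV. norm (osc_on (I i) lam f x) powr (q / ?d)) \<partial>?\<mu>)
       = (\<integral>\<^sup>+x. ennreal (norm (osc_box I lam F x) powr r) \<partial>?\<mu>)"
      unfolding S r_def[symmetric] by (simp add: prod_norm[symmetric] prod_powr_distrib)
    also have "\<dots> \<le> ennreal (C1 * B * NF powr (r - 1))" by (rule main)
    also have "\<dots> \<le> ennreal (C1 * B * (2 powr (q - ?d) * l powr (q - ?d - q / p) * N powr (q / p)))"
      using C1 B by (intro ennreal_leI mult_left_mono NFb) auto
    also have "C1 * B * (2 powr (q - ?d) * l powr (q - ?d - q / p) * N powr (q / p))
      = ?K * lam powr (- \<alpha>) * (l powr (?d - \<beta>) * l powr (q - ?d - q / p)) * N powr (q / p)"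
      unfolding B_def by (simp only: mult_ac)
    \<comment> \<open>The dimension cancels: (d - \<beta>) + (q - d - q/p) = q (1 - 1/p) -
      \<beta>.\<close>
    also have "l powr (?d - \<beta>) * l powr (q - ?d - q / p) = l powr gain"
      by (simp add: powr_add[symmetric] gain_def algebra_simps)
    finally show "(\<integral>\<^sup>+x. ennreal (\<Prod>i\<in>UNIV. norm (osc_on (I i) lam f x) powr (q / CARD('n))) \<partial>?\<mu>)
        \<le> ennreal (?K * lam powr (- \<alpha>) * l powr gain * N powr (q / p))" .
  qed
qed

end

section \<open>The pointwise broad-narrow alternative\<close>

text \<open>The embedding of l^1 into l^s. With s = q/p it recombines the masses of the pieces in
  \<open>local_estimate\<close>; this is where p <= q enters.\<close>

lemma powr_sum_le:
  fixes x :: "'a \<Rightarrow> real"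
  assumes "finite K" "\<And>k. k \<in> K \<Longrightarrow> x k \<ge> 0" "s \<ge> 1"
  shows "(\<Sum>k\<in>K. x k powr s) \<le> (\<Sum>k\<in>K. x k) powr s"
proof -
  let ?S = "\<Sum>k\<in>K. x k"
  have split: "u powr s = u * u powr (s - 1)" if "u \<ge> 0" for u :: real
    using that powr_add[of u 1 "s - 1"] by (cases "u = 0") auto
  have "(\<Sum>k\<in>K. x k powr s) \<le> (\<Sum>k\<in>K. x k * ?S powr (s - 1))"
  proof (rule sum_mono)
    fix k assume k: "k \<in> K"
    have "x k powr (s - 1) \<le> ?S powr (s - 1)"
      using assms k by (intro powr_mono2 member_le_sum) auto
    then show "x k powr s \<le> x k * ?S powr (s - 1)"
      using assms(2)[OF k] by (simp add: split mult_left_mono)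
  qed
  also have "\<dots> = ?S powr s" using assms(2) by (simp add: sum_distrib_right[symmetric] split sum_nonneg)
  finally show ?thesis .
qed

text \<open>Either few pieces carry the sum, and then the largest one does, or there are so many significant
  pieces that \<open>d\<close> of them are pairwise non-adjacent: half of them have indices of equal parity.\<close>

lemma broad_narrow:
  fixes w :: "nat \<Rightarrow> complex" and q :: real
  assumes q: "q > 0" and A: "A > 0"
  defines "Sep \<equiv> {\<sigma> \<in> PiE (UNIV :: 'n::finite set) (\<lambda>_. {..<A}). \<forall>i j. i \<noteq> j \<longrightarrow> \<sigma> i + 2 \<le> \<sigma> j \<or> \<sigma> j + 2 \<le> \<sigma> i}"
  shows "norm (\<Sum>k<A. w k) powr q \<le> (4 * real CARD('n)) powr q * (\<Sum>k<A. norm (w k) powr q)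
    + (2 * real A) powr q * (\<Sum>\<sigma>\<in>Sep. \<Prod>i\<in>UNIV. norm (w (\<sigma> i)) powr (q / CARD('n)))"
proof -
  let ?z = "norm (\<Sum>k<A. w k)"
  have Sep: "finite Sep" unfolding Sep_def by (rule finite_subset[of _ "PiE (UNIV :: 'n set) (\<lambda>_. {..<A})"]) (auto intro: finite_PiE)
  let ?P = "\<Sum>\<sigma>\<in>Sep. \<Prod>i\<in>(UNIV :: 'n set). norm (w (\<sigma> i)) powr (q / CARD('n))"
  have nn1: "0 \<le> (4 * real CARD('n)) powr q * (\<Sum>k<A. norm (w k) powr q)"
    by (intro mult_nonneg_nonneg sum_nonneg) auto
  have nn2: "0 \<le> (2 * real A) powr q * ?P"
    by (intro mult_nonneg_nonneg sum_nonneg prod_nonneg) auto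
  show ?thesis
  proof (cases "?z = 0")
    case True
    then show ?thesis using nn1 nn2 by simp
  next
    case False
    then have z: "?z > 0" by simp
    \<comment> \<open>With the threshold z/(2A) the insignificant pieces, at most A in number, sum
      to at most z/2, so the significant ones carry the other half.\<close>
    define G where "G = {k. k < A \<and> ?z / (2 * real A) \<le> norm (w k)}"
    have G: "finite G" "G \<subseteq> {..<A}" by (auto simp: G_def)
    have half: "?z / 2 \<le> (\<Sum>k\<in>G. norm (w k))"
    proof -
      have "?z \<le> (\<Sum>k<A. norm (w k))" by (rule norm_sum)
      also have "\<dots> = (\<Sum>k\<in>G. norm (w k)) + (\<Sum>k\<in>{..<A} - G. norm (w k))"
        using G by (subst sum.subset_diff[of G "{..<A}"]) auto
      also have "(\<Sum>k\<in>{..<A} - G. norm (w k)) \<le> (\<Sum>k\<in>{..<A} - G. ?z / (2 * real A))"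
        by (intro sum_mono) (auto simp: G_def)
      also have "\<dots> \<le> (\<Sum>k<A. ?z / (2 * real A))" by (intro sum_mono2) auto
      also have "\<dots> = ?z / 2" using A by simp
      finally show ?thesis by simp
    qed
    show ?thesis
    proof (cases "card G < 2 * CARD('n)")
      case True
      have "G \<noteq> {}" using half z by auto
      define m where "m = Max ((\<lambda>k. norm (w k)) ` G)"
      have "m \<in> (\<lambda>k. norm (w k)) ` G" unfolding m_def using G \<open>G \<noteq> {}\<close> by (intro Max_in) auto
      then obtain k where k: "k \<in> G" "m = norm (w k)" by auto
      \<comment> \<open>Fewer than 2d pieces carry z/2, so the largest is at least z/(4d). This is
        why the constant of the narrow term is free of A.\<close>
      have "?z / 2 \<le> card G * m"
        using half sum_bounded_above[of G "\<lambda>k. norm (w k)" m] G by (auto simp: m_def intro: order_trans)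
      also have "\<dots> \<le> (2 * real CARD('n)) * m" using True k(2) by (intro mult_right_mono) auto
      finally have "?z \<le> (4 * real CARD('n)) * norm (w k)" using k by simp
      then have "?z powr q \<le> ((4 * real CARD('n)) * norm (w k)) powr q" using q by (intro powr_mono2) auto
      also have "\<dots> = (4 * real CARD('n)) powr q * norm (w k) powr q" by (simp add: powr_mult)
      also have "\<dots> \<le> (4 * real CARD('n)) powr q * (\<Sum>k<A. norm (w k) powr q)"
        using k G by (intro mult_left_mono member_le_sum) auto
      finally show ?thesis using nn2 by linarith
    next
      case False
      define G0 where "G0 = {k \<in> G. even k}"
      define G1 where "G1 = {k \<in> G. odd k}"
      have "card G = card G0 + card G1"
        using G by (subst card_Un_disjoint[symmetric]) (auto simp: G0_def G1_def intro!: arg_cong[where f = card])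
      then have "CARD('n) \<le> card G0 \<or> CARD('n) \<le> card G1" using False by linarith
      then obtain G' where G': "CARD('n) \<le> card G'" "G' = G0 \<or> G' = G1" by blast
      then have G'f: "finite G'" "G' \<subseteq> G" using G by (auto simp: G0_def G1_def)
      obtain \<sigma> where \<sigma>: "\<sigma> ` (UNIV :: 'n set) \<subseteq> G'" "inj \<sigma>"
        using card_le_inj[OF finite_class.finite_UNIV G'f(1) G'(1)] by blast
      have "\<sigma> \<in> Sep" unfolding Sep_def
      proof (intro CollectI conjI allI impI)
        show "\<sigma> \<in> PiE UNIV (\<lambda>_. {..<A})" using \<sigma> G'f G by (auto simp: PiE_def)
        fix i j :: 'n assume "i \<noteq> j"
        then have ne: "\<sigma> i \<noteq> \<sigma> j" using \<sigma>(2) by (auto dest: injD)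
        have "even (\<sigma> i) = even (\<sigma> j)"
          using G'(2) \<sigma>(1) unfolding G0_def G1_def by blast
        then show "\<sigma> i + 2 \<le> \<sigma> j \<or> \<sigma> j + 2 \<le> \<sigma> i" using ne by presburger
      qed
      let ?r = "q / CARD('n)"
      have d: "real CARD('n) > 0" by simp
      \<comment> \<open>Each of the d selected pieces is at least z/(2A); spreading z^q evenly over
        them produces the geometric mean.\<close>
      have "?z powr q = (\<Prod>i\<in>(UNIV :: 'n set). ?z powr ?r)"
        using z d by (simp add: powr_power)
      also have "\<dots> \<le> (\<Prod>i\<in>(UNIV :: 'n set). (2 * real A) powr ?r * norm (w (\<sigma> i)) powr ?r)"
      proof (intro prod_mono conjI)
        fix i
        have "\<sigma> i \<in> G" using \<sigma> G'f by auto
        then have "?z \<le> (2 * real A) * norm (w (\<sigma> i))" using A by (simp add: G_def field_simps)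
        then have "?z powr ?r \<le> ((2 * real A) * norm (w (\<sigma> i))) powr ?r"
          using q by (intro powr_mono2) auto
        then show "?z powr ?r \<le> (2 * real A) powr ?r * norm (w (\<sigma> i)) powr ?r"
          by (simp add: powr_mult)
      qed simp
      also have "\<dots> = (2 * real A) powr q * (\<Prod>i\<in>(UNIV :: 'n set). norm (w (\<sigma> i)) powr ?r)"
        using A d by (simp add: prod.distrib powr_power)
      also have "\<dots> \<le> (2 * real A) powr q * ?P"
        using \<open>\<sigma> \<in> Sep\<close> Sep by (intro mult_left_mono member_le_sum[of \<sigma>]) (auto intro!: prod_nonneg)
      finally show ?thesis using nn1 by linarith
    qed
  qed
qed

section \<open>The broad-narrow iteration\<close>

lemma integrable_lebesgue_on_subset:
  fixes g :: "real \<Rightarrow> 'b::{banach, second_countable_topology}"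
  assumes "integrable (lebesgue_on S) g" "T \<subseteq> S" "S \<in> sets lebesgue" "T \<in> sets lebesgue"
  shows "integrable (lebesgue_on T) g"
proof -
  have "set_integrable lebesgue S g" using assms by (simp add: integrable_restrict_space set_integrable_def)
  then have "set_integrable lebesgue T g" using assms by (auto intro: set_integrable_subset)
  then show ?thesis using assms by (simp add: integrable_restrict_space set_integrable_def)
qed

lemma integral_split_pieces:
  fixes g :: "real \<Rightarrow> 'b::{banach, second_countable_topology}"
  assumes g: "integrable (lebesgue_on {a..<a + real A * w}) g" and w: "w > 0"
  shows "(LINT t|lebesgue_on {a..<a + real A * w}. g t) = (\<Sum>k<A. LINT t|lebesgue_on {a + real k * w..<a + real k * w + w}. g t)"
proof -
  let ?J = "\<lambda>k. {a + real k * w..<a + real k * w + w}"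
  have ind: "indicator {a..<a + real m * w} t = (\<Sum>k<m. indicator (?J k) t :: real)" for m t
  proof (induction m)
    case (Suc m)
    define y where "y = real m * w"
    have y: "0 \<le> y" "real (Suc m) * w = y + w" using w by (simp_all add: y_def distrib_right)
    have "(indicator {a..<a + real (Suc m) * w} t :: real) = indicator {a..<a + real m * w} t + indicator (?J m) t"
      unfolding y(2) y_def[symmetric] using w y(1) by (auto simp: indicator_def)
    then show ?case using Suc by simp
  qed simp
  have sub: "?J k \<subseteq> {a..<a + real A * w}" if "k < A" for k
  proof -
    define y where "y = real k * w"
    have "0 \<le> y" using w by (simp add: y_def)
    moreover have "(real k + 1) * w \<le> real A * w" using that w by (intro mult_right_mono) auto
    then have "y + w \<le> real A * w" by (simp add: y_def distrib_right)
    ultimately show ?thesis unfolding y_def[symmetric] by auto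
  qed
  have int: "integrable lebesgue (\<lambda>t. indicator (?J k) t *\<^sub>R g t)" if "k < A" for k
    using integrable_lebesgue_on_subset[OF g sub[OF that]]
    by (simp add: integrable_restrict_space set_integrable_def)
  have "(LINT t|lebesgue_on {a..<a + real A * w}. g t) = (LINT t|lebesgue. (\<Sum>k<A. indicator (?J k) t *\<^sub>R g t))"
    by (simp add: integral_restrict_space ind scaleR_left.sum)
  also have "\<dots> = (\<Sum>k<A. LINT t|lebesgue. indicator (?J k) t *\<^sub>R g t)"
    using int by (intro Bochner_Integration.integral_sum) auto
  also have "\<dots> = (\<Sum>k<A. LINT t|lebesgue_on (?J k). g t)"
    by (simp add: integral_restrict_space)
  finally show ?thesis .
qed

context nondegenerate_curve
begin

text \<open>Half-open intervals let equal pieces tile an interval without overlap.\<close>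

definition piece :: "real \<Rightarrow> (real \<Rightarrow> complex) \<Rightarrow> real \<Rightarrow> real \<Rightarrow> real ^ 'n \<Rightarrow> complex" where
  "piece lam f a l x = (LINT t|lebesgue_on {a..<a + l}. f t * iexp (lam * (x \<bullet> \<gamma> t)))"

definition mass :: "real \<Rightarrow> (real \<Rightarrow> complex) \<Rightarrow> real \<Rightarrow> real \<Rightarrow> real" where
  "mass p f a l = (LINT t|lebesgue_on {a..<a + l}. norm (f t) powr p)"

lemma mass_nonneg: "mass p f a l \<ge> 0"
  by (simp add: mass_def)

lemma piece_integrable:
  assumes "integrable (lebesgue_on S) f" "S \<in> sets lebesgue" "S \<subseteq> {0..1}"
  shows "integrable (lebesgue_on S) (\<lambda>t. f t * iexp (lam * (x \<bullet> \<gamma> t)))"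
proof (rule Bochner_Integration.integrable_bound[OF assms(1)])
  note [measurable] = gamma_measurable[OF assms(2,3)] borel_measurable_integrable[OF assms(1)]
  show "(\<lambda>t. f t * iexp (lam * (x \<bullet> \<gamma> t))) \<in> borel_measurable (lebesgue_on S)" by measurable
qed (simp add: norm_mult)

lemma osc_measurable:
  assumes "f \<in> borel_measurable (lebesgue_on S)" "S \<in> sets lebesgue" "S \<subseteq> {0..1}"
  shows "(\<lambda>x. osc_on S lam f x) \<in> borel_measurable borel"
proof -
  interpret finite_measure "lebesgue_on S"
    by (rule finite_measure_lebesgue_on_subset[OF assms(2,3)])
  note [measurable] = gamma_measurable[OF assms(2,3)] assms(1)
  show ?thesis by measurable
qed

end

context restriction_exponents
begin

text \<open>\<open>broad_narrow\<close> integrated over a ball. \<open>C\<close> may grow with A,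
  whereas the factor in front of the narrow sum does not, and A can still be chosen large.\<close>

lemma broad_narrow_step:
  assumes A: "(A :: nat) > 0"
  obtains C l0 where "C > 0" "l0 > 0" "l0 \<le> 1"
    "\<And>a l lam R f. 0 \<le> a \<Longrightarrow> 0 < l \<Longrightarrow> a + l \<le> 1 \<Longrightarrow> l \<le> l0 \<Longrightarrow> lam > 0 \<Longrightarrow>
      integrable (lebesgue_on {0..1}) f \<Longrightarrow>
      integrable (lebesgue_on {0..1}) (\<lambda>t. norm (f t) powr p) \<Longrightarrow>
      (\<integral>\<^sup>+x. ennreal (norm (piece lam f a l x) powr q) \<partial>mu_ball R)
        \<le> ennreal ((4 * real CARD('n)) powr q) * (\<Sum>k<A. \<integral>\<^sup>+x. ennreal (norm (piece lam f (a + real k * (l / A)) (l / A) x) powr q) \<partial>mu_ball R)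
          + ennreal (C * lam powr (- \<alpha>) * l powr gain * mass p f a l powr (q / p))"
proof -
  have h: "1 / real A > 0" using A by simp
  obtain C l0 where C: "C > 0" "l0 > 0" "l0 \<le> 1"
    "\<And>a l I lam R f N. admissible (1 / real A) a l I \<Longrightarrow> l \<le> l0 \<Longrightarrow> lam > 0 \<Longrightarrow>
      \<forall>i. f \<in> borel_measurable (lebesgue_on (I i)) \<and> integrable (lebesgue_on (I i)) (\<lambda>t. norm (f t) powr p)
        \<and> (LINT t|lebesgue_on (I i). norm (f t) powr p) \<le> N \<Longrightarrow>
      (\<integral>\<^sup>+x. ennreal (\<Prod>i\<in>UNIV. norm (osc_on (I i) lam f x) powr (q / CARD('n)))
          \<partial>mu_ball R)
        \<le> ennreal (C * lam powr (- \<alpha>) * l powr gain * N powr (q / p))"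
    by (rule multilinear_Lq[OF h]) (rule that)
  define Sep where "Sep = {\<sigma> \<in> PiE (UNIV :: 'n set) (\<lambda>_. {..<A}). \<forall>i j. i \<noteq> j \<longrightarrow> \<sigma> i + 2 \<le> \<sigma> j \<or> \<sigma> j + 2 \<le> \<sigma> i}"
  have Sep: "finite Sep" unfolding Sep_def by (rule finite_subset[of _ "PiE (UNIV :: 'n set) (\<lambda>_. {..<A})"]) (auto intro: finite_PiE)
  have q0: "q > 0" using q by (rule less_le_trans[rotated]) simp
  \<comment> \<open>The \<open>+ 1\<close> keeps the constant positive when A is too small for d
    pairwise non-adjacent pieces and \<open>Sep\<close> is empty.\<close>
  let ?C = "(2 * real A) powr q * (real (card Sep) + 1) * C"
  show ?thesis
  proof (rule that[OF _ C(2,3)])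
    show "?C > 0" using A C(1) by (intro mult_pos_pos) auto
    fix a l lam R :: real and f :: "real \<Rightarrow> complex"
    assume al: "0 \<le> a" "0 < l" "a + l \<le> 1" "l \<le> l0" and lam: "lam > 0"
      and fi: "integrable (lebesgue_on {0..1}) f"
      and fp: "integrable (lebesgue_on {0..1}) (\<lambda>t. norm (f t) powr p)"
    define w where "w = l / A"
    have w: "w > 0" "real A * w = l" using A al by (simp_all add: w_def)
    let ?J = "\<lambda>k. {a + real k * w..<a + real k * w + w}"
    let ?\<mu> = "mu_ball R"
    have sub: "?J k \<subseteq> {a..a + l} \<and> {a + real k * w..a + real k * w + w} \<subseteq> {a..a + l}" if "k < A" for k
    proof -
      define y where "y = real k * w"
      have "0 \<le> y" using w by (simp add: y_def)
      moreover have "(real k + 1) * w \<le> real A * w" using that w by (intro mult_right_mono) auto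
      then have "y + w \<le> l" using w(2) by (simp add: y_def distrib_right)
      ultimately show ?thesis unfolding y_def[symmetric] by auto
    qed
    have sub01: "?J k \<subseteq> {0..1}" if "k < A" for k using sub[OF that] al by fastforce
    have big: "{a..<a + l} \<subseteq> {0..1}" using al by auto
    have f_big: "integrable (lebesgue_on {a..<a + l}) f" "integrable (lebesgue_on {a..<a + l}) (\<lambda>t. norm (f t) powr p)"
      by (rule integrable_lebesgue_on_subset[OF fi big] integrable_lebesgue_on_subset[OF fp big]; simp)+
    have split: "piece lam f a l x = (\<Sum>k<A. piece lam f (a + real k * w) w x)" for x
      using integral_split_pieces[of a A w "\<lambda>t. f t * iexp (lam * (x \<bullet> \<gamma> t))"] piece_integrable[OF f_big(1) _ big] w
      by (simp add: piece_def)
    have msplit: "mass p f a l = (\<Sum>k<A. mass p f (a + real k * w) w)"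
      using integral_split_pieces[of a A w "\<lambda>t. norm (f t) powr p"] f_big(2) w by (simp add: mass_def)
    have pm: "(\<lambda>x. piece lam f (a + real k * w) w x) \<in> borel_measurable ?\<mu>" if "k < A" for k
    proof -
      have "f \<in> borel_measurable (lebesgue_on (?J k))"
        using integrable_lebesgue_on_subset[OF fi sub01[OF that]] by (simp add: borel_measurable_integrable)
      then have "(\<lambda>x. piece lam f (a + real k * w) w x) \<in> borel_measurable borel"
        unfolding piece_def using sub01[OF that] by (intro osc_measurable) auto
      then have "(\<lambda>x. piece lam f (a + real k * w) w x) \<in> borel_measurable \<mu>"
        by (simp add: measurable_cong_sets[OF mu refl])
      then show ?thesis by (rule measurable_restrict_space1)
    qed
    let ?u = "\<lambda>k x. ennreal (norm (piece lam f (a + real k * w) w x) powr q)"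
    let ?v = "\<lambda>\<sigma> x. ennreal (\<Prod>i\<in>UNIV. norm (piece lam f (a + real (\<sigma> i) * w) w x) powr (q / CARD('n)))"
    let ?D = "(4 * real CARD('n)) powr q" and ?A = "(2 * real A) powr q"
    let ?B = "?C * lam powr (- \<alpha>) * l powr gain * mass p f a l powr (q / p)"
    let ?b = "C * lam powr (- \<alpha>) * l powr gain * mass p f a l powr (q / p)"
    have multi: "(\<integral>\<^sup>+x. ?v \<sigma> x \<partial>?\<mu>)
      \<le> ennreal ?b"
      if \<sigma>: "\<sigma> \<in> Sep" for \<sigma>
    proof -
      have \<sigma>A: "\<sigma> i < A" for i using \<sigma> by (auto simp: Sep_def)
      let ?lo = "\<lambda>i. a + real (\<sigma> i) * w" and ?hi = "\<lambda>i. a + real (\<sigma> i) * w + w"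
      have sep: "\<bar>u - v\<bar> \<ge> 1 / real A * l"
        if "i \<noteq> j" "u \<in> {?lo i..?hi i}" "v \<in> {?lo j..?hi j}" for i j u v
      proof -
        \<comment> \<open>Non-adjacent pieces have at least one whole piece between them; hence the
          gap l/A and the choice of 1/A as separation parameter.\<close>
        have lw: "1 / real A * l = w" by (simp add: w_def)
        have "\<sigma> i + 2 \<le> \<sigma> j \<or> \<sigma> j + 2 \<le> \<sigma> i" using \<sigma> that(1) by (simp add: Sep_def)
        then have "(real (\<sigma> i) + 2) * w \<le> real (\<sigma> j) * w \<or> (real (\<sigma> j) + 2) * w \<le> real (\<sigma> i) * w"
          using w by (auto intro!: mult_right_mono)
        then show ?thesis using that(2,3) unfolding lw by (auto simp: distrib_right)
      qed
      have 1: "\<forall>i. ?J (\<sigma> i) \<subseteq> {?lo i..?hi i} \<and> {?lo i..?hi i} \<subseteq> {a..a + l}"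
        using sub[OF \<sigma>A] by (simp add: atLeastLessThan_subseteq_atLeastAtMost_iff)
      have 2: "\<forall>i j. i \<noteq> j \<longrightarrow> (\<forall>u\<in>{?lo i..?hi i}. \<forall>v\<in>{?lo j..?hi j}. \<bar>u - v\<bar> \<ge> 1 / real A * l)"
        by (intro allI impI ballI sep)
      have adm: "admissible (1 / real A) a l (\<lambda>i. ?J (\<sigma> i))"
        unfolding admissible_def
      proof (intro conjI)
        show "\<exists>lo hi. (\<forall>i. ?J (\<sigma> i) \<subseteq> {lo i..hi i} \<and> {lo i..hi i} \<subseteq> {a..a + l}) \<and>
          (\<forall>i j. i \<noteq> j \<longrightarrow> (\<forall>u\<in>{lo i..hi i}. \<forall>v\<in>{lo j..hi j}. \<bar>u - v\<bar> \<ge> 1 / real A * l))"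
          by (rule exI[of _ ?lo], rule exI[of _ ?hi], rule conjI[OF 1 2])
      qed (use al in auto)
      show ?thesis unfolding piece_def
      proof (rule C(4)[OF adm al(4) lam], intro allI conjI)
        fix i
        show "f \<in> borel_measurable (lebesgue_on (?J (\<sigma> i)))"
          using integrable_lebesgue_on_subset[OF fi sub01[OF \<sigma>A]] by (simp add: borel_measurable_integrable)
        show "integrable (lebesgue_on (?J (\<sigma> i))) (\<lambda>t. norm (f t) powr p)"
          by (rule integrable_lebesgue_on_subset[OF fp sub01[OF \<sigma>A]]) auto
        show "(LINT t|lebesgue_on (?J (\<sigma> i)). norm (f t) powr p) \<le> mass p f a l"
          unfolding msplit mass_def[symmetric] by (rule member_le_sum) (auto simp: \<sigma>A mass_nonneg)
      qed
    qed
    have "(\<integral>\<^sup>+x. ennreal (norm (piece lam f a l x) powr q) \<partial>?\<mu>)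
      \<le> (\<integral>\<^sup>+x. ennreal ?D * (\<Sum>k<A. ?u k x)
          + ennreal ?A * (\<Sum>\<sigma>\<in>Sep. ?v \<sigma> x) \<partial>?\<mu>)"
    proof (rule nn_integral_mono)
      fix x
      have "norm (piece lam f a l x) powr q \<le> (4 * real CARD('n)) powr q * (\<Sum>k<A. norm (piece lam f (a + real k * w) w x) powr q)
         + (2 * real A) powr q * (\<Sum>\<sigma>\<in>Sep. \<Prod>i\<in>UNIV. norm (piece lam f (a + real (\<sigma> i) * w) w x) powr (q / CARD('n)))"
        unfolding split Sep_def by (rule broad_narrow[OF q0 A])
      then have "ennreal (norm (piece lam f a l x) powr q) \<le> ennreal \<dots>" by (rule ennreal_leI)
      also have "\<dots> = ennreal ?D * (\<Sum>k<A. ?u k x)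
          + ennreal ?A * (\<Sum>\<sigma>\<in>Sep. ?v \<sigma> x)"
        by (subst ennreal_plus) (auto intro!: mult_nonneg_nonneg sum_nonneg prod_nonneg simp: ennreal_mult sum_nonneg prod_nonneg)
      finally show "ennreal (norm (piece lam f a l x) powr q) \<le> \<dots>" .
    qed
    also have "\<dots> = ennreal ?D * (\<Sum>k<A. \<integral>\<^sup>+x. ?u k x \<partial>?\<mu>)
       + ennreal ?A * (\<Sum>\<sigma>\<in>Sep. \<integral>\<^sup>+x. ?v \<sigma> x \<partial>?\<mu>)"
    proof -
      have m1: "?u k \<in> borel_measurable ?\<mu>" if "k < A" for k
        using pm[OF that] by measurable
      have m2: "?v \<sigma> \<in> borel_measurable ?\<mu>"
        if "\<sigma> \<in> Sep" for \<sigma>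
      proof -
        have [measurable]: "(\<lambda>x. piece lam f (a + real (\<sigma> i) * w) w x) \<in> borel_measurable ?\<mu>" for i
          using that by (intro pm) (auto simp: Sep_def)
        show ?thesis by measurable
      qed
      have 1: "(\<lambda>x. \<Sum>k<A. ?u k x) \<in> borel_measurable ?\<mu>"
        by (rule borel_measurable_sum, rule m1) simp
      have 2: "(\<lambda>x. \<Sum>\<sigma>\<in>Sep. ?v \<sigma> x) \<in> borel_measurable ?\<mu>"
        by (rule borel_measurable_sum) (rule m2)
      show ?thesis
        unfolding nn_integral_add[OF borel_measurable_times_ennreal[OF borel_measurable_const 1] borel_measurable_times_ennreal[OF borel_measurable_const 2]]
          nn_integral_cmult[OF 1] nn_integral_cmult[OF 2]
        by (subst nn_integral_sum[OF m1], simp, subst nn_integral_sum[OF m2]) auto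
    qed
    also have "\<dots> \<le> ennreal ?D * (\<Sum>k<A. \<integral>\<^sup>+x. ?u k x \<partial>?\<mu>)
      + ennreal (?B)"
    proof (rule add_left_mono)
      have b: "?b \<ge> 0" using C(1) by simp
      have "ennreal ?A * (\<Sum>\<sigma>\<in>Sep. \<integral>\<^sup>+x. ?v \<sigma> x \<partial>?\<mu>)
         \<le> ennreal ?A * (\<Sum>\<sigma>\<in>Sep. ennreal ?b)"
        by (intro mult_left_mono sum_mono multi) auto
      also have "\<dots> = ennreal ((2 * real A) powr q * (real (card Sep) * ?b))"
        by (simp add: ennreal_of_nat_eq_real_of_nat ennreal_mult[symmetric] b)
      also have "\<dots> \<le> ennreal (?B)"
      proof (rule ennreal_leI)
        have "(2 * real A) powr q * (real (card Sep) * ?b) \<le> (2 * real A) powr q * ((real (card Sep) + 1) * ?b)"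
          using b by (intro mult_left_mono mult_right_mono) auto
        then show "(2 * real A) powr q * (real (card Sep) * ?b) \<le> ?B"
          by (simp only: mult.assoc)
      qed
      finally show "ennreal ?A * (\<Sum>\<sigma>\<in>Sep. \<integral>\<^sup>+x. ?v \<sigma> x \<partial>?\<mu>)
        \<le> ennreal (?B)" .
    qed
    finally show "(\<integral>\<^sup>+x. ennreal (norm (piece lam f a l x) powr q) \<partial>?\<mu>)
        \<le> ennreal ?D * (\<Sum>k<A. \<integral>\<^sup>+x. ennreal (norm (piece lam f (a + real k * (l / A)) (l / A) x) powr q) \<partial>?\<mu>)
          + ennreal (?C * lam powr (- \<alpha>) * l powr gain * mass p f a l powr (q / p))"
      unfolding w_def .
  qed
qed

end

lemma norm_sum_powr_le:
  fixes z :: "'a \<Rightarrow> 'b::real_normed_vector"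
  assumes "finite K" "q > 0"
  shows "norm (\<Sum>k\<in>K. z k) powr q \<le> real (card K) powr q * (\<Sum>k\<in>K. norm (z k) powr q)"
proof (cases "K = {}")
  case False
  define m where "m = Max ((\<lambda>k. norm (z k)) ` K)"
  have "m \<in> (\<lambda>k. norm (z k)) ` K" unfolding m_def using assms False by (intro Max_in) auto
  then obtain k where k: "k \<in> K" "m = norm (z k)" by auto
  have "norm (\<Sum>k\<in>K. z k) \<le> real (card K) * m"
    by (rule order_trans[OF norm_sum sum_bounded_above]) (use assms in \<open>auto simp: m_def\<close>)
  then have "norm (\<Sum>k\<in>K. z k) powr q \<le> (real (card K) * norm (z k)) powr q"
    using assms k by (intro powr_mono2) auto
  also have "\<dots> = real (card K) powr q * norm (z k) powr q" by (simp add: powr_mult)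
  also have "\<dots> \<le> real (card K) powr q * (\<Sum>k\<in>K. norm (z k) powr q)"
    using assms k by (intro mult_left_mono member_le_sum) auto
  finally show ?thesis .
qed simp

lemma integral_atLeastLessThan_eq:
  fixes g :: "real \<Rightarrow> complex"
  assumes g: "integrable (lebesgue_on {0..1}) g"
  shows "(LINT t|lebesgue_on {0..1}. g t) = (LINT t|lebesgue_on {0..<1}. g t)"
proof -
  have 1: "integrable lebesgue (\<lambda>t. indicator {0..1} t *\<^sub>R g t)"
    using g by (simp add: integrable_restrict_space)
  have 2: "integrable lebesgue (\<lambda>t. indicator {0..<1} t *\<^sub>R g t)"
    using integrable_lebesgue_on_subset[OF g atLeastLessThan_subseteq_atLeastAtMost_iff[THEN iffD2], of 0 1]
    by (simp add: integrable_restrict_space)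
  have "AE t in lebesgue. t \<noteq> (1::real)"
    by (rule AE_completion[OF AE_lborel_singleton])
  then have "AE t in lebesgue. indicator {0..1} t *\<^sub>R g t = indicator {0..<1} t *\<^sub>R g t"
    by eventually_elim (auto simp: indicator_def)
  then have "(LINT t|lebesgue. indicator {0..1} t *\<^sub>R g t) = (LINT t|lebesgue. indicator {0..<1} t *\<^sub>R g t)"
    using 1 2 by (intro integral_cong_AE borel_measurable_integrable)
  then show ?thesis by (simp add: integral_restrict_space)
qed

context restriction_exponents
begin

text \<open>Write y for the right side without its constant. Summed over the A pieces it is at most
  A^(-gain) times its value on the whole arc, and A is so large that this beats twice the narrow
  constant. Each application of \<open>broad_narrow_step\<close> therefore halves whatever bound is
  already known, up to a fixed additive term.\<close>

lemma local_estimate: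
  assumes qp: "p \<le> q" and e: "gain > 0"
  obtains C l0 where "C > 0" "l0 > 0" "l0 \<le> 1"
    "\<And>a l lam R f. 0 \<le> a \<Longrightarrow> 0 < l \<Longrightarrow> a + l \<le> 1 \<Longrightarrow> l \<le> l0 \<Longrightarrow> lam > 0 \<Longrightarrow>
      integrable (lebesgue_on {0..1}) f \<Longrightarrow>
      integrable (lebesgue_on {0..1}) (\<lambda>t. norm (f t) powr p) \<Longrightarrow>
      (\<integral>\<^sup>+x. ennreal (norm (piece lam f a l x) powr q) \<partial>mu_ball R)
        \<le> ennreal (C * lam powr (- \<alpha>) * (l powr gain * mass p f a l powr (q / p)))"
proof -
  let ?D = "(4 * real CARD('n)) powr q"
  have D: "?D > 0" by simp
  define A where "A = nat \<lceil>(2 * ?D) powr (1 / gain)\<rceil>"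
  have A1: "real A \<ge> (2 * ?D) powr (1 / gain)" unfolding A_def by linarith
  moreover have "(2 * ?D) powr (1 / gain) > 0" by simp
  ultimately have A: "A > 0" by (metis gr0I less_le_not_le of_nat_0)
  have "((2 * ?D) powr (1 / gain)) powr gain \<le> real A powr gain" using A1 e by (intro powr_mono2) auto
  then have "2 * ?D \<le> real A powr gain" using e by (simp add: powr_powr)
  then have DA: "?D * real A powr (- gain) \<le> 1 / 2"
    using A by (simp add: powr_minus field_simps)
  have q0: "q > 0" using q by (rule less_le_trans[rotated]) simp
  obtain C l0 where C: "C > 0" "l0 > 0" "l0 \<le> 1"
    "\<And>a l lam R f. 0 \<le> a \<Longrightarrow> 0 < l \<Longrightarrow> a + l \<le> 1 \<Longrightarrow> l \<le> l0 \<Longrightarrow> lam > 0 \<Longrightarrow>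
      integrable (lebesgue_on {0..1}) f \<Longrightarrow>
      integrable (lebesgue_on {0..1}) (\<lambda>t. norm (f t) powr p) \<Longrightarrow>
      (\<integral>\<^sup>+x. ennreal (norm (piece lam f a l x) powr q) \<partial>mu_ball R)
        \<le> ennreal ((4 * real CARD('n)) powr q) * (\<Sum>k<A. \<integral>\<^sup>+x. ennreal (norm (piece lam f (a + real k * (l / A)) (l / A) x) powr q) \<partial>mu_ball R)
          + ennreal (C * lam powr (- \<alpha>) * l powr gain * mass p f a l powr (q / p))"
    by (rule broad_narrow_step[OF A]) (rule that)
  show ?thesis
  proof (rule that[OF _ C(2,3)])
    show "2 * C > 0" using C(1) by simp
    fix a0 l0' lam R :: real and f :: "real \<Rightarrow> complex"
    assume al0: "0 \<le> a0" "0 < l0'" "a0 + l0' \<le> 1" "l0' \<le> l0" and lam: "lam > 0"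
      and fi: "integrable (lebesgue_on {0..1}) f"
      and fp: "integrable (lebesgue_on {0..1}) (\<lambda>t. norm (f t) powr p)"
    let ?\<mu> = "mu_ball R"
    interpret mu: finite_measure ?\<mu> by (rule finite_measure_restrict_ball[OF mu ball])
    define X where "X a l = (\<integral>\<^sup>+x. ennreal (norm (piece lam f a l x) powr q) \<partial>?\<mu>)" for a l
    define y where "y a l = l powr gain * mass p f a l powr (q / p)" for a l
    have y0: "y a l \<ge> 0" for a l by (simp add: y_def)
    define K where "K = C * lam powr (- \<alpha>)"
    have K: "K \<ge> 0" using C(1) by (simp add: K_def)
    \<comment> \<open>The coefficient of the crude bound that starts the iteration. It depends on R
      through the mass of the ball and must not survive.\<close>
    define m0 where "m0 = 2 powr q * measure ?\<mu> (space ?\<mu>)"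
    have m0: "m0 \<ge> 0" by (simp add: m0_def)
    have sub01: "{a..<a + l} \<subseteq> {0..1}" if "0 \<le> a" "a + l \<le> 1" for a l :: real using that by auto
    \<comment> \<open>The oscillatory integral is at most the L^1 norm of f on the arc. Hoelder's
      inequality yields l^(q (1 - 1/p)), which is at most l^gain because \<beta> > 0 and l <=
      1.\<close>
    have base: "X a l \<le> ennreal (m0 * y a l)" if al: "0 \<le> a" "0 < l" "a + l \<le> 1" for a l
    proof -
      let ?L = "lebesgue_on {a..<a + l}"
      have fi': "integrable ?L f" and fp': "integrable ?L (\<lambda>t. norm (f t) powr p)"
        by (rule integrable_lebesgue_on_subset[OF fi sub01[OF al(1,3)]]
            integrable_lebesgue_on_subset[OF fp sub01[OF al(1,3)]]; simp)+
      have "(LINT t|?L. norm (f t)) \<le> 2 * l powr (1 - 1 / p) * mass p f a l powr (1 / p)"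
      proof (rule integral_le_powr(2)[OF _ _ _ p fp'])
        show "finite_measure ?L" by (rule finite_measure_lebesgue_on_subset[of _ a "a + l"]) auto
        show "(\<lambda>t. norm (f t)) \<in> borel_measurable ?L" using borel_measurable_integrable[OF fi'] by measurable
        show "measure ?L (space ?L) \<le> l" using al by (simp add: measure_restrict_space)
      qed (use al in \<open>auto simp: mass_def\<close>)
      moreover have "norm (piece lam f a l x) \<le> (LINT t|?L. norm (f t))" for x
        unfolding piece_def by (rule order_trans[OF integral_norm_bound]) (simp add: norm_mult)
      ultimately have "norm (piece lam f a l x) \<le> 2 * l powr (1 - 1 / p) * mass p f a l powr (1 / p)" for x
        by (meson order_trans)
      then have "norm (piece lam f a l x) powr q \<le> (2 * l powr (1 - 1 / p) * mass p f a l powr (1 / p)) powr q" for x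
        using q0 by (intro powr_mono2) auto
      also have "(2 * l powr (1 - 1 / p) * mass p f a l powr (1 / p)) powr q
          = 2 powr q * (l powr (q * (1 - 1 / p)) * mass p f a l powr (q / p))"
        by (simp add: powr_mult powr_powr mult.commute)
      also have "\<dots> \<le> 2 powr q * y a l"
        unfolding y_def
      proof (intro mult_left_mono mult_right_mono)
        have "gain \<le> q * (1 - 1 / p)" using beta_pos[OF \<alpha>] unfolding gain_def by (simp add: beta)
        then show "l powr (q * (1 - 1 / p)) \<le> l powr gain" using al by (intro powr_mono') auto
      qed auto
      finally have "norm (piece lam f a l x) powr q \<le> 2 powr q * y a l" for x .
      then have "X a l \<le> (\<integral>\<^sup>+x. ennreal (2 powr q * y a l) \<partial>?\<mu>)"
        unfolding X_def by (intro nn_integral_mono ennreal_leI)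
      also have "\<dots> = ennreal (2 powr q * y a l) * ennreal (measure ?\<mu> (space ?\<mu>))"
        by (simp add: mu.emeasure_eq_measure)
      also have "\<dots> = ennreal (m0 * y a l)"
        using y0[of a l] by (simp add: m0_def ennreal_mult[symmetric] mult_ac)
      finally show ?thesis .
    qed
    \<comment> \<open>One step acts on the coefficient by c -> c/2 + K, whose fixed point is 2K;
      hence this form.\<close>
    have iter: "X a l \<le> ennreal ((m0 / 2 ^ n + 2 * K) * y a l)"
      if al: "0 \<le> a" "0 < l" "a + l \<le> 1" "l \<le> l0" for a l n
      using al
    proof (induction n arbitrary: a l)
      case 0
      have "m0 * y a l \<le> (m0 / 2 ^ 0 + 2 * K) * y a l" using K y0 by (intro mult_right_mono) auto
      then show ?case using base[OF 0(1-3)] by (meson ennreal_leI order_trans)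
    next
      case (Suc n)
      define w where "w = l / A"
      have w: "w > 0" "real A * w = l" "w \<le> l" using A Suc.prems by (simp_all add: w_def divide_le_eq)
      let ?m = "m0 / 2 ^ n + 2 * K"
      have m: "?m \<ge> 0" using m0 K by simp
      have IH: "X (a + real k * w) w \<le> ennreal (?m * y (a + real k * w) w)" if "k < A" for k
      proof (rule Suc.IH)
        have "(real k + 1) * w \<le> real A * w" using that w by (intro mult_right_mono) auto
        then show "a + real k * w + w \<le> 1" using w Suc.prems by (simp add: distrib_right)
      qed (use w Suc.prems in auto)
      have msplit: "mass p f a l = (\<Sum>k<A. mass p f (a + real k * w) w)"
        using integral_split_pieces[of a A w "\<lambda>t. norm (f t) powr p"] w
          integrable_lebesgue_on_subset[OF fp sub01[OF Suc.prems(1,3)]] by (simp add: mass_def)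
      have "(\<Sum>k<A. mass p f (a + real k * w) w powr (q / p)) \<le> mass p f a l powr (q / p)"
        unfolding msplit by (rule powr_sum_le) (use qp p in \<open>auto simp: mass_nonneg\<close>)
      then have "(\<Sum>k<A. y (a + real k * w) w) \<le> w powr gain * mass p f a l powr (q / p)"
        unfolding y_def sum_distrib_left[symmetric] by (intro mult_left_mono) auto
      also have "w powr gain = real A powr (- gain) * l powr gain"
        using A Suc.prems by (simp add: w_def powr_divide powr_minus_divide)
      finally have ysum: "(\<Sum>k<A. y (a + real k * w) w) \<le> real A powr (- gain) * y a l"
        by (simp add: y_def mult_ac)
      have "X a l \<le> ennreal ?D * (\<Sum>k<A. X (a + real k * w) w) + ennreal (K * y a l)"
        using C(4)[OF Suc.prems(1-4) lam fi fp, of R] unfolding X_def w_def K_def y_def by (simp only: mult.assoc)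
      also have "\<dots> \<le> ennreal ?D * (\<Sum>k<A. ennreal (?m * y (a + real k * w) w)) + ennreal (K * y a l)"
        by (intro add_right_mono mult_left_mono sum_mono IH) auto
      also have "(\<Sum>k<A. ennreal (?m * y (a + real k * w) w)) = ennreal (?m * (\<Sum>k<A. y (a + real k * w) w))"
        unfolding sum_distrib_left by (intro sum_ennreal mult_nonneg_nonneg m y0)
      also have "ennreal ?D * \<dots> + ennreal (K * y a l) = ennreal (?D * (?m * (\<Sum>k<A. y (a + real k * w) w)) + K * y a l)"
        using m y0 K by (subst ennreal_plus) (auto intro!: mult_nonneg_nonneg sum_nonneg simp: ennreal_mult' sum_nonneg)
      also have "\<dots> \<le> ennreal ((m0 / 2 ^ Suc n + 2 * K) * y a l)"
      proof (rule ennreal_leI)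
        have "?D * (?m * (\<Sum>k<A. y (a + real k * w) w)) \<le> ?D * (?m * (real A powr (- gain) * y a l))"
          using m by (intro mult_left_mono ysum) auto
        also have "\<dots> = (?D * real A powr (- gain)) * (?m * y a l)" by (simp only: mult_ac)
        also have "\<dots> \<le> 1 / 2 * (?m * y a l)" using m y0 by (intro mult_right_mono DA mult_nonneg_nonneg) auto
        finally show "?D * (?m * (\<Sum>k<A. y (a + real k * w) w)) + K * y a l \<le> (m0 / 2 ^ Suc n + 2 * K) * y a l"
          by (simp add: algebra_simps)
      qed
      finally show ?case .
    qed
    have "(\<lambda>n. (m0 * (1 / 2) ^ n + 2 * K) * y a0 l0') \<longlonglongrightarrow> (m0 * 0 + 2 * K) * y a0 l0'"
      by (intro tendsto_intros LIMSEQ_realpow_zero) auto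
    then have lim: "(\<lambda>n. ennreal ((m0 * (1 / 2) ^ n + 2 * K) * y a0 l0')) \<longlonglongrightarrow> ennreal ((m0 * 0 + 2 * K) * y a0 l0')"
      by (rule tendsto_ennrealI)
    have le: "X a0 l0' \<le> ennreal ((m0 * (1 / 2) ^ n + 2 * K) * y a0 l0')" for n
      using iter[OF al0, of n] by (simp add: power_divide)
    have "X a0 l0' \<le> ennreal ((m0 * 0 + 2 * K) * y a0 l0')"
      by (rule LIMSEQ_le_const[OF lim]) (use le in blast)
    then show "(\<integral>\<^sup>+x. ennreal (norm (piece lam f a0 l0' x) powr q) \<partial>?\<mu>)
        \<le> ennreal (2 * C * lam powr (- \<alpha>) * (l0' powr gain * mass p f a0 l0' powr (q / p)))"
      by (simp add: X_def K_def y_def mult.assoc)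
  qed
qed

text \<open>Lifts the restrictions to short arcs and to balls: [0,1] is cut into a number of arcs
  that depends only on \<open>l0\<close>, and monotone convergence lets the ball grow.\<close>

lemma global_estimate:
  assumes qp: "p \<le> q" and e: "gain > 0"
  obtains C where "C > 0"
    "\<And>lam f. lam > 0 \<Longrightarrow> integrable (lebesgue_on {0..1}) f \<Longrightarrow>
      integrable (lebesgue_on {0..1}) (\<lambda>t. norm (f t) powr p) \<Longrightarrow>
      (\<integral>\<^sup>+x. ennreal (norm (osc_on {0..1} lam f x) powr q) \<partial>\<mu>)
        \<le> ennreal (C * lam powr (- \<alpha>) * (LINT t|lebesgue_on {0..1}. norm (f t) powr p) powr (q / p))"
proof -
  obtain C l0 where C: "C > 0" "l0 > 0" "l0 \<le> 1"
    "\<And>a l lam R f. 0 \<le> a \<Longrightarrow> 0 < l \<Longrightarrow> a + l \<le> 1 \<Longrightarrow> l \<le> l0 \<Longrightarrow> lam > 0 \<Longrightarrow>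
      integrable (lebesgue_on {0..1}) f \<Longrightarrow>
      integrable (lebesgue_on {0..1}) (\<lambda>t. norm (f t) powr p) \<Longrightarrow>
      (\<integral>\<^sup>+x. ennreal (norm (piece lam f a l x) powr q) \<partial>mu_ball R)
        \<le> ennreal (C * lam powr (- \<alpha>) * (l powr gain * mass p f a l powr (q / p)))"
    by (rule local_estimate[OF qp e]) (rule that)
  have q0: "q > 0" using q by (rule less_le_trans[rotated]) simp
  define N where "N = nat \<lceil>1 / l0\<rceil>"
  have N1: "real N \<ge> 1 / l0" unfolding N_def by linarith
  have "1 / l0 > 0" using C(2) by simp
  then have Np: "real N > 0" using N1 by linarith
  then have N: "N > 0" "1 / real N \<le> l0" using N1 C(2) by (auto simp: field_simps)
  define w where "w = 1 / real N"
  have w: "w > 0" "real N * w = 1" "w \<le> l0" using N by (simp_all add: w_def)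
  let ?C = "real N powr q * (real N * C)"
  show ?thesis
  proof (rule that)
    show "?C > 0" using N C(1) by simp
    fix lam :: real and f :: "real \<Rightarrow> complex"
    assume lam: "lam > 0" and fi: "integrable (lebesgue_on {0..1}) f"
      and fp: "integrable (lebesgue_on {0..1}) (\<lambda>t. norm (f t) powr p)"
    define T where "T x = (osc_on {0..1} lam f x)" for x
    define m where "m = (LINT t|lebesgue_on {0..1}. norm (f t) powr p)"
    let ?B = "?C * lam powr (- \<alpha>) * m powr (q / p)"
    have Tm: "T \<in> borel_measurable \<mu>"
      using osc_measurable[OF borel_measurable_integrable[OF fi], of lam] unfolding T_def measurable_cong_sets[OF mu refl] by simp
    let ?J = "\<lambda>k. {0 + real k * w..<0 + real k * w + w}"
    have sub: "?J k \<subseteq> {0..1}" "real k * w + w \<le> 1" if "k < N" for k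
    proof -
      have "(real k + 1) * w \<le> real N * w" using that w by (intro mult_right_mono) auto
      then show 1: "real k * w + w \<le> 1" using w(2) by (simp add: distrib_right)
      define y where "y = real k * w"
      have "0 \<le> y" using w by (simp add: y_def)
      then show "?J k \<subseteq> {0..1}"
        using 1 unfolding y_def[symmetric] by auto
    qed
    have Ei: "integrable (lebesgue_on {0..1}) (\<lambda>t. f t * iexp (lam * (x \<bullet> \<gamma> t)))" for x
      by (rule piece_integrable[OF fi]) auto
    have T: "T x = (\<Sum>k<N. piece lam f (0 + real k * w) w x)" for x
    proof -
      \<comment> \<open>The half-open pieces miss the endpoint 1, a null set. The summand
        \<open>0 +\<close> matches the form of \<open>integral_split_pieces\<close>.\<close>
      have "T x = (LINT t|lebesgue_on {0..<0 + real N * w}. f t * iexp (lam * (x \<bullet> \<gamma> t)))"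
        unfolding T_def w(2) using integral_atLeastLessThan_eq[OF Ei] by simp
      also have "\<dots> = (\<Sum>k<N. piece lam f (0 + real k * w) w x)"
        unfolding piece_def
        by (rule integral_split_pieces[OF _ w(1)], rule integrable_lebesgue_on_subset[OF Ei]) (auto simp: w(2))
      finally show ?thesis .
    qed
    have mass_le: "mass p f (0 + real k * w) w \<le> m" if "k < N" for k
      unfolding mass_def m_def
    proof -
      have "(LINT t|lebesgue_on (?J k). norm (f t) powr p) = (LINT t|lebesgue. indicator (?J k) t *\<^sub>R (norm (f t) powr p))"
        by (simp add: integral_restrict_space)
      also have "\<dots> \<le> (LINT t|lebesgue. indicator {0..1} t *\<^sub>R (norm (f t) powr p))"
      proof (rule integral_mono)
        show "integrable lebesgue (\<lambda>t. indicator (?J k) t *\<^sub>R (norm (f t) powr p))"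
          using integrable_lebesgue_on_subset[OF fp sub(1)[OF that]] by (simp add: integrable_restrict_space)
        show "integrable lebesgue (\<lambda>t. indicator {0..1} t *\<^sub>R (norm (f t) powr p))"
          using fp by (simp add: integrable_restrict_space)
        show "indicator (?J k) t *\<^sub>R (norm (f t) powr p) \<le> indicator {0..1} t *\<^sub>R (norm (f t) powr p)" for t
          using subsetD[OF sub(1)[OF that], of t] by (cases "t \<in> ?J k") (auto simp: indicator_def)
      qed
      also have "\<dots> = (LINT t|lebesgue_on {0..1}. norm (f t) powr p)" by (simp add: integral_restrict_space)
      finally show "(LINT t|lebesgue_on (?J k). norm (f t) powr p) \<le> (LINT t|lebesgue_on {0..1}. norm (f t) powr p)" .
    qed
    let ?u = "\<lambda>k x. ennreal (norm (piece lam f (0 + real k * w) w x) powr q)"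
    let ?t = "\<lambda>x. ennreal (norm (T x) powr q)"
    let ?g = "\<lambda>n x. ?t x * indicator (ball 0 (real n)) x"
    have fin: "(\<integral>\<^sup>+x. ?t x \<partial>mu_ball R) \<le> ennreal ?B" for R
    proof -
      let ?\<mu> = "mu_ball R"
      have pm: "?u k \<in> borel_measurable ?\<mu>" if "k < N" for k
      proof -
        have "f \<in> borel_measurable (lebesgue_on (?J k))"
          using integrable_lebesgue_on_subset[OF fi sub(1)[OF that]] by (simp add: borel_measurable_integrable)
        then have "(\<lambda>x. piece lam f (0 + real k * w) w x) \<in> borel_measurable borel"
          unfolding piece_def using sub(1)[OF that] by (intro osc_measurable) auto
        then have "(\<lambda>x. piece lam f (0 + real k * w) w x) \<in> borel_measurable \<mu>"
          unfolding measurable_cong_sets[OF mu refl] .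
        from measurable_restrict_space1[OF this] show ?thesis by measurable
      qed
      have "(\<integral>\<^sup>+x. ?t x \<partial>?\<mu>)
        \<le> (\<integral>\<^sup>+x. ennreal (real N powr q) * (\<Sum>k<N. ?u k x) \<partial>?\<mu>)"
      proof (rule nn_integral_mono)
        fix x
        have "norm (T x) powr q \<le> real N powr q * (\<Sum>k<N. norm (piece lam f (0 + real k * w) w x) powr q)"
          unfolding T using norm_sum_powr_le[of "{..<N}" q "\<lambda>k. piece lam f (0 + real k * w) w x"] q0 by simp
        from ennreal_leI[OF this]
        show "?t x \<le> ennreal (real N powr q) * (\<Sum>k<N. ?u k x)"
          by (simp add: ennreal_mult sum_nonneg)
      qed
      also have "\<dots> = ennreal (real N powr q) * (\<Sum>k<N. \<integral>\<^sup>+x. ?u k x \<partial>?\<mu>)"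
      proof -
        have 1: "(\<lambda>x. \<Sum>k<N. ?u k x) \<in> borel_measurable ?\<mu>"
          by (rule borel_measurable_sum, rule pm) simp
        show ?thesis unfolding nn_integral_cmult[OF 1] by (subst nn_integral_sum[OF pm]) auto
      qed
      also have "\<dots> \<le> ennreal (real N powr q) * (\<Sum>k<N. ennreal (C * lam powr (- \<alpha>) * m powr (q / p)))"
      proof (intro mult_left_mono sum_mono)
        fix k assume "k \<in> {..<N}"
        then have k: "k < N" by simp
        have "(\<integral>\<^sup>+x. ?u k x \<partial>?\<mu>)
          \<le> ennreal (C * lam powr (- \<alpha>) * (w powr gain * mass p f (0 + real k * w) w powr (q / p)))"
          by (rule C(4)[OF _ w(1) _ w(3) lam fi fp]) (use w sub(2)[OF k] in simp_all)
        also have "\<dots> \<le> ennreal (C * lam powr (- \<alpha>) * (1 * m powr (q / p)))"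
        proof (intro ennreal_leI mult_left_mono mult_mono)
          show "w powr gain \<le> 1" using powr_mono2[of gain w 1] e w C(3) by simp
          show "mass p f (0 + real k * w) w powr (q / p) \<le> m powr (q / p)"
            using q0 p by (intro powr_mono2 mass_le k mass_nonneg) auto
        qed (use C(1) in auto)
        finally show "(\<integral>\<^sup>+x. ?u k x \<partial>?\<mu>)
          \<le> ennreal (C * lam powr (- \<alpha>) * m powr (q / p))" by simp
      qed auto
      also have "\<dots> = ennreal ?B"
        using C(1) by (simp add: ennreal_of_nat_eq_real_of_nat ennreal_mult[symmetric] mult_ac)
      finally show ?thesis .
    qed
    have "(\<integral>\<^sup>+x. ?t x \<partial>\<mu>) = (\<integral>\<^sup>+x. (SUP n. ?g n x) \<partial>\<mu>)"
    proof (intro nn_integral_cong antisym)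
      fix x :: "real ^ 'n"
      obtain n where "norm x < real n" using reals_Archimedean2 by blast
      then show "?t x \<le> (SUP n. ?g n x)"
        by (intro SUP_upper2[of n]) auto
      show "(SUP n. ?g n x) \<le> ?t x"
        by (intro SUP_least) (auto simp: indicator_def)
    qed
    also have "\<dots> = (SUP n. \<integral>\<^sup>+x. ?g n x \<partial>\<mu>)"
    proof (rule nn_integral_monotone_convergence_SUP)
      show "incseq (?g)"
        by (intro incseq_SucI le_funI mult_left_mono) (auto simp: indicator_def)
      have "ball 0 (real n) \<in> sets \<mu>" for n by (simp add: mu)
      then show "(\<lambda>x. ?g n x) \<in> borel_measurable \<mu>" for n
        using Tm by measurable
    qed
    also have "\<dots> \<le> ennreal ?B"
    proof (rule SUP_least)
      fix n
      have "(\<integral>\<^sup>+x. ?g n x \<partial>\<mu>) = (\<integral>\<^sup>+x. ?t x \<partial>restrict_space \<mu> (ball 0 (real n)))"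
        by (rule nn_integral_restrict_space[symmetric]) (simp add: mu)
      then show "(\<integral>\<^sup>+x. ?g n x \<partial>\<mu>) \<le> ennreal ?B"
        using fin[of "real n"] by simp
    qed
    finally show "(\<integral>\<^sup>+x. ennreal (norm (osc_on {0..1} lam f x) powr q) \<partial>\<mu>)
        \<le> ennreal (?C * lam powr (- \<alpha>) * (LINT t|lebesgue_on {0..1}. norm (f t) powr p) powr (q / p))"
      unfolding T_def m_def .
  qed
qed

end

section \<open>The restriction estimate\<close>

lemma Lp_space_finite_exponent:
  assumes "f \<in> Lp_space M (ereal r)"
  shows "integrable M (\<lambda>x. norm (f x) powr r)"
    "Lp_norm M (ereal r) f = ennreal ((LINT x|M. norm (f x) powr r) powr (1 / r))"
proof -
  let ?J = "\<integral>\<^sup>+x. ennreal (norm (f x) powr r) \<partial>M"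
  have f[measurable]: "f \<in> borel_measurable M" and fin: "Lp_norm M (ereal r) f < \<infinity>"
    using assms by (auto simp: Lp_space_def)
  have "?J \<noteq> \<infinity>" using fin by (auto simp: Lp_norm_def Let_def)
  then show int: "integrable M (\<lambda>x. norm (f x) powr r)"
    by (intro integrableI_nonneg) (auto simp: less_top)
  have "?J = ennreal (LINT x|M. norm (f x) powr r)"
    by (rule nn_integral_eq_integral[OF int]) auto
  then show "Lp_norm M (ereal r) f = ennreal ((LINT x|M. norm (f x) powr r) powr (1 / r))"
    by (simp add: Lp_norm_def)
qed

lemma Lp_norm_le:
  assumes "r > 0" "B \<ge> 0" "(\<integral>\<^sup>+x. ennreal (norm (f x) powr r) \<partial>M) \<le> ennreal B"
  shows "Lp_norm M (ereal r) f \<le> ennreal (B powr (1 / r))"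
proof -
  let ?J = "\<integral>\<^sup>+x. ennreal (norm (f x) powr r) \<partial>M"
  have J: "?J \<noteq> \<infinity>" using assms(3) by (auto simp: top_unique)
  have "enn2real ?J \<le> B" using assms by (intro enn2real_leI) auto
  then have "enn2real ?J powr (1 / r) \<le> B powr (1 / r)"
    using assms by (intro powr_mono2) auto
  then show ?thesis using J by (simp add: Lp_norm_def ennreal_leI)
qed

text \<open>The factor 2 comes from \<open>integral_le_powr\<close>. It is also paid when r = p or p
  = \<infinity>, so that all these cases have one form.\<close>

lemma Lp_space_embed:
  assumes M: "finite_measure M" "measure M (space M) \<le> 1"
    and f: "f \<in> Lp_space M p" and r: "1 \<le> r" "ereal r \<le> p"
  shows "integrable M (\<lambda>x. norm (f x) powr r)"
    "ennreal ((LINT x|M. norm (f x) powr r) powr (1 / r)) \<le> ennreal 2 * Lp_norm M p f"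
proof -
  interpret finite_measure M by fact
  have fm[measurable]: "f \<in> borel_measurable M" using f by (simp add: Lp_space_def)
  have "integrable M (\<lambda>x. norm (f x) powr r) \<and>
    ennreal ((LINT x|M. norm (f x) powr r) powr (1 / r)) \<le> ennreal 2 * Lp_norm M p f"
  proof (cases p)
    case (real s)
    then have rs: "r \<le> s" using r by simp
    have fs: "f \<in> Lp_space M (ereal s)" using f real by simp
    let ?N = "LINT x|M. norm (f x) powr s"
    note N = Lp_space_finite_exponent[OF fs]
    have eq: "(norm (f x) powr r) powr (s / r) = norm (f x) powr s" for x
      using r by (simp add: powr_powr)
    have sr: "1 \<le> s / r" using r rs by simp
    have m: "(\<lambda>x. norm (f x) powr r) \<in> borel_measurable M" by measurable
    note * = integral_le_powr[OF M(1) m _ sr _ _ M(2), unfolded eq, OF _ N(1) order_refl]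
    have "(LINT x|M. norm (f x) powr r) \<le> 2 * ?N powr (r / s)" using *(2) by simp
    then have "(LINT x|M. norm (f x) powr r) powr (1 / r) \<le> (2 * ?N powr (r / s)) powr (1 / r)"
      using r by (intro powr_mono2) auto
    also have "\<dots> = 2 powr (1 / r) * ?N powr (1 / s)"
      using r by (simp add: powr_mult powr_powr)
    also have "\<dots> \<le> 2 powr 1 * ?N powr (1 / s)"
      using r by (intro mult_right_mono powr_mono) auto
    finally have "ennreal ((LINT x|M. norm (f x) powr r) powr (1 / r)) \<le> ennreal (2 * ?N powr (1 / s))"
      by (intro ennreal_leI) simp
    then show ?thesis using *(1) N(2) real by (simp add: ennreal_mult')
  next
    case PInf
    let ?g = "\<lambda>x. ennreal (norm (f x))"
    have "esssup M ?g < \<infinity>" using f PInf by (simp add: Lp_space_def Lp_norm_def)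
    then obtain c where c: "c \<ge> 0" "esssup M ?g = ennreal c" by (cases "esssup M ?g") auto
    have ae: "AE x in M. norm (f x) \<le> c"
      using esssup_AE[of ?g M] unfolding c(2) by eventually_elim (simp add: c(1))
    have aer: "AE x in M. norm (f x) powr r \<le> c powr r"
      using ae by eventually_elim (use r in \<open>auto intro: powr_mono2\<close>)
    have int: "integrable M (\<lambda>x. norm (f x) powr r)"
      by (rule integrable_const_bound[of _ "c powr r"]) (use aer in auto)
    have "(LINT x|M. norm (f x) powr r) \<le> (LINT x|M. c powr r)"
      by (rule integral_mono_AE[OF int _ aer]) simp
    also have "\<dots> \<le> c powr r" using M(2) by (simp add: mult_left_le_one_le)
    finally have "(LINT x|M. norm (f x) powr r) powr (1 / r) \<le> (c powr r) powr (1 / r)"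
      using r by (intro powr_mono2) auto
    also have "\<dots> = c" using r c by (simp add: powr_powr)
    finally have "ennreal ((LINT x|M. norm (f x) powr r) powr (1 / r)) \<le> ennreal (2 * c)"
      using c(1) by (intro ennreal_leI) linarith
    then show ?thesis using int c PInf by (simp add: Lp_norm_def ennreal_mult')
  qed (use r in simp)
  then show "integrable M (\<lambda>x. norm (f x) powr r)"
    "ennreal ((LINT x|M. norm (f x) powr r) powr (1 / r)) \<le> ennreal 2 * Lp_norm M p f"
    by blast+
qed

theorem theorem1p1:
  fixes \<gamma> :: "real \<Rightarrow> real ^ 'n::finite"
    and \<alpha> :: real and \<mu> :: "(real ^ 'n) measure" and p q :: ereal
  assumes "CARD('n) \<ge> 2"
    and "Ck_on (CARD('n) + 1) {0..1} \<gamma>"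
    and "0 < \<alpha>" and "\<alpha> \<le> real CARD('n)"
    and "sets \<mu> = sets borel"
    and "\<forall>t\<in>{0..1}. det (deriv_matrix {0..1} \<gamma> t) \<noteq> 0"
    and "\<exists>C\<^sub>\<mu>::real. \<forall>x \<rho>. \<rho> > 0 \<longrightarrow> emeasure \<mu> (ball x \<rho>) \<le> ennreal (C\<^sub>\<mu> * \<rho> powr \<alpha>)"
    and "1 \<le> p" and "1 \<le> q"
    and "ereal (real CARD('n)) / q \<le> 1 - 1 / p"
    and "q \<ge> ereal (2 * real CARD('n))"
    and "ereal (beta CARD('n) \<alpha>) / q + 1 / p < 1"
    and "q > ereal (beta CARD('n) \<alpha> + 1)"
  shows "\<exists>C::real. C \<ge> 0 \<and>
    (\<forall>f \<in> Lp_space (lebesgue_on {0..1}) p. \<forall>lam::real. lam \<ge> 1 \<longrightarrow>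
       Lp_norm \<mu> q (osc_op \<gamma> lam f)
         \<le> ennreal (C * lam powr (- real_of_ereal (ereal \<alpha> / q))) * Lp_norm (lebesgue_on {0..1}) p f)"
proof -
  interpret nondegenerate_curve \<gamma>
    by unfold_locales (use assms(2,6) in auto)
  let ?d = "real CARD('n)" and ?\<beta> = "beta CARD('n) \<alpha>"
  let ?L = "lebesgue_on {0..1::real}"
  have d: "?d \<ge> 2" using assms(1) by simp
  have L: "finite_measure ?L" "measure ?L (space ?L) \<le> 1"
    by (rule finite_measure_lebesgue_on_subset[of _ 0 1]) (auto simp: measure_restrict_space)
  obtain M where ball: "\<And>x \<rho>. \<rho> > 0 \<Longrightarrow> emeasure \<mu> (ball x \<rho>) \<le> ennreal (M * \<rho> powr \<alpha>)"
    using assms(7) by blast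
  have osc: "osc_op \<gamma> lam f = (\<lambda>x. LINT t|?L. f t * iexp (lam * (x \<bullet> \<gamma> t)))" for lam f
    by (simp add: osc_op_def fun_eq_iff mult.commute)
  show ?thesis
  proof (cases q)
    \<comment> \<open>Here \<alpha>/q = 0, so no decay in lam is claimed and the pointwise bound by
      the L^1 norm of f suffices.\<close>
    case PInf
    show ?thesis
    proof (intro exI[of _ 2] conjI ballI allI impI)
      fix f lam assume f: "f \<in> Lp_space ?L p" and lam: "lam \<ge> (1::real)"
      have fm: "f \<in> borel_measurable ?L" using f by (simp add: Lp_space_def)
      have *: "ennreal (LINT t|?L. norm (f t)) \<le> ennreal 2 * Lp_norm ?L p f"
        using Lp_space_embed(2)[OF L f, of 1] assms(8) by (simp add: one_ereal_def)
      have "osc_op \<gamma> lam f \<in> borel_measurable \<mu>"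
        using osc_measurable[OF fm, of lam] unfolding osc measurable_cong_sets[OF assms(5) refl] by simp
      then have m: "(\<lambda>x. ennreal (norm (osc_op \<gamma> lam f x))) \<in> borel_measurable \<mu>" by measurable
      have "norm (osc_op \<gamma> lam f x) \<le> (LINT t|?L. norm (f t))" for x
        unfolding osc by (rule order_trans[OF integral_norm_bound]) (simp add: norm_mult)
      then have "ennreal (norm (osc_op \<gamma> lam f x)) \<le> ennreal 2 * Lp_norm ?L p f" for x
        by (rule order_trans[OF ennreal_leI *])
      then have "Lp_norm \<mu> q (osc_op \<gamma> lam f) \<le> ennreal 2 * Lp_norm ?L p f"
        using m by (auto simp: Lp_norm_def PInf)
      then show "Lp_norm \<mu> q (osc_op \<gamma> lam f)
         \<le> ennreal (2 * lam powr (- real_of_ereal (ereal \<alpha> / q))) * Lp_norm ?L p f"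
        using lam by (simp add: PInf)
    qed simp
  next
    case (real r)
    have r: "r \<ge> 2 * ?d" "r > ?\<beta> + 1" using assms(11,13) real by auto
    have r0: "r > 0" using r d by linarith
    \<comment> \<open>The exponent s = min p q, which is real even if p is infinite. L^p embeds in
      L^s on [0,1], and the iteration requires s <= q.\<close>
    obtain s where s: "1 \<le> s" "ereal s \<le> p" "s \<le> r" "?d / r \<le> 1 - 1 / s" "r * (1 - 1 / s) - ?\<beta> > 0"
    proof (cases "p \<le> q")
      case True
      then obtain s where p: "p = ereal s" using assms(8) real by (cases p) auto
      have s: "s \<ge> 1" using assms(8) p by (simp add: one_ereal_def)
      have 1: "1 / p = ereal (1 / s)" using s by (simp add: p one_ereal_def)
      have 2: "ereal x / q = ereal (x / r)" for x using r0 by (simp add: real)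
      have "?d / r \<le> 1 - 1 / s" using assms(10) unfolding 1 2 by (simp add: one_ereal_def)
      moreover have "?\<beta> / r + 1 / s < 1" using assms(12) unfolding 1 2 by (simp add: one_ereal_def)
      then have "r * (?\<beta> / r) < r * (1 - 1 / s)" using r0 by (intro mult_strict_left_mono) auto
      then have "r * (1 - 1 / s) - ?\<beta> > 0" using r0 by simp
      ultimately show ?thesis using s True by (intro that[of s]) (auto simp: p real)
    next
      case False
      \<comment> \<open>For s = r the condition d/r <= 1 - 1/r is a consequence of r >= 2d and d >=
        2: both fractions are at most one half.\<close>
      have "?d / r \<le> 1 / 2" using r(1) r0 by (simp add: divide_le_eq)
      moreover have "1 / r \<le> 1 / 2" using r(1) d by (intro divide_left_mono) auto
      ultimately have "?d / r \<le> 1 - 1 / r" by linarith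
      moreover have "r * (1 - 1 / r) - ?\<beta> > 0" using r(2) r0 by (simp add: right_diff_distrib)
      ultimately show ?thesis using False r d by (intro that[of r]) (auto simp: real)
    qed
    have r2: "real (2 * CARD('n)) \<le> r" using r(1) by simp
    interpret restriction_exponents \<gamma> \<mu> \<alpha> ?\<beta> M s r
      by unfold_locales (use assms(3,4,5) ball r2 s(1,4) in auto)
    have gain: "gain > 0" using s(5) by (simp add: gain_def)
    obtain C where C: "C > 0"
      "\<And>lam f. lam > 0 \<Longrightarrow> integrable ?L f \<Longrightarrow> integrable ?L (\<lambda>t. norm (f t) powr s) \<Longrightarrow>
        (\<integral>\<^sup>+x. ennreal (norm (LINT t|?L. f t * iexp (lam * (x \<bullet> \<gamma> t))) powr r) \<partial>\<mu>)
          \<le> ennreal (C * lam powr (- \<alpha>) * (LINT t|?L. norm (f t) powr s) powr (r / s))"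
      by (rule global_estimate[OF s(3) gain]) (rule that)
    show ?thesis
    proof (intro exI[of _ "2 * C powr (1 / r)"] conjI ballI allI impI)
      fix f lam assume f: "f \<in> Lp_space ?L p" and lam: "lam \<ge> (1::real)"
      have fm: "f \<in> borel_measurable ?L" using f by (simp add: Lp_space_def)
      have fi: "integrable ?L f"
        using Lp_space_embed(1)[OF L f, of 1] assms(8) fm by (simp add: one_ereal_def integrable_norm_iff)
      let ?N = "LINT t|?L. norm (f t) powr s"
      note fs = Lp_space_embed[OF L f s(1,2)]
      let ?B = "C * lam powr (- \<alpha>) * ?N powr (r / s)"
      have "Lp_norm \<mu> (ereal r) (osc_op \<gamma> lam f) \<le> ennreal (?B powr (1 / r))"
        unfolding osc by (rule Lp_norm_le[OF r0 _ C(2)[OF _ fi fs(1)]]) (use C(1) lam in auto)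
      also have "?B powr (1 / r) = C powr (1 / r) * lam powr (- (\<alpha> / r)) * ?N powr (1 / s)"
        using r0 C(1) by (simp add: powr_mult powr_powr)
      also have "ennreal \<dots> = ennreal (C powr (1 / r) * lam powr (- (\<alpha> / r))) * ennreal (?N powr (1 / s))"
        by (rule ennreal_mult) auto
      also have "\<dots> \<le> ennreal (C powr (1 / r) * lam powr (- (\<alpha> / r))) * (ennreal 2 * Lp_norm ?L p f)"
        by (intro mult_left_mono fs(2)) auto
      also have "\<dots> = ennreal (2 * C powr (1 / r) * lam powr (- (\<alpha> / r))) * Lp_norm ?L p f"
        by (simp add: ennreal_mult mult_ac)
      finally show "Lp_norm \<mu> q (osc_op \<gamma> lam f)
         \<le> ennreal (2 * C powr (1 / r) * lam powr (- real_of_ereal (ereal \<alpha> / q))) * Lp_norm ?L p f"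
        using r0 by (simp add: real)
    qed simp
  qed (use assms(9) in simp)
qed

end
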